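(* Let $R$ be a one-dimensional complete local domain as in the context, with embedding dimension $n$ and conductor $\mathfrak{C}_R\subseteq\mathfrak{m}_R^2$. Let $S=R\left[\frac{\mathfrak{C}_R}{x_1}\right]=R[T_1,\dots,T_s]$ be constructed as in the context, where $s$ is the reduced type of $R$. Suppose $\ell(\tau(\Omega_S))\geq N:=ns+\binom{s}{2}+1$, and that there are $k$-linearly independent torsion elements $\tau_1,\dots,\tau_N\in\tau(\Omega_S)$, each of which can be written as $\sum_{i=1}^n r_i\,dx_i+\sum_{j=1}^s r_j'\,dT_j$ with $r_i,r_j'\in S$ and every $r_j'$ a non-unit of $S$. Then some $k$-linear combination of these torsion elements can be pulled back to a nonzero torsion element of $\Omega_R$, i.e. it is the image of a nonzero element of $\tau(\Omega_R)$ under the natural map $\Omega_R\to\Omega_S$, $dx_i\mapsto dx_i$. In particular, $\tau(\Omega_R)\neq 0$.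
   Context: $k$ is an algebraically closed field of characteristic $0$; $(R,\mathfrak{m}_R,k)$ is a one-dimensional complete equicharacteristic local $k$-algebra which is a domain, with residue field $k$, fraction field $Q$, integral closure $\overline{R}=k[[t]]$ and embedding dimension $n$. Write $R=k[[x_1,\dots,x_n]]$ with $x_i=\alpha_it^{a_i}$ minimal generators of $\mathfrak{m}_R$, $\alpha_i$ units of $\overline{R}$, $\alpha_1=1$ (achieved by choice of $t$), $a_1\le\cdots\le a_n$. The conductor is $\mathfrak{C}_R=\{q\in Q:q\overline{R}\subseteq R\}=t^{c}\overline{R}$, where $c=c_R$ is its least valuation. The reduced type of $R$ is $s=\dim_k\frac{(\mathfrak{C}_R,x_1)}{(x_1)}$. Set $\frac{\mathfrak{C}_R}{x_1}=\{\frac{z}{x_1}:z\in\mathfrak{C}_R\}$ and $S=R[\frac{\mathfrak{C}_R}{x_1}]\subseteq\overline{R}$. There are exactly $s$ integers in $\{c-a_1,\dots,c-1\}$ that are not $t$-adic valuations of nonzero elements of $R$; call them $b_1<\cdots<b_s$, and put $T_j=t^{b_j}$, so that $S=k[[x_1,\dots,x_n,T_1,\dots,T_s]]$, a complete local domain of embedding dimension $n+s$ when $\mathfrak{C}_R\subseteq \mathfrak{m}_R^2$. For a ring $A=k[[Y_1,\dots,Y_m]]/(F_1,\dots,F_r)$ with $(F_1,\dots,F_r)\subseteq (Y_1,\dots,Y_m)^2$ and $y_i$ the image of $Y_i$, the universally finite module of differentials $\Omega_A$ is the cokernel of the Jacobian matrix $A^r\xrightarrow{[\partial F_j/\partial y_i]}A^m$,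 with images of the standard basis vectors denoted $dy_1,\dots,dy_m$; $\tau(\Omega_A)$ is its torsion submodule. Thus $\Omega_R$ is generated by $dx_1,\dots,dx_n$ and $\Omega_S$ by $dx_1,\dots,dx_n,dT_1,\dots,dT_s$. $\ell$ denotes length. *)

theory Defs
  imports
    "HOL-Library.Poly_Mapping"
    "HOL-Library.Extended_Nat"
    "HOL-Computational_Algebra.Polynomial"
    "HOL-Computational_Algebra.Formal_Laurent_Series"
    "HOL-Algebra.Module"
    "HOL-Algebra.QuotRing"
    "HOL-Algebra.Ideal_Product"
    "HOL-Algebra.Generated_Rings"
    "HOL-Algebra.Embedded_Algebras"
begin

section \<open>Power series rings in finitely many variables\<close>

text \<open>A power series is its coefficient function on exponent vectors. The ring \<open>k[[Y\<^sub>0,\<dots>,Y\<^sub>m\<^sub>-\<^sub>1]]\<close>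
  consists of those whose exponents involve only the indices below \<open>m\<close>; all families are
  indexed from \<open>0\<close>, so the paper's \<open>x\<^sub>1\<close> is \<open>x 0\<close>.\<close>

type_synonym 'k mps = "(nat \<Rightarrow>\<^sub>0 nat) \<Rightarrow> 'k"

definition mps_ring :: "nat \<Rightarrow> ('k::field) mps ring" where
  "mps_ring m =
    \<lparr> carrier = {F. \<forall>\<alpha>. F \<alpha> \<noteq> 0 \<longrightarrow> Poly_Mapping.keys \<alpha> \<subseteq> {..<m}},
      monoid.mult = (\<lambda>F G \<alpha>. \<Sum>p\<in>{p. fst p + snd p = \<alpha>}. F (fst p) * G (snd p)),
      one = (\<lambda>\<alpha>. if \<alpha> = 0 then 1 else 0),
      zero = (\<lambda>\<alpha>. 0),
      add = (\<lambda>F G \<alpha>. F \<alpha> + G \<alpha>) \<rparr>"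

definition mps_var :: "nat \<Rightarrow> ('k::field) mps" where
  "mps_var i = (\<lambda>\<alpha>. if \<alpha> = Poly_Mapping.single i 1 then 1 else 0)"

definition mps_deriv :: "nat \<Rightarrow> ('k::field) mps \<Rightarrow> 'k mps" where
  "mps_deriv i F = (\<lambda>\<alpha>. of_nat (Poly_Mapping.lookup \<alpha> i + 1) * F (\<alpha> + Poly_Mapping.single i 1))"

text \<open>Substitution \<open>Y\<^sub>i \<mapsto> y\<^sub>i\<close>, for \<open>y\<^sub>i \<in> t k[[t]]\<close>. Monomials of total degree above \<open>N\<close> then do
  not contribute to the coefficient of \<open>t\<^sup>N\<close>, so the finite sum below is the full one.\<close>

definition mps_eval :: "nat \<Rightarrow> (nat \<Rightarrow> 'k fls) \<Rightarrow> ('k::field) mps \<Rightarrow> 'k fls" where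
  "mps_eval m y F = fps_to_fls (Abs_fps (\<lambda>N.
     \<Sum>\<alpha>\<in>{\<alpha>. Poly_Mapping.keys \<alpha> \<subseteq> {..<m} \<and> (\<Sum>i<m. Poly_Mapping.lookup \<alpha> i) \<le> N}.
       F \<alpha> * fls_nth (\<Prod>i<m. y i ^ Poly_Mapping.lookup \<alpha> i) (int N)))"


section \<open>Subrings of \<open>k((t))\<close>\<close>

text \<open>All rings live inside the field \<open>k((t))\<close>, the fraction field of \<open>k[[t]]\<close>.\<close>

definition fls_ring :: "('k::field) fls set \<Rightarrow> 'k fls ring" where
  "fls_ring A = \<lparr> carrier = A, monoid.mult = (*), one = 1, zero = 0, add = (+) \<rparr>"

definition power_series_alg :: "nat \<Rightarrow> (nat \<Rightarrow> 'k fls) \<Rightarrow> ('k::field) fls set" where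
  "power_series_alg m y = mps_eval m y ` carrier (mps_ring m)"

text \<open>The set of non-units, which is the maximal ideal when \<open>A\<close> is local.\<close>

definition maximal_id :: "('k::field) fls set \<Rightarrow> 'k fls set" where
  "maximal_id A = A - Units (fls_ring A)"

definition minimal_generators :: "nat \<Rightarrow> (nat \<Rightarrow> 'k fls) \<Rightarrow> ('k::field) fls set \<Rightarrow> bool" where
  "minimal_generators n x A \<longleftrightarrow>
     Idl\<^bsub>fls_ring A\<^esub> (x ` {..<n}) = maximal_id A \<and>
     (\<forall>i<n. Idl\<^bsub>fls_ring A\<^esub> (x ` ({..<n} - {i})) \<noteq> maximal_id A)"

definition frac_field :: "('k::field) fls set \<Rightarrow> 'k fls set" where
  "frac_field A = {p / q | p q. p \<in> A \<and> q \<in> A \<and> q \<noteq> 0}"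

definition int_closure :: "('k::field) fls set \<Rightarrow> 'k fls set" where
  "int_closure A = {q \<in> frac_field A.
     \<exists>p. Polynomial.lead_coeff p = 1 \<and> (\<forall>i. Polynomial.coeff p i \<in> A) \<and> poly p q = 0}"

definition conductor :: "('k::field) fls set \<Rightarrow> 'k fls set" where
  "conductor A = {q \<in> frac_field A. \<forall>f\<in>int_closure A. q * f \<in> A}"

definition conductor_val :: "('k::field) fls set \<Rightarrow> nat" where
  "conductor_val A = (LEAST c. \<exists>q\<in>conductor A. q \<noteq> 0 \<and> fls_subdegree q = int c)"

text \<open>The dimension over \<open>k\<close> of \<open>(C, x\<^sub>1) / (x\<^sub>1)\<close>, where \<open>C\<close> is the conductor, as a subspace of the
  \<open>k\<close>-algebra \<open>A / (x\<^sub>1)\<close>; the field \<open>k\<close> enters as its image in that quotient ring.\<close>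

definition reduced_type :: "('k::field) fls set \<Rightarrow> 'k fls \<Rightarrow> nat" where
  "reduced_type A x1 =
     (let P = fls_ring A; I = Idl\<^bsub>P\<^esub> {x1} in
      ring.dim (P Quot I)
        ((\<lambda>a. I +>\<^bsub>P\<^esub> fls_const a) ` UNIV)
        ((\<lambda>z. I +>\<^bsub>P\<^esub> z) ` (Idl\<^bsub>P\<^esub> (conductor A \<union> {x1}))))"

definition adjoin_conductor :: "('k::field) fls set \<Rightarrow> 'k fls \<Rightarrow> 'k fls set" where
  "adjoin_conductor A x1 = generate_ring (fls_ring UNIV) (A \<union> {z / x1 | z. z \<in> conductor A})"

text \<open>The integers in \<open>{c - a,\<dots>,c - 1}\<close> that are not valuations of nonzero elements of \<open>A\<close>;
  \<open>c - a \<le> e\<close> is written \<open>c \<le> e + a\<close> to avoid truncated subtraction.\<close>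

definition late_gaps :: "('k::field) fls set \<Rightarrow> nat \<Rightarrow> nat set" where
  "late_gaps A a = {e. conductor_val A \<le> e + a \<and> e < conductor_val A \<and>
     \<not> (\<exists>r\<in>A. r \<noteq> 0 \<and> fls_subdegree r = int e)}"

definition gap_monomial :: "('k::field) fls set \<Rightarrow> nat \<Rightarrow> nat \<Rightarrow> 'k fls" where
  "gap_monomial A a j = fls_X ^ (sorted_list_of_set (late_gaps A a) ! j)"

definition append_tuple :: "nat \<Rightarrow> (nat \<Rightarrow> 'a) \<Rightarrow> (nat \<Rightarrow> 'a) \<Rightarrow> nat \<Rightarrow> 'a" where
  "append_tuple n x T i = (if i < n then x i else T (i - n))"


section \<open>Modules\<close>

text \<open>In module records the fields \<open>mult\<close> and \<open>one\<close> carry no information.\<close>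

definition free_module :: "('k::field) fls set \<Rightarrow> nat \<Rightarrow> ('k fls, nat \<Rightarrow> 'k fls) module" where
  "free_module A m =
    \<lparr> carrier = {v. (\<forall>i<m. v i \<in> A) \<and> (\<forall>i\<ge>m. v i = 0)},
      monoid.mult = undefined, one = undefined,
      zero = (\<lambda>i. 0),
      add = (\<lambda>u v i. u i + v i),
      smult = (\<lambda>a v i. a * v i) \<rparr>"

definition quot_module :: "('r, 'a) module \<Rightarrow> 'a set \<Rightarrow> ('r, 'a set) module" where
  "quot_module M J =
    \<lparr> carrier = a_rcosets\<^bsub>M\<^esub> J,
      monoid.mult = undefined, one = undefined,
      zero = J,
      add = set_add M,
      smult = (\<lambda>a X. \<Union>v\<in>X. J +>\<^bsub>M\<^esub> (a \<odot>\<^bsub>M\<^esub> v)) \<rparr>"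

definition torsion :: "('r, 'm) ring_scheme \<Rightarrow> ('r, 'a) module \<Rightarrow> 'a set" where
  "torsion P M = {w \<in> carrier M. \<exists>a\<in>carrier P. a \<noteq> \<zero>\<^bsub>P\<^esub> \<and> a \<odot>\<^bsub>M\<^esub> w = \<zero>\<^bsub>M\<^esub>}"

text \<open>The length of the submodule \<open>H\<close> of \<open>M\<close>: the supremum of the lengths of strict chains of
  submodules contained in \<open>H\<close>.\<close>

definition module_length :: "('r, 'm) ring_scheme \<Rightarrow> ('r, 'a) module \<Rightarrow> 'a set \<Rightarrow> enat" where
  "module_length P M H =
     (SUP l\<in>{l. \<exists>f. (\<forall>i\<le>l. submodule (f i) P M \<and> f i \<subseteq> H) \<and> (\<forall>i<l. f i \<subset> f (Suc i))}. enat l)"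

definition lin_independent ::
    "(nat \<Rightarrow> 'a) \<Rightarrow> nat \<Rightarrow> (('k::field) fls, 'a) module \<Rightarrow> bool" where
  "lin_independent w N M \<longleftrightarrow>
     (\<forall>c. (\<Oplus>\<^bsub>M\<^esub>l\<in>{..<N}. fls_const (c l) \<odot>\<^bsub>M\<^esub> w l) = \<zero>\<^bsub>M\<^esub> \<longrightarrow> (\<forall>l<N. c l = 0))"


section \<open>Universally finite differentials\<close>

text \<open>\<open>presents m y Fs A\<close>: the substitution \<open>Y\<^sub>i \<mapsto> y\<^sub>i\<close> induces an isomorphism of
  \<open>k[[Y\<^sub>0,\<dots>,Y\<^sub>m\<^sub>-\<^sub>1]] / (Fs)\<close> with \<open>A\<close>, and the ideal \<open>(Fs)\<close> is contained in the square of the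
  maximal ideal.\<close>

definition presents ::
    "nat \<Rightarrow> (nat \<Rightarrow> 'k fls) \<Rightarrow> 'k mps list \<Rightarrow> ('k::field) fls set \<Rightarrow> bool" where
  "presents m y Fs A \<longleftrightarrow>
     (let P = mps_ring m; Y = Idl\<^bsub>P\<^esub> (mps_var ` {..<m}) in
      power_series_alg m y = A \<and>
      set Fs \<subseteq> carrier P \<and>
      a_kernel P (fls_ring A) (mps_eval m y) = Idl\<^bsub>P\<^esub> (set Fs) \<and>
      Idl\<^bsub>P\<^esub> (set Fs) \<subseteq> Y \<cdot>\<^bsub>P\<^esub> Y)"

text \<open>The image of \<open>A\<^sup>r \<rightarrow> A\<^sup>m\<close> given by the Jacobian matrix of \<open>Fs\<close>, where \<open>r = length Fs\<close>.\<close>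

definition jacobian_image ::
    "('k::field) fls set \<Rightarrow> nat \<Rightarrow> (nat \<Rightarrow> 'k fls) \<Rightarrow> 'k mps list \<Rightarrow> (nat \<Rightarrow> 'k fls) set" where
  "jacobian_image A m y Fs =
     {(\<lambda>i. if i < m then \<Sum>j<length Fs. a j * mps_eval m y (mps_deriv i (Fs ! j)) else 0) | a.
        \<forall>j<length Fs. a j \<in> A}"

definition Omega ::
    "('k::field) fls set \<Rightarrow> nat \<Rightarrow> (nat \<Rightarrow> 'k fls) \<Rightarrow> 'k mps list
      \<Rightarrow> ('k fls, (nat \<Rightarrow> 'k fls) set) module" where
  "Omega A m y Fs = quot_module (free_module A m) (jacobian_image A m y Fs)"

definition Omega_class ::
    "('k::field) fls set \<Rightarrow> nat \<Rightarrow> (nat \<Rightarrow> 'k fls) \<Rightarrow> 'k mps list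
      \<Rightarrow> (nat \<Rightarrow> 'k fls) \<Rightarrow> (nat \<Rightarrow> 'k fls) set" where
  "Omega_class A m y Fs v = jacobian_image A m y Fs +>\<^bsub>free_module A m\<^esub> v"

definition Omega_d ::
    "('k::field) fls set \<Rightarrow> nat \<Rightarrow> (nat \<Rightarrow> 'k fls) \<Rightarrow> 'k mps list
      \<Rightarrow> nat \<Rightarrow> (nat \<Rightarrow> 'k fls) set" where
  "Omega_d A m y Fs i = Omega_class A m y Fs (\<lambda>i'. if i' = i then 1 else 0)"

text \<open>The map into \<open>Omega A m y Fs\<close> with \<open>dy\<^sub>i \<mapsto> dy\<^sub>i\<close>, from the differentials of a subring
  generated by the first \<open>n \<le> m\<close> of the \<open>y\<^sub>i\<close>. Vectors vanish beyond their length, so a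
  representative \<open>v\<close> of length \<open>n\<close>, padded with zeros to length \<open>m\<close>, is the same function \<open>v\<close>.
  The union is over all representatives of \<open>X\<close>, which have the same image.\<close>

definition Omega_map ::
    "('k::field) fls set \<Rightarrow> nat \<Rightarrow> (nat \<Rightarrow> 'k fls) \<Rightarrow> 'k mps list
      \<Rightarrow> (nat \<Rightarrow> 'k fls) set \<Rightarrow> (nat \<Rightarrow> 'k fls) set" where
  "Omega_map A m y Fs X = (\<Union>v\<in>X. Omega_class A m y Fs v)"

end

theory Submission
  imports Defs
begin

text \<open>Since \<open>c \<ge> 2 a\<close>, where \<open>a\<close> is the order of \<open>x\<^sub>0\<close>, one has \<open>S = R + \<Sum>\<^sub>j k T\<^sub>j\<close>, and all products
  \<open>T\<^sub>j T\<^sub>k\<close> and \<open>\<rho> T\<^sub>j\<close> with \<open>\<rho> \<in> \<mm>\<^sub>R\<close> lie in the conductor, hence in \<open>R\<close>. Differentiating them in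
  \<open>\<Omega>\<^sub>S\<close> shows that an element \<open>\<Sum> r\<^sub>i dx\<^sub>i + \<Sum> r'\<^sub>j dT\<^sub>j\<close> with non-units \<open>r'\<^sub>j\<close> is, up to the
  image of \<open>\<Omega>\<^sub>R\<close>, a \<open>k\<close>-combination of the \<open>ns\<close> elements \<open>T\<^sub>j dx\<^sub>i\<close> and the \<open>(s choose 2)\<close> elements
  \<open>T\<^sub>j dT\<^sub>k\<close>, \<open>j < k\<close>. Hence among \<open>N\<close> elements some nontrivial \<open>k\<close>-combination comes from
  \<open>\<Omega>\<^sub>R\<close>. Being torsion it is killed by \<open>dy \<mapsto> y'(t) dt\<close>, and the kernel of this map on \<open>\<Omega>\<^sub>R\<close> is
  the torsion, because each \<open>x\<^sub>i\<close> is separably algebraic over \<open>k((x\<^sub>0))\<close>.\<close>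

unbundle fps_syntax

section \<open>Orders of Laurent series\<close>

text \<open>The bound \<open>2 * a \<le> c\<close> comes from the conductor lying in the square of
  the maximal ideal: every non-unit of R has order at least a, while t^c is in the conductor. Since
  T_j has order at least c - a, which is at least a, each product in question has order at least c.
  The relation d(T_j T_k) = T_j dT_k + T_k dT_j trades one order of the indices for the other, and
  in characteristic 0 it can be halved when j = k; this is why only pairs j < k are counted. A
  coefficient of dT_j with a nonzero constant term would leave dT_j itself, which these relations do
  not remove; hence the non-unit assumption. All relations are used as power series F with F(y) = 0,
  so the gradient of every such F, and not only of the listed generators, has to lie in the Jacobian
  image. Linear independence over k makes the combination nonzero in Omega_S, and a preimage of a
  nonzero element is nonzero. The integer s is given as the dimension of a quotient of ideals, so it
  has to be matched with the number of gaps.\<close>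

definition ord_ge :: "int \<Rightarrow> 'a::zero fls \<Rightarrow> bool" where
  "ord_ge n f \<longleftrightarrow> (\<forall>k<n. f $$ k = 0)"

text \<open>The zero series has every order here, although \<open>fls_subdegree 0 = 0\<close>; this
  makes the series of order at least n closed under addition without case distinctions.\<close>

lemma ord_ge_iff: "ord_ge n f \<longleftrightarrow> f = 0 \<or> n \<le> fls_subdegree f"
  unfolding ord_ge_def
  by (metis fls_eq0_below_subdegree fls_subdegree_geI fls_zero_nth order_less_le_trans)

lemma ord_ge_0 [simp]: "ord_ge n 0"
  by (simp add: ord_ge_def)

lemma ord_ge_mono: "ord_ge n f \<Longrightarrow> m \<le> n \<Longrightarrow> ord_ge m f"
  by (auto simp: ord_ge_def)

lemma ord_ge_add: "ord_ge n f \<Longrightarrow> ord_ge n g \<Longrightarrow> ord_ge n (f + g)"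
  for f :: "'a::monoid_add fls"
  by (simp add: ord_ge_def)

lemma ord_ge_diff: "ord_ge n f \<Longrightarrow> ord_ge n g \<Longrightarrow> ord_ge n (f - g)"
  for f :: "'a::group_add fls"
  by (simp add: ord_ge_def)

lemma ord_ge_sum: "(\<And>i. i \<in> I \<Longrightarrow> ord_ge n (f i)) \<Longrightarrow> ord_ge n (\<Sum>i\<in>I. f i)"
  for f :: "'b \<Rightarrow> 'a::comm_monoid_add fls"
  by (induction I rule: infinite_finite_induct) (auto intro: ord_ge_add)

lemma ord_ge_mult: "ord_ge m f \<Longrightarrow> ord_ge n g \<Longrightarrow> ord_ge (m + n) (f * g)"
  for f :: "'a::idom fls"
  by (cases "f = 0 \<or> g = 0") (auto simp: ord_ge_iff)

lemma ord_ge_mult_left: "ord_ge 0 f \<Longrightarrow> ord_ge n g \<Longrightarrow> ord_ge n (f * g)"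
  for f :: "'a::idom fls"
  using ord_ge_mult[of 0 f n g] by simp

lemma ord_ge_mult_right: "ord_ge n f \<Longrightarrow> ord_ge 0 g \<Longrightarrow> ord_ge n (f * g)"
  for f :: "'a::idom fls"
  using ord_ge_mult[of n f 0 g] by simp

lemma ord_ge_const [simp]: "ord_ge 0 (fls_const c)"
  by (simp add: ord_ge_def)

lemma ord_ge_one [simp]: "ord_ge 0 (1 :: 'a::{zero,one} fls)"
  by (simp add: ord_ge_def)

lemma ord_ge_fps_to_fls [simp]: "ord_ge 0 (fps_to_fls f)"
  by (simp add: ord_ge_def)

lemma ord_ge_prod: "(\<And>i. i \<in> I \<Longrightarrow> ord_ge (d i) (f i)) \<Longrightarrow> ord_ge (\<Sum>i\<in>I. d i) (\<Prod>i\<in>I. f i)"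
  for f :: "'b \<Rightarrow> 'a::idom fls"
  by (induction I rule: infinite_finite_induct) (auto intro: ord_ge_mult)

lemma ord_ge_power: "ord_ge n f \<Longrightarrow> ord_ge (int k * n) (f ^ k)"
  for f :: "'a::idom fls"
  by (induction k) (auto simp: algebra_simps intro: ord_ge_mult)

lemma ord_ge_deriv: "ord_ge (n + 1) f \<Longrightarrow> ord_ge n (fls_deriv f)"
  for f :: "'a::ring_1 fls"
  by (simp add: ord_ge_def)

lemma ord_ge_all_imp_zero: "(\<And>N. ord_ge (int N) f) \<Longrightarrow> f = 0"
proof (rule fls_eqI)
  fix k assume "\<And>N. ord_ge (int N) f"
  then have "ord_ge (int (nat (k + 1))) f" .
  then show "f $$ k = 0 $$ k" by (simp add: ord_ge_def)
qed

lemma ord_ge_0_iff_range: "ord_ge 0 f \<longleftrightarrow> f \<in> range fps_to_fls"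
proof
  assume "ord_ge 0 f"
  then have "f = fps_to_fls (fls_regpart f)"
    by (intro fls_eqI) (auto simp: ord_ge_def)
  then show "f \<in> range fps_to_fls" by blast
qed auto


section \<open>Power series in several variables\<close>

text \<open>This is the index set of the finite sum inside \<open>mps_eval\<close>: only monomials
  of total degree at most N can reach the coefficient of t^N.\<close>

definition box :: "nat \<Rightarrow> nat \<Rightarrow> (nat \<Rightarrow>\<^sub>0 nat) set" where
  "box m N = {\<alpha>. Poly_Mapping.keys \<alpha> \<subseteq> {..<m} \<and> (\<Sum>i<m. Poly_Mapping.lookup \<alpha> i) \<le> N}"

text \<open>Natural exponents cannot cancel, so the supports unite exactly; closure of the carrier
  under products and partial derivatives rests on this.\<close>

lemma keys_add_nat:
  "Poly_Mapping.keys (\<alpha> + \<beta>) = Poly_Mapping.keys \<alpha> \<union> Poly_Mapping.keys (\<beta> :: 'a \<Rightarrow>\<^sub>0 nat)"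
  by (auto simp: in_keys_iff lookup_add)

lemma finite_box: "finite (box m N)"
proof -
  let ?F = "{f. \<forall>i. (i \<in> {..<m} \<longrightarrow> f i \<in> {..N}) \<and> (i \<notin> {..<m} \<longrightarrow> f i = (0::nat))}"
  have "Poly_Mapping.lookup ` box m N \<subseteq> ?F"
  proof clarsimp
    fix \<alpha> i assume \<alpha>: "\<alpha> \<in> box m N"
    show "(i < m \<longrightarrow> Poly_Mapping.lookup \<alpha> i \<le> N) \<and> (\<not> i < m \<longrightarrow> Poly_Mapping.lookup \<alpha> i = 0)"
    proof (cases "i < m")
      case True
      then have "Poly_Mapping.lookup \<alpha> i \<le> (\<Sum>i<m. Poly_Mapping.lookup \<alpha> i)"
        by (intro member_le_sum) auto
      with \<alpha> True show ?thesis by (simp add: box_def)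
    next
      case False
      with \<alpha> show ?thesis by (auto simp: box_def in_keys_iff)
    qed
  qed
  moreover have "finite ?F"
    by (rule finite_set_of_finite_funs) auto
  ultimately have "finite (Poly_Mapping.lookup ` box m N)"
    by (rule finite_subset)
  then show ?thesis
    by (rule finite_imageD) (auto simp: inj_on_def intro: poly_mapping_eqI)
qed

lemma box_add_iff:
  "\<alpha> + \<beta> \<in> box m N \<longleftrightarrow> Poly_Mapping.keys \<alpha> \<subseteq> {..<m} \<and> Poly_Mapping.keys \<beta> \<subseteq> {..<m} \<and>
     (\<Sum>i<m. Poly_Mapping.lookup \<alpha> i) + (\<Sum>i<m. Poly_Mapping.lookup \<beta> i) \<le> N"
  by (auto simp: box_def keys_add_nat lookup_add sum.distrib)

lemma keys_subset_lessThan: "\<exists>m. Poly_Mapping.keys (\<alpha> :: nat \<Rightarrow>\<^sub>0 nat) \<subseteq> {..<m}"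
  using finite_keys[of \<alpha>] finite_nat_iff_bounded by blast

text \<open>Both summands are bounded by \<alpha> in support and total degree. Without finiteness
  the convolution sum would be the default value 0.\<close>

lemma finite_splittings: "finite {p. fst p + snd p = (\<alpha> :: nat \<Rightarrow>\<^sub>0 nat)}"
proof -
  obtain m where m: "Poly_Mapping.keys \<alpha> \<subseteq> {..<m}" using keys_subset_lessThan by blast
  define N where "N = (\<Sum>i<m. Poly_Mapping.lookup \<alpha> i)"
  have "{p. fst p + snd p = \<alpha>} \<subseteq> box m N \<times> box m N"
  proof
    fix p assume "p \<in> {p. fst p + snd p = \<alpha>}"
    moreover have "\<alpha> \<in> box m N" using m by (simp add: box_def N_def)
    ultimately have "fst p + snd p \<in> box m N" by simp
    then show "p \<in> box m N \<times> box m N"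
      unfolding box_add_iff by (simp add: box_def mem_Times_iff)
  qed
  then show ?thesis by (rule finite_subset) (simp add: finite_box)
qed

definition mps_times :: "('k::field) mps \<Rightarrow> 'k mps \<Rightarrow> 'k mps" where
  "mps_times F G = (\<lambda>\<alpha>. \<Sum>p\<in>{p. fst p + snd p = \<alpha>}. F (fst p) * G (snd p))"

definition mps_one :: "('k::field) mps" where
  "mps_one = (\<lambda>\<alpha>. if \<alpha> = 0 then 1 else 0)"

definition mps_carrier :: "nat \<Rightarrow> ('k::field) mps set" where
  "mps_carrier m = {F. \<forall>\<alpha>. F \<alpha> \<noteq> 0 \<longrightarrow> Poly_Mapping.keys \<alpha> \<subseteq> {..<m}}"

lemma mps_ring_simps [simp]:
  "carrier (mps_ring m) = mps_carrier m"
  "monoid.mult (mps_ring m) = mps_times"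
  "monoid.one (mps_ring m) = mps_one"
  "ring.zero (mps_ring m) = (\<lambda>\<alpha>. 0)"
  "ring.add (mps_ring m) = (\<lambda>F G \<alpha>. F \<alpha> + G \<alpha>)"
  by (simp_all add: mps_ring_def mps_carrier_def mps_times_def mps_one_def fun_eq_iff)

lemma mps_carrierI: "(\<And>\<alpha>. F \<alpha> \<noteq> 0 \<Longrightarrow> Poly_Mapping.keys \<alpha> \<subseteq> {..<m}) \<Longrightarrow> F \<in> mps_carrier m"
  by (simp add: mps_carrier_def)

lemma mps_carrierD: "F \<in> mps_carrier m \<Longrightarrow> F \<alpha> \<noteq> 0 \<Longrightarrow> Poly_Mapping.keys \<alpha> \<subseteq> {..<m}"
  by (simp add: mps_carrier_def)

lemma mps_add_carrier:
  assumes "F \<in> mps_carrier m" "G \<in> mps_carrier m"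
  shows "(\<lambda>\<alpha>. F \<alpha> + G \<alpha>) \<in> mps_carrier m"
proof (rule mps_carrierI)
  fix \<alpha> assume "F \<alpha> + G \<alpha> \<noteq> 0"
  then have "F \<alpha> \<noteq> 0 \<or> G \<alpha> \<noteq> 0" by auto
  then show "Poly_Mapping.keys \<alpha> \<subseteq> {..<m}" using assms by (blast dest: mps_carrierD)
qed

lemma mps_uminus_carrier: "F \<in> mps_carrier m \<Longrightarrow> (\<lambda>\<alpha>. - F \<alpha>) \<in> mps_carrier m"
  by (simp add: mps_carrier_def)

lemma mps_diff_carrier:
  "F \<in> mps_carrier m \<Longrightarrow> G \<in> mps_carrier m \<Longrightarrow> (\<lambda>\<alpha>. F \<alpha> - G \<alpha>) \<in> mps_carrier m"
  using mps_add_carrier[OF _ mps_uminus_carrier] by fastforce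

lemma mps_zero_carrier: "(\<lambda>\<alpha>. 0) \<in> mps_carrier m"
  by (simp add: mps_carrier_def)

lemma mps_one_carrier: "mps_one \<in> mps_carrier m"
  by (simp add: mps_carrier_def mps_one_def)

lemma mps_carrier_mono:
  assumes "F \<in> mps_carrier m" "m \<le> m'"
  shows "F \<in> mps_carrier m'"
proof (rule mps_carrierI)
  fix \<alpha> assume "F \<alpha> \<noteq> 0"
  with assms(1) have "Poly_Mapping.keys \<alpha> \<subseteq> {..<m}" by (rule mps_carrierD)
  also have "\<dots> \<subseteq> {..<m'}" using assms(2) by simp
  finally show "Poly_Mapping.keys \<alpha> \<subseteq> {..<m'}" .
qed

lemma mps_times_carrier:
  assumes F: "F \<in> mps_carrier m" and G: "G \<in> mps_carrier m"
  shows "mps_times F G \<in> mps_carrier m"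
proof (rule mps_carrierI)
  fix \<alpha> assume n0: "mps_times F G \<alpha> \<noteq> 0"
  from n0 obtain p where "p \<in> {p. fst p + snd p = \<alpha>}" and p: "F (fst p) * G (snd p) \<noteq> 0"
    unfolding mps_times_def by (rule sum.not_neutral_contains_not_neutral)
  then have "Poly_Mapping.keys \<alpha> = Poly_Mapping.keys (fst p) \<union> Poly_Mapping.keys (snd p)"
    using keys_add_nat[of "fst p" "snd p"] by simp
  moreover have "F (fst p) \<noteq> 0" "G (snd p) \<noteq> 0" using p by auto
  ultimately show "Poly_Mapping.keys \<alpha> \<subseteq> {..<m}"
    using F G by (simp add: mps_carrierD)
qed

lemma mps_times_commute: "mps_times F G = mps_times G F"
proof
  fix \<alpha>
  show "mps_times F G \<alpha> = mps_times G F \<alpha>"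
    unfolding mps_times_def
    by (rule sum.reindex_bij_witness[of _ prod.swap prod.swap]) (auto simp: add.commute mult.commute)
qed

text \<open>Both bracketings are sums over triples of exponents with total \<alpha>; the two
  witnesses re-bracket such triples.\<close>

lemma mps_times_assoc: "mps_times (mps_times F G) H = mps_times F (mps_times G H)"
proof
  fix \<alpha>
  let ?D = "\<lambda>\<alpha>. {p. fst p + snd p = (\<alpha> :: nat \<Rightarrow>\<^sub>0 nat)}"
  have "mps_times (mps_times F G) H \<alpha> =
      (\<Sum>(p, q)\<in>Sigma (?D \<alpha>) (\<lambda>p. ?D (fst p)). F (fst q) * G (snd q) * H (snd p))"
    unfolding mps_times_def
    by (subst sum.Sigma[symmetric]) (auto simp: finite_splittings sum_distrib_right)
  also have "\<dots> = (\<Sum>(p, q)\<in>Sigma (?D \<alpha>) (\<lambda>p. ?D (snd p)). F (fst p) * (G (fst q) * H (snd q)))"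
    by (rule sum.reindex_bij_witness[of _
          "\<lambda>(p, q). ((fst p + fst q, snd q), (fst p, fst q))"
          "\<lambda>(p, q). ((fst q, snd q + snd p), (snd q, snd p))"]) (auto simp: add.assoc mult.assoc)
  also have "\<dots> = mps_times F (mps_times G H) \<alpha>"
    unfolding mps_times_def
    by (subst sum.Sigma[symmetric]) (auto simp: finite_splittings sum_distrib_left)
  finally show "mps_times (mps_times F G) H \<alpha> = mps_times F (mps_times G H) \<alpha>" .
qed

lemma mps_times_one: "mps_times mps_one F = F"
proof
  fix \<alpha>
  have "mps_times mps_one F \<alpha> = (\<Sum>p\<in>{(0, \<alpha>)}. mps_one (fst p) * F (snd p))"
    unfolding mps_times_def
    by (rule sum.mono_neutral_right) (auto simp: finite_splittings mps_one_def)
  then show "mps_times mps_one F \<alpha> = F \<alpha>" by (simp add: mps_one_def)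
qed

lemma mps_times_add_left: "mps_times (\<lambda>\<alpha>. F \<alpha> + G \<alpha>) H = (\<lambda>\<alpha>. mps_times F H \<alpha> + mps_times G H \<alpha>)"
  by (simp add: mps_times_def fun_eq_iff distrib_right sum.distrib)

lemma cring_mps_ring: "cring (mps_ring m :: ('k::field) mps ring)"
proof (rule cringI)
  show "abelian_group (mps_ring m :: 'k mps ring)"
  proof (rule abelian_groupI)
    fix F :: "'k mps" assume "F \<in> carrier (mps_ring m)"
    then show "\<exists>G\<in>carrier (mps_ring m). G \<oplus>\<^bsub>mps_ring m\<^esub> F = \<zero>\<^bsub>mps_ring m\<^esub>"
      by (intro bexI[of _ "\<lambda>\<alpha>. - F \<alpha>"]) (auto simp: mps_uminus_carrier)
  qed (auto simp: mps_add_carrier mps_zero_carrier add_ac)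
  show "Group.comm_monoid (mps_ring m :: 'k mps ring)"
    by (rule comm_monoidI)
      (auto simp: mps_times_assoc mps_times_carrier mps_times_one mps_one_carrier
        intro: mps_times_commute)
qed (auto simp: mps_times_add_left)

section \<open>Formal partial derivatives and the Leibniz rule\<close>

lemma mps_deriv_carrier:
  assumes "F \<in> mps_carrier m"
  shows "mps_deriv i F \<in> mps_carrier m"
proof (rule mps_carrierI)
  fix \<alpha> assume "mps_deriv i F \<alpha> \<noteq> 0"
  then have "F (\<alpha> + Poly_Mapping.single i 1) \<noteq> 0" by (simp add: mps_deriv_def)
  with assms show "Poly_Mapping.keys \<alpha> \<subseteq> {..<m}"
    by (metis Un_subset_iff keys_add_nat mps_carrierD)
qed

lemma mps_deriv_vanishes:
  assumes "F \<in> mps_carrier m" "m \<le> i"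
  shows "mps_deriv i F = (\<lambda>\<alpha>. 0)"
proof
  fix \<alpha> :: "nat \<Rightarrow>\<^sub>0 nat"
  have "i \<in> Poly_Mapping.keys (\<alpha> + Poly_Mapping.single i 1)" by (simp add: keys_add_nat)
  with assms have "F (\<alpha> + Poly_Mapping.single i 1) = 0"
    by (metis lessThan_iff linorder_not_le mps_carrierD subsetD)
  then show "mps_deriv i F \<alpha> = 0" by (simp add: mps_deriv_def)
qed

lemma mps_deriv_add: "mps_deriv i (\<lambda>\<alpha>. F \<alpha> + G \<alpha>) = (\<lambda>\<alpha>. mps_deriv i F \<alpha> + mps_deriv i G \<alpha>)"
  by (simp add: mps_deriv_def fun_eq_iff distrib_left)

lemma mps_deriv_diff: "mps_deriv i (\<lambda>\<alpha>. F \<alpha> - G \<alpha>) = (\<lambda>\<alpha>. mps_deriv i F \<alpha> - mps_deriv i G \<alpha>)"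
  by (simp add: mps_deriv_def fun_eq_iff right_diff_distrib)

lemma single_diff_add:
  "0 < Poly_Mapping.lookup \<alpha> i \<Longrightarrow> \<alpha> - Poly_Mapping.single i 1 + Poly_Mapping.single i (1::nat) = \<alpha>"
  by (rule poly_mapping_eqI) (auto simp: lookup_add lookup_minus lookup_single when_def)

text \<open>Shifting the first exponent by the i-th unit vector turns the factor
  \<open>lookup + 1\<close> into \<open>lookup\<close>; splittings with exponent 0 at i are missed
  by the shift but carry weight 0. In this form both Leibniz terms run over the same
  splittings.\<close>

lemma mps_times_deriv_left:
  "mps_times (mps_deriv i F) G \<alpha> =
     (\<Sum>p\<in>{p. fst p + snd p = \<alpha> + Poly_Mapping.single i 1}.
        of_nat (Poly_Mapping.lookup (fst p) i) * F (fst p) * G (snd p))"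
proof -
  let ?e = "Poly_Mapping.single i (1::nat)"
  let ?D = "{p. fst p + snd p = \<alpha> + ?e \<and> 0 < Poly_Mapping.lookup (fst p) i}"
  have "mps_times (mps_deriv i F) G \<alpha> =
      (\<Sum>p\<in>{p. fst p + snd p = \<alpha>}. of_nat (Poly_Mapping.lookup (fst p) i + 1) * F (fst p + ?e) * G (snd p))"
    by (simp add: mps_times_def mps_deriv_def)
  also have "\<dots> = (\<Sum>p\<in>?D. of_nat (Poly_Mapping.lookup (fst p) i) * F (fst p) * G (snd p))"
  proof (rule sum.reindex_bij_witness[of _ "\<lambda>p. (fst p - ?e, snd p)" "\<lambda>p. (fst p + ?e, snd p)"])
    fix p assume "p \<in> ?D"
    then have p: "fst p + snd p = \<alpha> + ?e" and e: "fst p - ?e + ?e = fst p"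
      using single_diff_add by auto
    show "(fst (fst p - ?e, snd p) + ?e, snd (fst p - ?e, snd p)) = p" using e by simp
    have "(fst p - ?e + snd p) + ?e = \<alpha> + ?e"
      using p e by (metis add.assoc add.commute)
    then show "(fst p - ?e, snd p) \<in> {p. fst p + snd p = \<alpha>}" by simp
  qed (auto simp: ac_simps lookup_add)
  also have "\<dots> = (\<Sum>p\<in>{p. fst p + snd p = \<alpha> + ?e}.
        of_nat (Poly_Mapping.lookup (fst p) i) * F (fst p) * G (snd p))"
    by (rule sum.mono_neutral_left) (auto simp: finite_splittings)
  finally show ?thesis .
qed

text \<open>The weight of a splitting of the shifted exponent is the i-th exponent of the total,
  which is the sum of the i-th exponents of the two parts; these give the two terms.\<close>

lemma mps_deriv_times:
  "mps_deriv i (mps_times F G) =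
     (\<lambda>\<alpha>. mps_times (mps_deriv i F) G \<alpha> + mps_times F (mps_deriv i G) \<alpha>)"
proof
  fix \<alpha>
  let ?D = "{p. fst p + snd p = \<alpha> + Poly_Mapping.single i (1::nat)}"
  have "mps_times F (mps_deriv i G) \<alpha> =
      (\<Sum>p\<in>?D. of_nat (Poly_Mapping.lookup (fst p) i) * G (fst p) * F (snd p))"
    unfolding mps_times_commute[of F "mps_deriv i G"] by (rule mps_times_deriv_left)
  also have "\<dots> = (\<Sum>p\<in>?D. of_nat (Poly_Mapping.lookup (snd p) i) * F (fst p) * G (snd p))"
    by (rule sum.reindex_bij_witness[of _ prod.swap prod.swap]) (auto simp: add.commute mult.commute mult.left_commute)
  finally have r: "mps_times F (mps_deriv i G) \<alpha> = \<dots>" .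
  have "mps_deriv i (mps_times F G) \<alpha> =
      (\<Sum>p\<in>?D. of_nat (Poly_Mapping.lookup \<alpha> i + 1) * (F (fst p) * G (snd p)))"
    by (simp add: mps_deriv_def mps_times_def sum_distrib_left)
  also have "\<dots> = (\<Sum>p\<in>?D. of_nat (Poly_Mapping.lookup (fst p) i) * F (fst p) * G (snd p) +
       of_nat (Poly_Mapping.lookup (snd p) i) * F (fst p) * G (snd p))"
  proof (rule sum.cong)
    fix p assume "p \<in> ?D"
    then have "fst p + snd p = \<alpha> + Poly_Mapping.single i 1" by simp
    from arg_cong[OF this, of "\<lambda>\<gamma>. Poly_Mapping.lookup \<gamma> i"]
    have "Poly_Mapping.lookup \<alpha> i + 1 = Poly_Mapping.lookup (fst p) i + Poly_Mapping.lookup (snd p) i"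
      by (simp add: lookup_add)
    then have "(of_nat (Poly_Mapping.lookup \<alpha> i + 1) :: 'a) =
        of_nat (Poly_Mapping.lookup (fst p) i) + of_nat (Poly_Mapping.lookup (snd p) i)"
      by (simp only: of_nat_add)
    then show "of_nat (Poly_Mapping.lookup \<alpha> i + 1) * (F (fst p) * G (snd p)) =
       of_nat (Poly_Mapping.lookup (fst p) i) * F (fst p) * G (snd p) +
       of_nat (Poly_Mapping.lookup (snd p) i) * F (fst p) * G (snd p)"
      by (simp only: distrib_right mult.assoc)
  qed simp
  also have "\<dots> = mps_times (mps_deriv i F) G \<alpha> + mps_times F (mps_deriv i G) \<alpha>"
    by (simp add: sum.distrib r mps_times_deriv_left)
  finally show "mps_deriv i (mps_times F G) \<alpha> =
    mps_times (mps_deriv i F) G \<alpha> + mps_times F (mps_deriv i G) \<alpha>" .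
qed


section \<open>Substitution into a power series\<close>

definition mon :: "nat \<Rightarrow> (nat \<Rightarrow> ('k::field) fls) \<Rightarrow> (nat \<Rightarrow>\<^sub>0 nat) \<Rightarrow> 'k fls" where
  "mon m y \<alpha> = (\<Prod>i<m. y i ^ Poly_Mapping.lookup \<alpha> i)"

lemma mon_0 [simp]: "mon m y 0 = 1"
  by (simp add: mon_def)

lemma mon_add: "mon m y (\<alpha> + \<beta>) = mon m y \<alpha> * mon m y \<beta>"
  by (simp add: mon_def lookup_add power_add prod.distrib)

lemma mon_single:
  assumes "i < m"
  shows "mon m y (Poly_Mapping.single i j) = y i ^ j"
proof -
  have "mon m y (Poly_Mapping.single i j) = (\<Prod>l<m. if l = i then y i ^ j else 1)"
    unfolding mon_def by (rule prod.cong) (auto simp: lookup_single when_def)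
  then show ?thesis using assms by simp
qed

lemma mon_ord:
  assumes "\<forall>i<m. ord_ge a (y i)"
  shows "ord_ge (int (\<Sum>i<m. Poly_Mapping.lookup \<alpha> i) * a) (mon m y \<alpha>)"
proof -
  have "ord_ge (\<Sum>i<m. int (Poly_Mapping.lookup \<alpha> i) * a) (mon m y \<alpha>)"
    unfolding mon_def using assms by (intro ord_ge_prod ord_ge_power) auto
  then show ?thesis by (simp add: sum_distrib_right)
qed

lemma mon_nth_eq_0:
  assumes "\<forall>i<m. ord_ge 1 (y i)" "k < int (\<Sum>i<m. Poly_Mapping.lookup \<alpha> i)"
  shows "mon m y \<alpha> $$ k = 0"
  using mon_ord[OF assms(1), of \<alpha>] assms(2) by (simp add: ord_ge_def)

lemma mps_eval_nth:
  "mps_eval m y F $$ k = (if k < 0 then 0 else \<Sum>\<alpha>\<in>box m (nat k). F \<alpha> * mon m y \<alpha> $$ k)"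
  by (simp add: mps_eval_def box_def mon_def)

lemma mps_eval_ord: "ord_ge 0 (mps_eval m y F)"
  by (simp add: ord_ge_def mps_eval_nth)

lemma mps_eval_add: "mps_eval m y (\<lambda>\<alpha>. F \<alpha> + G \<alpha>) = mps_eval m y F + mps_eval m y G"
  by (rule fls_eqI) (simp add: mps_eval_nth distrib_right sum.distrib)

lemma mps_eval_uminus: "mps_eval m y (\<lambda>\<alpha>. - F \<alpha>) = - mps_eval m y F"
  by (rule fls_eqI) (simp add: mps_eval_nth sum_negf)

lemma mps_eval_diff: "mps_eval m y (\<lambda>\<alpha>. F \<alpha> - G \<alpha>) = mps_eval m y F - mps_eval m y G"
  by (rule fls_eqI) (simp add: mps_eval_nth left_diff_distrib sum_subtractf)

lemma mps_eval_zero [simp]: "mps_eval m y (\<lambda>\<alpha>. 0) = 0"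
  by (rule fls_eqI) (simp add: mps_eval_nth)

text \<open>A polynomial truncation of the substitution. Identities hold for truncations up to terms
  of high order, and \<open>fls_eq_of_approx\<close> carries them over to
  \<open>mps_eval\<close>.\<close>

definition partial_eval ::
    "nat \<Rightarrow> (nat \<Rightarrow> ('k::field) fls) \<Rightarrow> (nat \<Rightarrow>\<^sub>0 nat) set \<Rightarrow> 'k mps \<Rightarrow> 'k fls" where
  "partial_eval m y A F = (\<Sum>\<alpha>\<in>A. fls_const (F \<alpha>) * mon m y \<alpha>)"

lemma fls_eq_of_approx:
  fixes f g :: "('k::field) fls"
  assumes "\<And>N. ord_ge (int N) (f - g)"
  shows "f = g"
  using ord_ge_all_imp_zero[OF assms] by simp

text \<open>A monomial of total degree d has order at least d, so the coefficients up to t^N see no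
  exponent outside \<open>box m N\<close>, and any finite superset gives the same result.\<close>

lemma mps_eval_approx:
  fixes y :: "nat \<Rightarrow> ('k::field) fls"
  assumes y: "\<forall>i<m. ord_ge 1 (y i)" and A: "finite A" "box m N \<subseteq> A"
    and keys: "\<And>\<alpha>. \<alpha> \<in> A \<Longrightarrow> Poly_Mapping.keys \<alpha> \<subseteq> {..<m}"
  shows "ord_ge (int N + 1) (mps_eval m y F - partial_eval m y A F)"
  unfolding ord_ge_def
proof (intro allI impI)
  fix k :: int assume k: "k < int N + 1"
  have p: "partial_eval m y A F $$ k = (\<Sum>\<alpha>\<in>A. F \<alpha> * mon m y \<alpha> $$ k)"
    by (simp add: partial_eval_def fls_nth_sum fls_mult_const_nth)
  show "(mps_eval m y F - partial_eval m y A F) $$ k = 0"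
  proof (cases "k < 0")
    case True
    then have "mon m y \<alpha> $$ k = 0" for \<alpha>
      by (intro mon_nth_eq_0 y) (simp add: sum_nonneg order_less_le_trans flip: of_nat_sum)
    with True p show ?thesis by (simp add: mps_eval_nth)
  next
    case False
    have "(\<Sum>\<alpha>\<in>A. F \<alpha> * mon m y \<alpha> $$ k) = (\<Sum>\<alpha>\<in>box m (nat k). F \<alpha> * mon m y \<alpha> $$ k)"
    proof (rule sum.mono_neutral_right)
      show "box m (nat k) \<subseteq> A"
        using A(2) k by (auto simp: box_def)
      show "\<forall>\<alpha>\<in>A - box m (nat k). F \<alpha> * mon m y \<alpha> $$ k = 0"
      proof
        fix \<alpha> assume \<alpha>: "\<alpha> \<in> A - box m (nat k)"
        then have "k < int (\<Sum>i<m. Poly_Mapping.lookup \<alpha> i)"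
          using keys[of \<alpha>] False by (auto simp: box_def not_le nat_less_iff)
        then show "F \<alpha> * mon m y \<alpha> $$ k = 0"
          using mon_nth_eq_0[OF y] by simp
      qed
    qed (fact A)
    with False p show ?thesis by (simp add: mps_eval_nth)
  qed
qed

lemma box_keys: "\<alpha> \<in> box m N \<Longrightarrow> Poly_Mapping.keys \<alpha> \<subseteq> {..<m}"
  by (simp add: box_def)

lemma mps_eval_approx_box:
  fixes y :: "nat \<Rightarrow> ('k::field) fls"
  assumes "\<forall>i<m. ord_ge 1 (y i)"
  shows "ord_ge (int N + 1) (mps_eval m y F - partial_eval m y (box m N) F)"
  using mps_eval_approx[OF assms finite_box subset_refl box_keys] .

lemma mps_eval_delta:
  fixes y :: "nat \<Rightarrow> ('k::field) fls"
  assumes y: "\<forall>i<m. ord_ge 1 (y i)" and \<beta>: "Poly_Mapping.keys \<beta> \<subseteq> {..<m}"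
  shows "mps_eval m y (\<lambda>\<alpha>. if \<alpha> = \<beta> then c else 0) = fls_const c * mon m y \<beta>"
proof (rule fls_eq_of_approx)
  fix N
  let ?F = "\<lambda>\<alpha>. if \<alpha> = \<beta> then c else 0"
  \<comment> \<open>Large enough both for \<beta> to lie in the box and for precision N.\<close>
  define M where "M = N + (\<Sum>i<m. Poly_Mapping.lookup \<beta> i)"
  have "partial_eval m y (box m M) ?F = (\<Sum>\<alpha>\<in>{\<beta>}. fls_const (?F \<alpha>) * mon m y \<alpha>)"
    unfolding partial_eval_def using \<beta>
    by (intro sum.mono_neutral_right) (auto simp: finite_box, auto simp: box_def M_def)
  then have "partial_eval m y (box m M) ?F = fls_const c * mon m y \<beta>" by simp
  with mps_eval_approx_box[OF y, where N = M and F = ?F]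
  have "ord_ge (int M + 1) (mps_eval m y ?F - fls_const c * mon m y \<beta>)" by simp
  moreover have "int N \<le> int M + 1" by (simp add: M_def sum_nonneg add_increasing2)
  ultimately show "ord_ge (int N) (mps_eval m y ?F - fls_const c * mon m y \<beta>)"
    by (rule ord_ge_mono)
qed

lemma mps_eval_one:
  assumes "\<forall>i<m. ord_ge 1 (y i)"
  shows "mps_eval m y mps_one = 1"
  using mps_eval_delta[OF assms, of 0 1] by (simp add: mps_one_def)

lemma mps_eval_const:
  assumes "\<forall>i<m. ord_ge 1 (y i)"
  shows "mps_eval m y (\<lambda>\<alpha>. if \<alpha> = 0 then c else 0) = fls_const c"
  using mps_eval_delta[OF assms, of 0 c] by simp

lemma mps_eval_var:
  assumes "\<forall>i<m. ord_ge 1 (y i)" "i < m"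
  shows "mps_eval m y (mps_var i) = y i"
  using mps_eval_delta[OF assms(1), of "Poly_Mapping.single i 1" 1] assms(2) mon_single[OF assms(2), of y 1]
  by (simp add: mps_var_def)

lemma mps_var_carrier: "i < m \<Longrightarrow> mps_var i \<in> mps_carrier m"
  by (auto simp: mps_carrier_def mps_var_def)

text \<open>Multiplying the truncations of F and G yields the truncation of the product plus terms
  for pairs of total degree above N; these terms have order above N.\<close>

lemma mps_eval_times:
  fixes y :: "nat \<Rightarrow> ('k::field) fls"
  assumes y: "\<forall>i<m. ord_ge 1 (y i)"
  shows "mps_eval m y (mps_times F G) = mps_eval m y F * mps_eval m y G"
proof (rule fls_eq_of_approx)
  fix N
  let ?B = "box m N" and ?D = "\<lambda>\<alpha>. {p. fst p + snd p = (\<alpha> :: nat \<Rightarrow>\<^sub>0 nat)}"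
  let ?e = "mps_eval m y" and ?p = "partial_eval m y (box m N)"
  let ?t = "\<lambda>p. fls_const (F (fst p) * G (snd p)) * mon m y (fst p + snd p)"
  let ?P = "{p. fst p + snd p \<in> ?B}"
  have sub: "?P \<subseteq> ?B \<times> ?B"
    by (auto simp: box_add_iff) (auto simp: box_def)
  have "?p (mps_times F G) = (\<Sum>\<gamma>\<in>?B. \<Sum>p\<in>?D \<gamma>. ?t p)"
    unfolding partial_eval_def
  proof (rule sum.cong)
    fix \<gamma> assume "\<gamma> \<in> ?B"
    have "fls_const (\<Sum>p\<in>?D \<gamma>. F (fst p) * G (snd p)) = (\<Sum>p\<in>?D \<gamma>. fls_const (F (fst p) * G (snd p)))"
      by (rule fls_eqI) (simp add: fls_nth_sum)
    then show "fls_const (mps_times F G \<gamma>) * mon m y \<gamma> = (\<Sum>p\<in>?D \<gamma>. ?t p)"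
      by (simp add: mps_times_def sum_distrib_right)
  qed simp
  also have "\<dots> = (\<Sum>p\<in>?P. ?t p)"
  proof -
    have "(\<Sum>\<gamma>\<in>?B. \<Sum>p\<in>?D \<gamma>. ?t p) = (\<Sum>(\<gamma>, p)\<in>Sigma ?B ?D. ?t p)"
      by (rule sum.Sigma) (auto simp: finite_box finite_splittings)
    also have "\<dots> = (\<Sum>p\<in>?P. ?t p)"
      by (rule sum.reindex_bij_witness[of _ "\<lambda>p. (fst p + snd p, p)" snd]) auto
    finally show ?thesis .
  qed
  finally have 1: "?p (mps_times F G) = (\<Sum>p\<in>?P. ?t p)" .
  have "?p F * ?p G = (\<Sum>p\<in>?B \<times> ?B. ?t p)"
    unfolding partial_eval_def sum_product sum.cartesian_product
    by (rule sum.cong) (auto simp: mon_add simp flip: fls_const_mult_const)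
  also have "\<dots> = (\<Sum>p\<in>?B \<times> ?B - ?P. ?t p) + (\<Sum>p\<in>?P. ?t p)"
    by (rule sum.subset_diff[OF sub]) (simp add: finite_box)
  finally have "?p F * ?p G - ?p (mps_times F G) = (\<Sum>p\<in>?B \<times> ?B - ?P. ?t p)"
    using 1 by simp
  also have "ord_ge (int N + 1) \<dots>"
  proof (rule ord_ge_sum)
    fix p assume p: "p \<in> ?B \<times> ?B - ?P"
    then have "N < (\<Sum>i<m. Poly_Mapping.lookup (fst p + snd p) i)"
      by (auto simp: box_def keys_add_nat)
    then have "ord_ge (int N + 1) (mon m y (fst p + snd p))"
      using mon_ord[OF y, of "fst p + snd p"] by (auto elim!: ord_ge_mono simp flip: of_nat_sum)
    then show "ord_ge (int N + 1) (?t p)"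
      by (rule ord_ge_mult_left[OF ord_ge_const])
  qed
  finally have 2: "ord_ge (int N + 1) (?p F * ?p G - ?p (mps_times F G))" .
  have p0: "ord_ge 0 (?p F)"
    unfolding partial_eval_def
  proof (intro ord_ge_sum ord_ge_mult_left[OF ord_ge_const])
    fix \<alpha> show "ord_ge 0 (mon m y \<alpha>)"
      using mon_ord[OF y] by (rule ord_ge_mono) (simp flip: of_nat_sum)
  qed
  note approx = mps_eval_approx_box[OF y, where N = N]
  \<comment> \<open>Telescoping: the four error terms combine to exactly the value of the product
    minus the product of the values.\<close>
  have "ord_ge (int N + 1) ((?e (mps_times F G) - ?p (mps_times F G)) - (?e F - ?p F) * ?e G
       - ?p F * (?e G - ?p G) - (?p F * ?p G - ?p (mps_times F G)))"
    by (intro ord_ge_diff approx 2 ord_ge_mult_left[OF p0] ord_ge_mult_right[OF _ mps_eval_ord])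
  then show "ord_ge (int N) (?e (mps_times F G) - ?e F * ?e G)"
    by (rule ord_ge_mono[THEN back_subst[of "ord_ge (int N)"]]) (auto simp: algebra_simps)
qed

section \<open>Differentiation in t and the chain rule\<close>

lemma fls_deriv_prod:
  fixes f :: "'b \<Rightarrow> ('k::field) fls"
  assumes "finite I"
  shows "fls_deriv (\<Prod>i\<in>I. f i) = (\<Sum>i\<in>I. (\<Prod>j\<in>I - {i}. f j) * fls_deriv (f i))"
  using assms
proof (induction I rule: finite_induct)
  case (insert l I)
  have "(\<Prod>j\<in>insert l I - {i}. f j) = f l * (\<Prod>j\<in>I - {i}. f j)" if "i \<in> I" for i
  proof -
    have "insert l I - {i} = insert l (I - {i})" using that insert by auto
    then show ?thesis using insert by simp
  qed
  then show ?case
    using insert by (simp add: sum_distrib_left mult.assoc)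
qed simp

lemma mon_deriv:
  "fls_deriv (mon m y \<alpha>) =
     (\<Sum>i<m. of_nat (Poly_Mapping.lookup \<alpha> i) * mon m y (\<alpha> - Poly_Mapping.single i 1) * fls_deriv (y i))"
  unfolding mon_def
proof (subst fls_deriv_prod, simp, rule sum.cong)
  fix i assume i: "i \<in> {..<m}"
  have "(\<Prod>j<m. y j ^ Poly_Mapping.lookup (\<alpha> - Poly_Mapping.single i 1) j) =
     y i ^ (Poly_Mapping.lookup \<alpha> i - 1) * (\<Prod>j\<in>{..<m} - {i}. y j ^ Poly_Mapping.lookup \<alpha> j)"
    using i by (subst prod.remove[of _ i]) (auto simp: lookup_minus lookup_single when_def intro!: prod.cong)
  then show "(\<Prod>j\<in>{..<m} - {i}. y j ^ Poly_Mapping.lookup \<alpha> j) * fls_deriv (y i ^ Poly_Mapping.lookup \<alpha> i) =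
     of_nat (Poly_Mapping.lookup \<alpha> i) *
     (\<Prod>j<m. y j ^ Poly_Mapping.lookup (\<alpha> - Poly_Mapping.single i 1) j) * fls_deriv (y i)"
    by (simp add: fls_deriv_power)
qed simp

text \<open>The box is one larger on the left because differentiating a monomial lowers its total
  degree by one; exponents vanishing at i drop out.\<close>

lemma partial_eval_deriv:
  fixes y :: "nat \<Rightarrow> ('k::field) fls"
  shows "fls_deriv (partial_eval m y (box m (Suc N)) F) =
     (\<Sum>i<m. partial_eval m y (box m N) (mps_deriv i F) * fls_deriv (y i))"
proof -
  let ?t = "\<lambda>i \<alpha>. fls_const (F \<alpha>) * (of_nat (Poly_Mapping.lookup \<alpha> i) *
     mon m y (\<alpha> - Poly_Mapping.single i 1) * fls_deriv (y i))"
  have "fls_deriv (partial_eval m y (box m (Suc N)) F) = (\<Sum>\<alpha>\<in>box m (Suc N). \<Sum>i<m. ?t i \<alpha>)"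
    by (simp add: partial_eval_def fls_deriv_sum fls_deriv_mult_const_left mon_deriv sum_distrib_left)
  also have "\<dots> = (\<Sum>i<m. \<Sum>\<alpha>\<in>box m (Suc N). ?t i \<alpha>)"
    by (rule sum.swap)
  also have "\<dots> = (\<Sum>i<m. partial_eval m y (box m N) (mps_deriv i F) * fls_deriv (y i))"
  proof (rule sum.cong)
    fix i assume i: "i \<in> {..<m}"
    let ?e = "Poly_Mapping.single i (1::nat)"
    have tot: "(\<Sum>l<m. Poly_Mapping.lookup (\<beta> + ?e) l) = Suc (\<Sum>l<m. Poly_Mapping.lookup \<beta> l)" for \<beta>
      using i by (simp add: lookup_add sum.distrib lookup_single when_def)
    have "(\<Sum>\<alpha>\<in>box m (Suc N). ?t i \<alpha>) =
        (\<Sum>\<alpha>\<in>{\<alpha> \<in> box m (Suc N). 0 < Poly_Mapping.lookup \<alpha> i}. ?t i \<alpha>)"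
      by (rule sum.mono_neutral_right) (auto simp: finite_box)
    also have "\<dots> = (\<Sum>\<beta>\<in>box m N. ?t i (\<beta> + ?e))"
    proof (rule sum.reindex_bij_witness[of _ "\<lambda>\<beta>. \<beta> + ?e" "\<lambda>\<alpha>. \<alpha> - ?e"])
      fix \<alpha> assume \<alpha>: "\<alpha> \<in> {\<alpha> \<in> box m (Suc N). 0 < Poly_Mapping.lookup \<alpha> i}"
      then show e: "\<alpha> - ?e + ?e = \<alpha>" using single_diff_add[of \<alpha> i] by simp
      show "\<alpha> - ?e \<in> box m N"
        using \<alpha> tot[of "\<alpha> - ?e"] keys_add_nat[of "\<alpha> - ?e" ?e] unfolding e by (auto simp: box_def)
      show "?t i (\<alpha> - ?e + ?e) = ?t i \<alpha>" unfolding e ..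
    next
      fix \<beta> assume \<beta>: "\<beta> \<in> box m N"
      show "\<beta> + ?e - ?e = \<beta>" by simp
      show "\<beta> + ?e \<in> {\<alpha> \<in> box m (Suc N). 0 < Poly_Mapping.lookup \<alpha> i}"
        using \<beta> i tot[of \<beta>] by (auto simp: box_def keys_add_nat lookup_add)
    qed
    also have "\<dots> = partial_eval m y (box m N) (mps_deriv i F) * fls_deriv (y i)"
      unfolding partial_eval_def sum_distrib_right
    proof (rule sum.cong)
      fix \<beta>
      have "fls_const (of_nat (Poly_Mapping.lookup \<beta> i + 1) * F (\<beta> + ?e)) =
          (of_nat (Poly_Mapping.lookup \<beta> i + 1) :: 'k fls) * fls_const (F (\<beta> + ?e))"
        by (metis fls_const_mult_const fls_of_nat)
      then show "?t i (\<beta> + ?e) = fls_const (mps_deriv i F \<beta>) * mon m y \<beta> * fls_deriv (y i)"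
        by (simp add: mps_deriv_def lookup_add mult_ac)
    qed simp
    finally show "(\<Sum>\<alpha>\<in>box m (Suc N). ?t i \<alpha>) =
       partial_eval m y (box m N) (mps_deriv i F) * fls_deriv (y i)" .
  qed simp
  finally show ?thesis .
qed

lemma mps_eval_chain_rule:
  fixes y :: "nat \<Rightarrow> ('k::field) fls"
  assumes y: "\<forall>i<m. ord_ge 1 (y i)"
  shows "fls_deriv (mps_eval m y F) = (\<Sum>i<m. mps_eval m y (mps_deriv i F) * fls_deriv (y i))"
proof (rule fls_eq_of_approx)
  fix N
  let ?e = "mps_eval m y" and ?p = "partial_eval m y (box m N)"
  let ?q = "partial_eval m y (box m (Suc N)) F"
  have y': "ord_ge 0 (fls_deriv (y i))" if "i < m" for i
    using y that by (auto intro: ord_ge_deriv)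
  \<comment> \<open>Differentiating loses one order, so F is truncated at \<open>Suc N\<close> to
    keep precision N + 1.\<close>
  have "ord_ge (int N + 1) (fls_deriv (?e F - ?q))"
    by (rule ord_ge_deriv) (use mps_eval_approx_box[OF y, where N = "Suc N" and F = F] in \<open>simp add: add.commute\<close>)
  moreover have "ord_ge (int N + 1) (\<Sum>i<m. (?e (mps_deriv i F) - ?p (mps_deriv i F)) * fls_deriv (y i))"
    using y' by (intro ord_ge_sum ord_ge_mult_right mps_eval_approx_box[OF y]) auto
  ultimately have "ord_ge (int N + 1) (fls_deriv (?e F - ?q) -
      (\<Sum>i<m. (?e (mps_deriv i F) - ?p (mps_deriv i F)) * fls_deriv (y i)))"
    by (rule ord_ge_diff)
  also have "fls_deriv (?e F - ?q) -
      (\<Sum>i<m. (?e (mps_deriv i F) - ?p (mps_deriv i F)) * fls_deriv (y i)) =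
     fls_deriv (?e F) - (\<Sum>i<m. ?e (mps_deriv i F) * fls_deriv (y i))"
    by (simp add: partial_eval_deriv left_diff_distrib sum_subtractf)
  finally show "ord_ge (int N) (fls_deriv (?e F) - (\<Sum>i<m. ?e (mps_deriv i F) * fls_deriv (y i)))"
    by (rule ord_ge_mono) simp
qed

text \<open>Series in the first n variables take the same value at the generators of R and at the
  longer tuple generating S; this lets elements of R and their differentials be compared inside
  S.\<close>

lemma mps_eval_restrict:
  fixes y :: "nat \<Rightarrow> ('k::field) fls"
  assumes F: "F \<in> mps_carrier n" and "n \<le> m" and yx: "\<And>i. i < n \<Longrightarrow> y i = x i"
  shows "mps_eval m y F = mps_eval n x F"
proof (rule fls_eqI)
  fix k
  have z: "Poly_Mapping.lookup \<alpha> i = 0" if "Poly_Mapping.keys \<alpha> \<subseteq> {..<n}" "n \<le> i"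
    for \<alpha> :: "nat \<Rightarrow>\<^sub>0 nat" and i
    using that by (meson in_keys_iff lessThan_iff linorder_not_le subsetD)
  have mon: "mon m y \<alpha> = mon n x \<alpha>" if "Poly_Mapping.keys \<alpha> \<subseteq> {..<n}" for \<alpha>
  proof -
    have "mon m y \<alpha> = (\<Prod>i<n. y i ^ Poly_Mapping.lookup \<alpha> i)"
      unfolding mon_def using that \<open>n \<le> m\<close>
      by (intro prod.mono_neutral_right) (auto simp: z)
    also have "\<dots> = mon n x \<alpha>" unfolding mon_def by (rule prod.cong) (auto simp: yx)
    finally show ?thesis .
  qed
  have tot: "(\<Sum>i<m. Poly_Mapping.lookup \<alpha> i) = (\<Sum>i<n. Poly_Mapping.lookup \<alpha> i)"
    if "Poly_Mapping.keys \<alpha> \<subseteq> {..<n}" for \<alpha> :: "nat \<Rightarrow>\<^sub>0 nat"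
    using that \<open>n \<le> m\<close> by (intro sum.mono_neutral_right) (auto simp: z)
  have "(\<Sum>\<alpha>\<in>box m (nat k). F \<alpha> * mon m y \<alpha> $$ k) = (\<Sum>\<alpha>\<in>box n (nat k). F \<alpha> * mon m y \<alpha> $$ k)"
  proof (rule sum.mono_neutral_right)
    have "Poly_Mapping.keys \<alpha> \<subseteq> {..<m}" if "Poly_Mapping.keys \<alpha> \<subseteq> {..<n}" for \<alpha> :: "nat \<Rightarrow>\<^sub>0 nat"
      using that \<open>n \<le> m\<close> by fastforce
    then show "box n (nat k) \<subseteq> box m (nat k)"
      unfolding box_def using tot by auto
    show "\<forall>\<alpha>\<in>box m (nat k) - box n (nat k). F \<alpha> * mon m y \<alpha> $$ k = 0"
    proof
      fix \<alpha> assume \<alpha>: "\<alpha> \<in> box m (nat k) - box n (nat k)"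
      have "F \<alpha> = 0"
        using mps_carrierD[OF F, of \<alpha>] tot[of \<alpha>] \<alpha> by (cases "F \<alpha> = 0") (auto simp: box_def)
      then show "F \<alpha> * mon m y \<alpha> $$ k = 0" by simp
    qed
  qed (rule finite_box)
  also have "\<dots> = (\<Sum>\<alpha>\<in>box n (nat k). F \<alpha> * mon n x \<alpha> $$ k)"
    by (rule sum.cong) (auto simp: mon box_keys)
  finally show "mps_eval m y F $$ k = mps_eval n x F $$ k"
    by (simp add: mps_eval_nth)
qed

lemma mps_eval_nth_0:
  assumes "\<forall>i<m. ord_ge 1 (y i)"
  shows "mps_eval m y F $$ 0 = F 0"
proof -
  have "box m 0 = {0}"
    by (auto simp: box_def in_keys_iff subset_iff intro!: poly_mapping_eqI)
  then show ?thesis by (simp add: mps_eval_nth)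
qed

text \<open>Every nonconstant monomial contains some factor y_i. Applied to R, this gives its
  non-units order at least a.\<close>

lemma mps_eval_ord_of_zero_const:
  fixes y :: "nat \<Rightarrow> ('k::field) fls"
  assumes y: "\<forall>i<m. ord_ge a (y i)" and a: "0 \<le> a" and F: "F 0 = 0"
  shows "ord_ge a (mps_eval m y F)"
  unfolding ord_ge_def
proof (intro allI impI)
  fix k :: int assume k: "k < a"
  have "F \<alpha> * mon m y \<alpha> $$ k = 0" if \<alpha>: "\<alpha> \<in> box m (nat k)" for \<alpha>
  proof (cases "\<alpha> = 0")
    case False
    then obtain i where i: "i \<in> Poly_Mapping.keys \<alpha>" by (metis keys_eq_empty ex_in_conv)
    then have "i < m" using \<alpha> by (auto simp: box_def)
    then have "Poly_Mapping.lookup \<alpha> i \<le> (\<Sum>i<m. Poly_Mapping.lookup \<alpha> i)"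
      by (intro member_le_sum) auto
    with i have "1 \<le> (\<Sum>i<m. Poly_Mapping.lookup \<alpha> i)" by (simp add: in_keys_iff)
    then have "a \<le> int (\<Sum>i<m. Poly_Mapping.lookup \<alpha> i) * a"
      using a by (metis mult.left_neutral mult_right_mono of_nat_1 of_nat_mono)
    with mon_ord[OF y, of \<alpha>] k show ?thesis by (simp add: ord_ge_def)
  qed (simp add: F)
  then have "(\<Sum>\<alpha>\<in>box m (nat k). F \<alpha> * mon m y \<alpha> $$ k) = 0" by (intro sum.neutral ballI)
  then show "mps_eval m y F $$ k = 0" by (simp add: mps_eval_nth)
qed

lemma mps_deriv_var: "mps_deriv i (mps_var j) = (if i = j then mps_one else (\<lambda>\<alpha>. 0))"
proof
  fix \<alpha> :: "nat \<Rightarrow>\<^sub>0 nat"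
  show "mps_deriv i (mps_var j) \<alpha> = (if i = j then mps_one else (\<lambda>\<alpha>. 0 :: 'a)) \<alpha>"
  proof (cases "i = j")
    case True
    then show ?thesis by (auto simp: mps_deriv_def mps_var_def mps_one_def)
  next
    case False
    then have "\<alpha> + Poly_Mapping.single i 1 \<noteq> Poly_Mapping.single j 1"
      by (metis add_is_0 lookup_add lookup_single_eq lookup_single_not_eq one_neq_zero)
    with False show ?thesis by (simp add: mps_deriv_def mps_var_def)
  qed
qed


section \<open>Polynomials over the power series in the first variable\<close>

text \<open>The embedding of k[[Y_0]] into the power series in more variables; through it,
  polynomials over k[[x_0]] become power series relations.\<close>

definition mps_of_fps :: "('k::field) fps \<Rightarrow> 'k mps" where
  "mps_of_fps c = (\<lambda>\<alpha>. if Poly_Mapping.keys \<alpha> \<subseteq> {0} then fps_nth c (Poly_Mapping.lookup \<alpha> 0) else 0)"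

lemma mps_of_fps_carrier: "0 < m \<Longrightarrow> mps_of_fps c \<in> mps_carrier m"
  by (auto simp: mps_carrier_def mps_of_fps_def)

lemma mps_deriv_of_fps: "i \<noteq> 0 \<Longrightarrow> mps_deriv i (mps_of_fps c) = (\<lambda>\<alpha>. 0)"
  by (auto simp: mps_deriv_def mps_of_fps_def keys_add_nat fun_eq_iff)

lemma mps_eval_of_fps:
  fixes y :: "nat \<Rightarrow> ('k::field) fls"
  assumes m: "0 < m" and y0: "y 0 = fps_to_fls (fps_X ^ a)" and a: "0 < a"
  shows "mps_eval m y (mps_of_fps c) = fps_to_fls (fps_compose c (fps_X ^ a))"
proof (rule fls_eqI)
  fix k :: int
  show "mps_eval m y (mps_of_fps c) $$ k = fps_to_fls (fps_compose c (fps_X ^ a)) $$ k"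
  proof (cases "k < 0")
    case False
    let ?s = "\<lambda>j. Poly_Mapping.single 0 j :: nat \<Rightarrow>\<^sub>0 nat"
    have mon: "mon m y (?s j) = fps_to_fls ((fps_X ^ a) ^ j)" for j
      using m by (simp add: mon_single y0 fps_to_fls_power)
    have "(\<Sum>\<alpha>\<in>box m (nat k). mps_of_fps c \<alpha> * mon m y \<alpha> $$ k) =
        (\<Sum>\<alpha>\<in>?s ` {..nat k}. mps_of_fps c \<alpha> * mon m y \<alpha> $$ k)"
    proof (rule sum.mono_neutral_right)
      show "?s ` {..nat k} \<subseteq> box m (nat k)"
        using m by (auto simp: box_def lookup_single when_def split: if_splits)
      show "\<forall>\<alpha>\<in>box m (nat k) - ?s ` {..nat k}. mps_of_fps c \<alpha> * mon m y \<alpha> $$ k = 0"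
      proof
        fix \<alpha> assume \<alpha>: "\<alpha> \<in> box m (nat k) - ?s ` {..nat k}"
        have "\<not> Poly_Mapping.keys \<alpha> \<subseteq> {0}"
        proof
          assume "Poly_Mapping.keys \<alpha> \<subseteq> {0}"
          then have "\<alpha> = ?s (Poly_Mapping.lookup \<alpha> 0)"
            by (intro poly_mapping_eqI) (auto simp: lookup_single when_def in_keys_iff subset_iff)
          moreover have "Poly_Mapping.lookup \<alpha> 0 \<le> (\<Sum>i<m. Poly_Mapping.lookup \<alpha> i)"
            using m by (intro member_le_sum) auto
          ultimately show False using \<alpha> by (auto simp: box_def)
        qed
        then show "mps_of_fps c \<alpha> * mon m y \<alpha> $$ k = 0" by (simp add: mps_of_fps_def)
      qed
    qed (rule finite_box)
    also have "\<dots> = (\<Sum>j\<le>nat k. mps_of_fps c (?s j) * mon m y (?s j) $$ k)"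
      by (subst sum.reindex) (auto simp: inj_on_def dest: arg_cong[of _ _ "\<lambda>\<alpha>. Poly_Mapping.lookup \<alpha> 0"])
    also have "\<dots> = (\<Sum>j\<le>nat k. fps_nth c j * fps_nth ((fps_X ^ a) ^ j) (nat k))"
      using False by (intro sum.cong) (auto simp: mps_of_fps_def mon)
    also have "\<dots> = fps_nth (fps_compose c (fps_X ^ a)) (nat k)"
      by (simp add: fps_compose_nth atMost_atLeast0)
    finally show ?thesis using False by (simp add: mps_eval_nth)
  qed (simp add: mps_eval_nth)
qed

text \<open>Horner's scheme turns a polynomial over k[[Y_0]], taken at Y_i, into a single power
  series. At y its partial derivatives vanish away from 0 and i; the one at 0 is left open, since
  orthogonality settles that component later.\<close>

lemma exists_mps_of_poly:
  fixes y :: "nat \<Rightarrow> ('k::field) fls" and q :: "'k fps poly"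
  assumes m: "0 < m" and y: "\<forall>i<m. ord_ge 1 (y i)"
    and y0: "y 0 = fps_to_fls (fps_X ^ a)" and a: "0 < a" and i: "i < m" "i \<noteq> 0"
  defines "\<phi> \<equiv> \<lambda>c. fps_to_fls (fps_compose c (fps_X ^ a))"
  shows "\<exists>F\<in>mps_carrier m. mps_eval m y F = poly (map_poly \<phi> q) (y i) \<and>
     mps_eval m y (mps_deriv i F) = poly (pderiv (map_poly \<phi> q)) (y i) \<and>
     (\<forall>j. j \<noteq> 0 \<and> j \<noteq> i \<longrightarrow> mps_eval m y (mps_deriv j F) = 0)"
proof (induction q)
  case 0
  then show ?case
    by (intro bexI[of _ "\<lambda>\<alpha>. 0"]) (auto simp: mps_zero_carrier mps_deriv_def)
next
  case (pCons c q)
  then obtain F where F: "F \<in> mps_carrier m" "mps_eval m y F = poly (map_poly \<phi> q) (y i)"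
     "mps_eval m y (mps_deriv i F) = poly (pderiv (map_poly \<phi> q)) (y i)"
     "\<forall>j. j \<noteq> 0 \<and> j \<noteq> i \<longrightarrow> mps_eval m y (mps_deriv j F) = 0" by blast
  have \<phi>0: "\<phi> 0 = 0" by (simp add: \<phi>_def)
  have e: "mps_eval m y (mps_of_fps c) = \<phi> c"
    unfolding \<phi>_def using m y0 a by (rule mps_eval_of_fps)
  let ?G = "\<lambda>\<alpha>. mps_of_fps c \<alpha> + mps_times (mps_var i) F \<alpha>"
  have "?G \<in> mps_carrier m"
    using F m i by (intro mps_add_carrier mps_times_carrier mps_of_fps_carrier mps_var_carrier)
  moreover have "mps_eval m y ?G = poly (map_poly \<phi> (pCons c q)) (y i)"
    using i by (simp add: mps_eval_add e mps_eval_times[OF y] mps_eval_var[OF y]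
        map_poly_pCons[of \<phi>, OF \<phi>0] F(2))
  moreover have "mps_eval m y (mps_deriv i ?G) = poly (pderiv (map_poly \<phi> (pCons c q))) (y i)"
    using i by (simp add: mps_deriv_add mps_deriv_times mps_deriv_of_fps mps_deriv_var mps_eval_add
        mps_eval_times[OF y] mps_eval_one[OF y] mps_eval_var[OF y] map_poly_pCons[of \<phi>, OF \<phi>0]
        pderiv_pCons F)
  moreover have "mps_eval m y (mps_deriv j ?G) = 0" if "j \<noteq> 0" "j \<noteq> i" for j
    using that F i by (simp add: mps_deriv_add mps_deriv_times mps_deriv_of_fps mps_deriv_var mps_eval_add
        mps_eval_times[OF y] mps_eval_var[OF y])
  ultimately show ?case by blast
qed


section \<open>Algebraicity over the power series in a power of the variable\<close>

text \<open>Gaussian elimination by cross-multiplication, valid over any domain: it serves over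
  k[[t]] for the annihilating polynomial and over k for the final count.\<close>

lemma exists_nontrivial_solution:
  fixes f :: "'l \<Rightarrow> 'j \<Rightarrow> 'a::idom"
  assumes "finite J" "finite L" "card J < card L"
  shows "\<exists>c. (\<exists>l\<in>L. c l \<noteq> 0) \<and> (\<forall>j\<in>J. (\<Sum>l\<in>L. c l * f l j) = 0)"
  using assms
proof (induction J arbitrary: L f rule: finite_induct)
  case empty
  then obtain l where "l \<in> L" by (metis card.empty ex_in_conv less_irrefl)
  then show ?case by (intro exI[of _ "\<lambda>_. 1"]) auto
next
  case (insert j J)
  show ?case
  proof (cases "\<forall>l\<in>L. f l j = 0")
    case True
    from insert obtain c where c: "\<exists>l\<in>L. c l \<noteq> 0" "\<forall>j\<in>J. (\<Sum>l\<in>L. c l * f l j) = 0"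
      by (metis card_insert_disjoint Suc_lessD)
    with True show ?thesis by (intro exI[of _ c]) auto
  next
    case False
    then obtain l0 where l0: "l0 \<in> L" "f l0 j \<noteq> 0" by blast
    define L' where "L' = L - {l0}"
    have L': "finite L'" "l0 \<notin> L'" "L = insert l0 L'" using insert l0 by (auto simp: L'_def)
    then have "card J < card L'" using insert by simp
    with insert.IH[OF L'(1), of "\<lambda>l i. f l0 j * f l i - f l j * f l0 i"]
    obtain c where c: "\<exists>l\<in>L'. c l \<noteq> 0"
      "\<forall>i\<in>J. (\<Sum>l\<in>L'. c l * (f l0 j * f l i - f l j * f l0 i)) = 0" by blast
    \<comment> \<open>With pivot \<open>f l0 j\<close>, this value of \<open>c' l0\<close> solves
      equation j, and scaling the other unknowns by the pivot clears the denominator.\<close>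
    define c' where "c' l = (if l = l0 then - (\<Sum>l\<in>L'. c l * f l j) else c l * f l0 j)" for l
    have s: "(\<Sum>l\<in>L. c' l * f l i) = (\<Sum>l\<in>L'. c l * (f l0 j * f l i - f l j * f l0 i))" for i
    proof -
      have "(\<Sum>l\<in>L. c' l * f l i) = c' l0 * f l0 i + (\<Sum>l\<in>L'. c' l * f l i)"
        using L' by simp
      also have "(\<Sum>l\<in>L'. c' l * f l i) = (\<Sum>l\<in>L'. c l * f l0 j * f l i)"
        using L' by (intro sum.cong) (auto simp: c'_def)
      finally show ?thesis
        by (simp add: c'_def sum_distrib_left right_diff_distrib sum_subtractf mult_ac)
    qed
    have "\<forall>i\<in>insert j J. (\<Sum>l\<in>L. c' l * f l i) = 0"
      using c(2) by (simp add: s mult_ac)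
    moreover have "\<exists>l\<in>L. c' l \<noteq> 0"
    proof -
      from c(1) obtain l where "l \<in> L'" "c l \<noteq> 0" by blast
      with L' l0 show ?thesis by (intro bexI[of _ l]) (auto simp: c'_def)
    qed
    ultimately show ?thesis by blast
  qed
qed

text \<open>Sorting exponents by their residue modulo a shows that k[[t]] is spanned over k[[t^a]]
  by 1, ..., t^(a-1).\<close>

lemma fps_residue_decomposition:
  fixes w :: "('k::field) fps"
  assumes a: "0 < a"
  shows "w = (\<Sum>r<a. fps_X ^ r * fps_compose (Abs_fps (\<lambda>n. fps_nth w (a * n + r))) (fps_X ^ a))"
proof (rule fps_ext)
  fix N
  have "fps_nth (\<Sum>r<a. fps_X ^ r * fps_compose (Abs_fps (\<lambda>n. fps_nth w (a * n + r))) (fps_X ^ a)) N =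
     (\<Sum>r<a. if r = N mod a then fps_nth w N else 0)"
    unfolding fps_sum_nth
  proof (rule sum.cong)
    fix r assume r: "r \<in> {..<a}"
    show "fps_nth (fps_X ^ r * fps_compose (Abs_fps (\<lambda>n. fps_nth w (a * n + r))) (fps_X ^ a)) N =
      (if r = N mod a then fps_nth w N else 0)"
    proof (cases "r \<le> N \<and> a dvd N - r")
      case True
      then have "N = a * ((N - r) div a) + r" by simp
      then have "r = N mod a" using r by (metis lessThan_iff mod_less mod_mult_self4)
      moreover have "fps_nth (fps_X ^ r * fps_compose (Abs_fps (\<lambda>n. fps_nth w (a * n + r))) (fps_X ^ a)) N
          = fps_nth w N"
        using True by (simp add: fps_X_power_mult_nth fps_nth_compose_X_power)
      ultimately show ?thesis by simp
    next
      case False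
      moreover have "N mod a \<le> N \<and> a dvd N - N mod a" by (simp add: dvd_minus_mod)
      ultimately have "r \<noteq> N mod a" by blast
      with False show ?thesis
        by (auto simp: fps_X_power_mult_nth fps_nth_compose_X_power)
    qed
  qed simp
  also have "\<dots> = fps_nth w N" using a by simp
  finally show "fps_nth w N =
     fps_nth (\<Sum>r<a. fps_X ^ r * fps_compose (Abs_fps (\<lambda>n. fps_nth w (a * n + r))) (fps_X ^ a)) N" ..
qed

lemma fps_compose_X_power_eq_0:
  assumes "fps_compose c (fps_X ^ a) = (0 :: ('k::field) fps)" "0 < a"
  shows "c = 0"
proof (rule fps_ext)
  fix n
  have "fps_nth (fps_compose c (fps_X ^ a)) (a * n) = fps_nth c n"
    using assms(2) by (simp add: fps_nth_compose_X_power)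
  with assms(1) show "fps_nth c n = fps_nth 0 n" by simp
qed

lemma fps_to_fls_sum: "fps_to_fls (\<Sum>i\<in>I. f i) = (\<Sum>i\<in>I. fps_to_fls (f i))"
  by (induction I rule: infinite_finite_induct) auto

lemma poly_eq_sum_upto:
  fixes q :: "'a::comm_semiring_1 poly"
  assumes "Polynomial.degree q \<le> M"
  shows "poly q z = (\<Sum>i\<le>M. Polynomial.coeff q i * z ^ i)"
  unfolding poly_altdef using assms
  by (intro sum.mono_neutral_left) (auto simp: coeff_eq_0)

text \<open>The a + 1 powers 1, w, ..., w^a lie in a module generated by a elements over k[[t^a]],
  hence satisfy a nontrivial linear relation.\<close>

lemma exists_annihilating_poly:
  fixes w :: "('k::field) fps"
  assumes a: "0 < a"
  shows "\<exists>p. p \<noteq> 0 \<and>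
     poly (map_poly (\<lambda>c. fps_to_fls (fps_compose c (fps_X ^ a))) p) (fps_to_fls w) = 0"
proof -
  let ?\<psi> = "\<lambda>c :: 'k fps. fps_compose c (fps_X ^ a)"
  let ?comp = "\<lambda>v r. Abs_fps (\<lambda>n. fps_nth v (a * n + r)) :: 'k fps"
  have X0: "fps_nth (fps_X ^ a :: 'k fps) 0 = 0" using a by simp
  obtain c where c0: "\<exists>l\<in>{..a}. c l \<noteq> 0" and c: "\<forall>r\<in>{..<a}. (\<Sum>l\<le>a. c l * ?comp (w ^ l) r) = 0"
    using exists_nontrivial_solution[of "{..<a}" "{..a}" "\<lambda>l. ?comp (w ^ l)"] by auto
  define p where "p = Poly (map c [0..<Suc a])"
  have cp: "Polynomial.coeff p l = (if l \<le> a then c l else 0)" for l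
    by (simp add: p_def nth_default_def del: upt_Suc)
  have "p \<noteq> 0" using c0 cp by (metis atMost_iff coeff_0)
  moreover have "poly (map_poly (\<lambda>c. fps_to_fls (?\<psi> c)) p) (fps_to_fls w) = 0"
  proof -
    have "Polynomial.degree (map_poly (\<lambda>c. fps_to_fls (?\<psi> c)) p) \<le> a"
      by (rule degree_le) (simp add: coeff_map_poly cp)
    then have "poly (map_poly (\<lambda>c. fps_to_fls (?\<psi> c)) p) (fps_to_fls w) =
        (\<Sum>l\<le>a. fps_to_fls (?\<psi> (Polynomial.coeff p l)) * fps_to_fls w ^ l)"
      by (simp add: poly_eq_sum_upto coeff_map_poly)
    also have "\<dots> = (\<Sum>l\<le>a. fps_to_fls (?\<psi> (c l) * w ^ l))"
      by (rule sum.cong) (auto simp: cp fps_to_fls_power fls_times_fps_to_fls)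
    also have "\<dots> = fps_to_fls (\<Sum>l\<le>a. ?\<psi> (c l) * w ^ l)"
      by (simp add: fps_to_fls_sum)
    also have "(\<Sum>l\<le>a. ?\<psi> (c l) * w ^ l) = (\<Sum>l\<le>a. \<Sum>r<a. ?\<psi> (c l) * (fps_X ^ r * ?\<psi> (?comp (w ^ l) r)))"
      by (rule sum.cong[OF refl], subst fps_residue_decomposition[OF a]) (simp add: sum_distrib_left)
    also have "\<dots> = (\<Sum>r<a. fps_X ^ r * ?\<psi> (\<Sum>l\<le>a. c l * ?comp (w ^ l) r))"
      by (subst sum.swap) (simp add: fps_compose_sum_distrib fps_compose_mult_distrib[OF X0]
          sum_distrib_left mult_ac)
    also have "\<dots> = 0" using c by simp
    finally show ?thesis by simp
  qed
  ultimately show ?thesis by blast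
qed

text \<open>A nonzero polynomial of least degree annihilating \<open>y\<^sub>i\<close> is separable at \<open>y\<^sub>i\<close>, because its
  derivative has smaller Polynomial.degree and is nonzero in characteristic \<open>0\<close>.\<close>

lemma exists_separable_relation:
  fixes y :: "nat \<Rightarrow> ('k::field_char_0) fls"
  assumes m: "0 < m" and y: "\<forall>i<m. ord_ge 1 (y i)"
    and y0: "y 0 = fps_to_fls (fps_X ^ a)" and a: "0 < a" and i: "i < m" "i \<noteq> 0"
  shows "\<exists>F\<in>mps_carrier m. mps_eval m y F = 0 \<and> mps_eval m y (mps_deriv i F) \<noteq> 0 \<and>
     (\<forall>j. j \<noteq> 0 \<and> j \<noteq> i \<longrightarrow> mps_eval m y (mps_deriv j F) = 0)"
proof -
  define \<phi> where "\<phi> c = fps_to_fls (fps_compose c (fps_X ^ a))" for c :: "'k fps"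
  have \<phi>0: "\<phi> 0 = 0" by (simp add: \<phi>_def)
  define P where "P p \<longleftrightarrow> p \<noteq> 0 \<and> poly (map_poly \<phi> p) (y i) = 0" for p
  have "ord_ge 0 (y i)" using y i by (auto intro: ord_ge_mono)
  then obtain w where w: "y i = fps_to_fls w" unfolding ord_ge_0_iff_range by blast
  have "\<exists>p. P p"
    using exists_annihilating_poly[OF a, of w] unfolding P_def w \<phi>_def by blast
  then obtain p where p: "P p" and least: "\<And>q. P q \<Longrightarrow> Polynomial.degree p \<le> Polynomial.degree q"
    using ex_has_least_nat[of P _ Polynomial.degree] by blast
  \<comment> \<open>A nonzero constant cannot annihilate, because substituting t^a is injective; so
    the derivative of p will be nonzero.\<close>
  have "Polynomial.degree p \<noteq> 0"
  proof
    assume "Polynomial.degree p = 0"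
    then obtain c where c: "p = [:c:]" by (rule degree_eq_zeroE)
    with p have "\<phi> c = 0" by (simp add: P_def map_poly_pCons[of \<phi>, OF \<phi>0])
    then have "c = 0" using a by (auto simp: \<phi>_def dest: fps_compose_X_power_eq_0)
    with p c show False by (simp add: P_def)
  qed
  then have "pderiv p \<noteq> 0" "Polynomial.degree (pderiv p) < Polynomial.degree p"
    by (auto simp: pderiv_eq_0_iff degree_pderiv)
  then have nz: "poly (map_poly \<phi> (pderiv p)) (y i) \<noteq> 0"
    using least[of "pderiv p"] by (auto simp: P_def)
  have "\<phi> (of_nat k * c) = of_nat k * \<phi> c" for k c
    by (induction k) (auto simp: \<phi>0 distrib_right, auto simp: \<phi>_def fps_compose_add_distrib)
  then have "pderiv (map_poly \<phi> p) = map_poly \<phi> (pderiv p)"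
    by (intro poly_eqI) (simp add: coeff_pderiv coeff_map_poly \<phi>0 del: of_nat_Suc)
  with nz p exists_mps_of_poly[OF m y y0 a i, of p, folded \<phi>_def] show ?thesis
    unfolding P_def by auto
qed


section \<open>Jacobian images\<close>

definition subalg :: "('k::field) fls set \<Rightarrow> bool" where
  "subalg A \<longleftrightarrow> (\<forall>c. fls_const c \<in> A) \<and> (\<forall>f\<in>A. \<forall>g\<in>A. f + g \<in> A \<and> f * g \<in> A)"

lemma subalg_const: "subalg A \<Longrightarrow> fls_const c \<in> A"
  by (simp add: subalg_def)

lemma subalg_0: "subalg A \<Longrightarrow> 0 \<in> A"
  using subalg_const[of A 0] by simp

lemma subalg_1: "subalg A \<Longrightarrow> 1 \<in> A"
  using subalg_const[of A 1] by simp

lemma subalg_add: "subalg A \<Longrightarrow> f \<in> A \<Longrightarrow> g \<in> A \<Longrightarrow> f + g \<in> A"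
  by (simp add: subalg_def)

lemma subalg_mult: "subalg A \<Longrightarrow> f \<in> A \<Longrightarrow> g \<in> A \<Longrightarrow> f * g \<in> A"
  by (simp add: subalg_def)

lemma subalg_uminus:
  assumes "subalg A" "f \<in> A"
  shows "- f \<in> A"
proof -
  have "fls_const (- 1) * f = - f" by (rule fls_eqI) (simp add: fls_mult_const_nth)
  then show ?thesis using subalg_mult[OF assms(1) subalg_const[OF assms(1)] assms(2), of "- 1"] by simp
qed

lemma subalg_diff: "subalg A \<Longrightarrow> f \<in> A \<Longrightarrow> g \<in> A \<Longrightarrow> f - g \<in> A"
  using subalg_add[OF _ _ subalg_uminus, of A f g] by simp

lemma subalg_sum: "subalg A \<Longrightarrow> (\<And>i. i \<in> I \<Longrightarrow> f i \<in> A) \<Longrightarrow> sum f I \<in> A"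
  by (induction I rule: infinite_finite_induct) (auto simp: subalg_0 subalg_add)

lemma subalg_prod: "subalg A \<Longrightarrow> (\<And>i. i \<in> I \<Longrightarrow> f i \<in> A) \<Longrightarrow> prod f I \<in> A"
  by (induction I rule: infinite_finite_induct) (auto simp: subalg_1 subalg_mult)

lemma subalg_power: "subalg A \<Longrightarrow> f \<in> A \<Longrightarrow> f ^ k \<in> A"
  by (induction k) (auto simp: subalg_1 subalg_mult)

lemma subalg_power_series_alg:
  fixes y :: "nat \<Rightarrow> ('k::field) fls"
  assumes y: "\<forall>i<m. ord_ge 1 (y i)"
  shows "subalg (power_series_alg m y)"
  unfolding subalg_def power_series_alg_def mps_ring_simps
proof (intro conjI allI ballI)
  fix c :: 'k
  have "(\<lambda>\<alpha>. if \<alpha> = 0 then c else 0) \<in> mps_carrier m" by (simp add: mps_carrier_def)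
  then show "fls_const c \<in> mps_eval m y ` mps_carrier m"
    using mps_eval_const[OF y, of c] by (metis imageI)
next
  fix f g assume "f \<in> mps_eval m y ` mps_carrier m" "g \<in> mps_eval m y ` mps_carrier m"
  then obtain F G where FG: "F \<in> mps_carrier m" "G \<in> mps_carrier m" "f = mps_eval m y F" "g = mps_eval m y G"
    by blast
  show "f + g \<in> mps_eval m y ` mps_carrier m"
    using mps_add_carrier[OF FG(1,2)] mps_eval_add[of m y F G] FG by (metis imageI)
  show "f * g \<in> mps_eval m y ` mps_carrier m"
    using mps_times_carrier[OF FG(1,2)] mps_eval_times[OF y, of F G] FG by (metis imageI)
qed

lemma power_series_algI: "F \<in> mps_carrier m \<Longrightarrow> mps_eval m y F \<in> power_series_alg m y"
  by (simp add: power_series_alg_def)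

lemma jacobian_imageE:
  assumes "v \<in> jacobian_image A m y Fs"
  obtains a where "\<forall>j<length Fs. a j \<in> A"
    "v = (\<lambda>i. if i < m then \<Sum>j<length Fs. a j * mps_eval m y (mps_deriv i (Fs ! j)) else 0)"
  using assms unfolding jacobian_image_def by blast

lemma jacobian_image_add:
  assumes A: "subalg A" and u: "u \<in> jacobian_image A m y Fs" and v: "v \<in> jacobian_image A m y Fs"
  shows "(\<lambda>i. u i + v i) \<in> jacobian_image A m y Fs"
proof -
  obtain a where a: "\<forall>j<length Fs. a j \<in> A"
    "u = (\<lambda>i. if i < m then \<Sum>j<length Fs. a j * mps_eval m y (mps_deriv i (Fs ! j)) else 0)"
    using u by (rule jacobian_imageE)
  obtain b where b: "\<forall>j<length Fs. b j \<in> A"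
    "v = (\<lambda>i. if i < m then \<Sum>j<length Fs. b j * mps_eval m y (mps_deriv i (Fs ! j)) else 0)"
    using v by (rule jacobian_imageE)
  from a b show ?thesis
    unfolding jacobian_image_def using A
    by (intro CollectI exI[of _ "\<lambda>j. a j + b j"])
      (auto simp: fun_eq_iff distrib_right sum.distrib subalg_add)
qed

lemma jacobian_image_smult:
  assumes A: "subalg A" and b: "b \<in> A" and v: "v \<in> jacobian_image A m y Fs"
  shows "(\<lambda>i. b * v i) \<in> jacobian_image A m y Fs"
proof -
  obtain a where "\<forall>j<length Fs. a j \<in> A"
    and "v = (\<lambda>i. if i < m then \<Sum>j<length Fs. a j * mps_eval m y (mps_deriv i (Fs ! j)) else 0)"
    using v by (rule jacobian_imageE)
  then show ?thesis
    unfolding jacobian_image_def using A b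
    by (intro CollectI exI[of _ "\<lambda>j. b * a j"])
      (auto simp: fun_eq_iff sum_distrib_left mult.assoc subalg_mult)
qed

lemma jacobian_image_zero:
  assumes A: "subalg A"
  shows "(\<lambda>i. 0) \<in> jacobian_image A m y Fs"
  unfolding jacobian_image_def using subalg_0[OF A] by (intro CollectI exI[of _ "\<lambda>j. 0"]) auto

lemma jacobian_image_diff:
  assumes A: "subalg A" and u: "u \<in> jacobian_image A m y Fs" and v: "v \<in> jacobian_image A m y Fs"
  shows "(\<lambda>i. u i - v i) \<in> jacobian_image A m y Fs"
  using jacobian_image_add[OF A u jacobian_image_smult[OF A subalg_uminus[OF A subalg_1[OF A]] v]] by simp

lemma jacobian_image_sum:
  assumes A: "subalg A" and "\<And>l. l \<in> L \<Longrightarrow> v l \<in> jacobian_image A m y Fs"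
  shows "(\<lambda>i. \<Sum>l\<in>L. v l i) \<in> jacobian_image A m y Fs"
  using assms(2)
  by (induction L rule: infinite_finite_induct)
    (auto simp: jacobian_image_zero[OF A] jacobian_image_add[OF A])

text \<open>The coordinate vector of dF in the free module, with coefficients evaluated at
  y.\<close>

definition grad :: "nat \<Rightarrow> (nat \<Rightarrow> ('k::field) fls) \<Rightarrow> 'k mps \<Rightarrow> nat \<Rightarrow> 'k fls" where
  "grad m y F = (\<lambda>i. mps_eval m y (mps_deriv i F))"

lemma grad_vanishes: "F \<in> mps_carrier m \<Longrightarrow> m \<le> i \<Longrightarrow> grad m y F i = 0"
  by (simp add: grad_def mps_deriv_vanishes)

lemma grad_mem_power_series_alg: "F \<in> mps_carrier m \<Longrightarrow> grad m y F i \<in> power_series_alg m y"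
  by (simp add: grad_def power_series_algI mps_deriv_carrier)

lemma grad_times:
  assumes "\<forall>i<m. ord_ge 1 (y i)"
  shows "grad m y (mps_times F G) = (\<lambda>i. mps_eval m y G * grad m y F i + mps_eval m y F * grad m y G i)"
  by (simp add: grad_def fun_eq_iff mps_deriv_times mps_eval_add mps_eval_times[OF assms] mult.commute)

lemma grad_add: "grad m y (\<lambda>\<alpha>. F \<alpha> + G \<alpha>) = (\<lambda>i. grad m y F i + grad m y G i)"
  by (simp add: grad_def mps_deriv_add mps_eval_add)

lemma grad_diff: "grad m y (\<lambda>\<alpha>. F \<alpha> - G \<alpha>) = (\<lambda>i. grad m y F i - grad m y G i)"
  by (simp add: grad_def mps_deriv_diff mps_eval_diff)

lemma grad_var:
  assumes "\<forall>i<m. ord_ge 1 (y i)"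
  shows "grad m y (mps_var j) = (\<lambda>i. if i = j then 1 else 0)"
  by (auto simp: grad_def fun_eq_iff mps_deriv_var mps_eval_one[OF assms])

lemma presentsD:
  assumes "presents m y Fs A"
  shows "A = power_series_alg m y" "set Fs \<subseteq> mps_carrier m"
    "{F \<in> mps_carrier m. mps_eval m y F = 0} = Idl\<^bsub>mps_ring m\<^esub> (set Fs)"
  using assms unfolding presents_def Let_def
  by (auto simp: a_kernel_def' fls_ring_def)

text \<open>The relations whose gradient lies in the Jacobian image form an ideal: in d(GF) = G dF +
  F dG the second term vanishes at y. This ideal contains \<open>Fs\<close>, hence the whole
  kernel.\<close>

lemma grad_mem_jacobian_image:
  fixes y :: "nat \<Rightarrow> ('k::field) fls"
  assumes pr: "presents m y Fs A" and y: "\<forall>i<m. ord_ge 1 (y i)"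
    and F: "F \<in> mps_carrier m" "mps_eval m y F = 0"
  shows "grad m y F \<in> jacobian_image A m y Fs"
proof -
  note prD = presentsD[OF pr]
  have A: "subalg A" unfolding prD(1) by (rule subalg_power_series_alg[OF y])
  let ?J = "jacobian_image A m y Fs" and ?P = "mps_ring m :: 'k mps ring"
  interpret P: cring ?P by (rule cring_mps_ring)
  define I where "I = {F \<in> mps_carrier m. mps_eval m y F = 0 \<and> grad m y F \<in> ?J}"
  have inv: "\<ominus>\<^bsub>?P\<^esub> F = (\<lambda>\<alpha>. - F \<alpha>)" if "F \<in> mps_carrier m" for F
    using that by (intro P.minus_equality) (auto simp: mps_uminus_carrier)
  have mult: "mps_times G F \<in> I" if "F \<in> I" "G \<in> mps_carrier m" for F G
    using that jacobian_image_smult[OF A power_series_algI[of G m y, folded prD(1)], of "grad m y F" m y Fs]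
    by (auto simp: I_def mps_times_carrier mps_eval_times[OF y] grad_times[OF y])
  have "ideal I ?P"
  proof (rule idealI)
    show "subgroup I (add_monoid ?P)"
    proof (rule P.add.subgroupI)
      show "I \<subseteq> carrier ?P" by (auto simp: I_def)
      show "I \<noteq> {}"
        using jacobian_image_zero[OF A] by (auto simp: I_def grad_def mps_deriv_def mps_zero_carrier
            intro!: exI[of _ "\<lambda>\<alpha>. 0"])
    next
      fix F assume F: "F \<in> I"
      then have "\<ominus>\<^bsub>?P\<^esub> F = (\<lambda>\<alpha>. 0 - F \<alpha>)" by (subst inv) (auto simp: I_def)
      moreover have "(\<lambda>\<alpha>. 0 - F \<alpha>) \<in> I"
        using F jacobian_image_diff[OF A jacobian_image_zero[OF A], of "grad m y F" m y Fs]
        by (simp add: I_def mps_uminus_carrier mps_eval_uminus grad_def)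
          (simp add: mps_deriv_def mps_eval_uminus)
      ultimately show "\<ominus>\<^bsub>?P\<^esub> F \<in> I" by simp
    next
      fix F G assume "F \<in> I" "G \<in> I"
      then show "F \<oplus>\<^bsub>?P\<^esub> G \<in> I"
        by (auto simp: I_def mps_add_carrier mps_eval_add grad_add jacobian_image_add[OF A])
    qed
  next
    fix F G assume FG: "F \<in> I" "G \<in> carrier ?P"
    then show "G \<otimes>\<^bsub>?P\<^esub> F \<in> I" using mult by simp
    then show "F \<otimes>\<^bsub>?P\<^esub> G \<in> I" by (simp add: mps_times_commute)
  qed (rule P.ring_axioms)
  moreover have "set Fs \<subseteq> I"
  proof
    fix G assume G: "G \<in> set Fs"
    then obtain l where l: "l < length Fs" "G = Fs ! l" by (metis in_set_conv_nth)
    have "set Fs \<subseteq> Idl\<^bsub>?P\<^esub> (set Fs)" using prD(2) by (intro P.genideal_self) simp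
    with G prD(3) have G0: "G \<in> mps_carrier m" "mps_eval m y G = 0" by blast+
    have "grad m y G \<in> ?J"
      unfolding jacobian_image_def
    proof (intro CollectI exI conjI)
      show "\<forall>j<length Fs. (if j = l then 1 else 0) \<in> A" using A by (simp add: subalg_0 subalg_1)
      show "grad m y G = (\<lambda>i. if i < m then \<Sum>j<length Fs. (if j = l then 1 else 0) *
          mps_eval m y (mps_deriv i (Fs ! j)) else 0)"
      proof
        fix i
        have "(\<Sum>j<length Fs. (if j = l then 1 else 0) * mps_eval m y (mps_deriv i (Fs ! j))) = grad m y G i"
          using l by (simp add: grad_def if_distrib[of "\<lambda>t. t * _"] cong: if_cong)
        then show "grad m y G i = (if i < m then \<Sum>j<length Fs. (if j = l then 1 else 0) *
          mps_eval m y (mps_deriv i (Fs ! j)) else 0)"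
          using grad_vanishes[OF G0(1), of i y] by simp
      qed
    qed
    with G0 show "G \<in> I" by (simp add: I_def)
  qed
  ultimately have "Idl\<^bsub>?P\<^esub> (set Fs) \<subseteq> I" by (rule P.genideal_minimal)
  with F prD(3) show ?thesis unfolding I_def by blast
qed

text \<open>Differentiate F(y(t)) = 0 by the chain rule. This is what makes dy_i \<mapsto> y_i'(t)
  dt well defined on the module of differentials.\<close>

lemma jacobian_image_orthogonal:
  fixes y :: "nat \<Rightarrow> ('k::field) fls"
  assumes pr: "presents m y Fs A" and y: "\<forall>i<m. ord_ge 1 (y i)"
    and v: "v \<in> jacobian_image A m y Fs"
  shows "(\<Sum>i<m. v i * fls_deriv (y i)) = 0"
proof -
  note prD = presentsD[OF pr]
  interpret P: cring "mps_ring m :: 'k mps ring" by (rule cring_mps_ring)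
  obtain a where a: "v = (\<lambda>i. if i < m then \<Sum>j<length Fs. a j * mps_eval m y (mps_deriv i (Fs ! j)) else 0)"
    using v by (rule jacobian_imageE)
  have z: "(\<Sum>i<m. mps_eval m y (mps_deriv i (Fs ! j)) * fls_deriv (y i)) = 0" if "j < length Fs" for j
  proof -
    have "Fs ! j \<in> Idl\<^bsub>mps_ring m\<^esub> (set Fs)"
      using P.genideal_self[of "set Fs"] prD(2) that by auto
    then have "mps_eval m y (Fs ! j) = 0" using prD(3) by blast
    then show ?thesis using mps_eval_chain_rule[OF y, of "Fs ! j"] by simp
  qed
  have "(\<Sum>i<m. v i * fls_deriv (y i)) =
      (\<Sum>i<m. \<Sum>j<length Fs. a j * (mps_eval m y (mps_deriv i (Fs ! j)) * fls_deriv (y i)))"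
    unfolding a by (rule sum.cong) (auto simp: sum_distrib_right mult.assoc)
  also have "\<dots> = (\<Sum>j<length Fs. a j * (\<Sum>i<m. mps_eval m y (mps_deriv i (Fs ! j)) * fls_deriv (y i)))"
    by (subst sum.swap) (simp add: sum_distrib_left)
  also have "\<dots> = 0" using z by simp
  finally show ?thesis .
qed

text \<open>The module of differentials has rank \<open>1\<close>: subtracting multiples of the gradients of the
  separable relations between \<open>y\<^sub>0\<close> and each \<open>y\<^sub>i\<close> leaves only the component at \<open>0\<close>, which the
  orthogonality relation then forces to vanish.\<close>

lemma orthogonal_imp_torsion:
  fixes y :: "nat \<Rightarrow> ('k::field_char_0) fls"
  assumes pr: "presents m y Fs A" and y: "\<forall>i<m. ord_ge 1 (y i)" and m: "0 < m"
    and y0: "y 0 = fps_to_fls (fps_X ^ a)" and a: "0 < a"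
    and v: "\<forall>i<m. v i \<in> A" "\<forall>i\<ge>m. v i = 0" and orth: "(\<Sum>i<m. v i * fls_deriv (y i)) = 0"
  shows "\<exists>b\<in>A. b \<noteq> 0 \<and> (\<lambda>i. b * v i) \<in> jacobian_image A m y Fs"
proof -
  note prD = presentsD[OF pr]
  have A: "subalg A" unfolding prD(1) by (rule subalg_power_series_alg[OF y])
  let ?J = "jacobian_image A m y Fs"
  have "\<forall>i\<in>{1..<m}. \<exists>F. F \<in> mps_carrier m \<and> mps_eval m y F = 0 \<and> grad m y F i \<noteq> 0 \<and>
     (\<forall>j. j \<noteq> 0 \<and> j \<noteq> i \<longrightarrow> grad m y F j = 0)"
  proof
    fix i assume "i \<in> {1..<m}"
    then have "i < m" "i \<noteq> 0" by auto
    from exists_separable_relation[OF m y y0 a this]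
    show "\<exists>F. F \<in> mps_carrier m \<and> mps_eval m y F = 0 \<and> grad m y F i \<noteq> 0 \<and>
        (\<forall>j. j \<noteq> 0 \<and> j \<noteq> i \<longrightarrow> grad m y F j = 0)"
      unfolding grad_def by blast
  qed
  from bchoice[OF this] obtain F where F: "\<forall>i\<in>{1..<m}. F i \<in> mps_carrier m \<and> mps_eval m y (F i) = 0 \<and>
      grad m y (F i) i \<noteq> 0 \<and> (\<forall>j. j \<noteq> 0 \<and> j \<noteq> i \<longrightarrow> grad m y (F i) j = 0)"
    by blast
  define D where "D i = grad m y (F i) i" for i
  have DA: "D i \<in> A" if "i \<in> {1..<m}" for i
    using F that unfolding D_def prD(1) by (blast intro: grad_mem_power_series_alg)
  define b where "b = (\<Prod>i\<in>{1..<m}. D i)"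
  \<comment> \<open>The factor \<open>D i\<close> is left out so that
    \<open>e i * D i = b * v i\<close> holds without dividing.\<close>
  define e where "e i = v i * (\<Prod>l\<in>{1..<m} - {i}. D l)" for i
  have eA: "e i \<in> A" if "i \<in> {1..<m}" for i
    unfolding e_def using that v DA A by (intro subalg_mult subalg_prod) auto
  define g where "g = (\<lambda>j. \<Sum>i\<in>{1..<m}. e i * grad m y (F i) j)"
  have g: "g \<in> ?J"
    unfolding g_def using F eA
    by (intro jacobian_image_sum[OF A] jacobian_image_smult[OF A] grad_mem_jacobian_image[OF pr y]) auto
  have gj: "g j = b * v j" if j: "j \<in> {1..<m}" for j
  proof -
    have "g j = (\<Sum>i\<in>{j}. e i * grad m y (F i) j)"
      unfolding g_def using F j by (intro sum.mono_neutral_right) auto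
    also have "\<dots> = v j * ((\<Prod>l\<in>{1..<m} - {j}. D l) * D j)" by (simp add: e_def D_def)
    also have "(\<Prod>l\<in>{1..<m} - {j}. D l) * D j = b"
      unfolding b_def using j by (subst (2) prod.remove[of _ j]) auto
    finally show ?thesis by simp
  qed
  have "(\<Sum>i<m. g i * fls_deriv (y i)) = 0" by (rule jacobian_image_orthogonal[OF pr y g])
  then have "(\<Sum>i<m. (b * v i - g i) * fls_deriv (y i)) = b * (\<Sum>i<m. v i * fls_deriv (y i))"
    by (simp add: left_diff_distrib sum_subtractf sum_distrib_left mult.assoc)
  moreover have "(\<Sum>i<m. (b * v i - g i) * fls_deriv (y i)) =
      (\<Sum>i\<in>{0}. (b * v i - g i) * fls_deriv (y i))"
    using m gj by (intro sum.mono_neutral_right) auto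
  ultimately have "(b * v 0 - g 0) * fls_deriv (y 0) = 0" using orth by simp
  \<comment> \<open>Characteristic 0 is used here: the coefficient of t^(a-1) in the derivative of
    t^a is a.\<close>
  moreover have "fls_deriv (y 0) \<noteq> 0"
  proof
    assume "fls_deriv (y 0) = 0"
    then have "fls_deriv (y 0) $$ (int a - 1) = 0" by simp
    then show False using a by (simp add: y0)
  qed
  ultimately have g0: "g 0 = b * v 0" by simp
  have "g = (\<lambda>i. b * v i)"
  proof
    fix i
    consider "i = 0" | "i \<in> {1..<m}" | "m \<le> i" by fastforce
    then show "g i = b * v i"
    proof cases
      case 3
      then show ?thesis using F v(2) by (auto simp: g_def intro!: sum.neutral grad_vanishes)
    qed (use g0 gj in auto)
  qed
  moreover have "b \<noteq> 0" unfolding b_def using F by (simp add: D_def)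
  moreover have "b \<in> A" unfolding b_def using A DA by (intro subalg_prod)
  ultimately show ?thesis using g by blast
qed


section \<open>The conductor and the reduced type\<close>

lemma fls_ring_simps [simp]:
  "carrier (fls_ring A) = A" "monoid.mult (fls_ring A) = (*)" "monoid.one (fls_ring A) = 1"
  "ring.zero (fls_ring A) = 0" "ring.add (fls_ring A) = (+)"
  by (simp_all add: fls_ring_def)

lemma cring_fls_ring:
  assumes A: "subalg A"
  shows "cring (fls_ring A)"
proof (rule cringI)
  show "abelian_group (fls_ring A)"
  proof (rule abelian_groupI)
    fix f assume "f \<in> carrier (fls_ring A)"
    then show "\<exists>g\<in>carrier (fls_ring A). g \<oplus>\<^bsub>fls_ring A\<^esub> f = \<zero>\<^bsub>fls_ring A\<^esub>"
      using subalg_uminus[OF A] by (intro bexI[of _ "- f"]) auto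
  qed (auto simp: subalg_0[OF A] subalg_add[OF A] add_ac)
  show "Group.comm_monoid (fls_ring A)"
    by (rule comm_monoidI) (auto simp: subalg_1[OF A] subalg_mult[OF A] mult_ac)
qed (auto simp: distrib_right)

lemma fls_ring_minus:
  assumes A: "subalg A" and "f \<in> A" "g \<in> A"
  shows "f \<ominus>\<^bsub>fls_ring A\<^esub> g = f - g" "\<ominus>\<^bsub>fls_ring A\<^esub> g = - g"
proof -
  interpret cring "fls_ring A" by (rule cring_fls_ring[OF A])
  show "\<ominus>\<^bsub>fls_ring A\<^esub> g = - g"
    using assms subalg_uminus by (intro minus_equality) auto
  then show "f \<ominus>\<^bsub>fls_ring A\<^esub> g = f - g" by (simp add: a_minus_def)
qed

lemma ord_ge_X_power: "ord_ge (int b) (fls_X ^ b :: ('k::field) fls)"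
  by (simp add: ord_ge_def fls_X_power_nth)

lemma ord_ge_divide:
  fixes f q :: "('k::field) fls"
  assumes "q \<noteq> 0" "ord_ge (fls_subdegree q + m) f"
  shows "ord_ge m (f / q)"
  using assms by (cases "f = 0") (auto simp: ord_ge_iff fls_divide_subdegree)

text \<open>A finite geometric series: with f = k (1 - g) and g of positive order, the inverse of f
  is 1/k times the sum of g^i for i < c, plus g^c / f. The last term has order at least c, so it
  lies in A.\<close>

lemma Units_fls_ringI:
  fixes A :: "('k::field) fls set"
  assumes A: "subalg A" and c: "\<And>f. ord_ge (int c) f \<Longrightarrow> f \<in> A"
    and f: "f \<in> A" "ord_ge 0 f" "f $$ 0 \<noteq> 0"
  shows "f \<in> Units (fls_ring A)"
proof -
  define k where "k = f $$ 0"
  define g where "g = 1 - fls_const (inverse k) * f"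
  have f0: "f \<noteq> 0" using f(3) by auto
  have g: "g \<in> A" unfolding g_def using A f by (intro subalg_diff subalg_mult subalg_const subalg_1)
  have "ord_ge 1 g"
    using f unfolding ord_ge_def g_def k_def
    by (auto simp: fls_mult_const_nth)
  then have gc: "ord_ge (int c) (g ^ c)" using ord_ge_power[of 1 g c] by simp
  have "fls_subdegree f = 0"
    using f by (intro fls_subdegree_eqI) (auto simp: ord_ge_def)
  then have "ord_ge 0 (inverse f)" by (simp add: ord_ge_iff)
  then have 1: "g ^ c * inverse f \<in> A" by (intro c ord_ge_mult_right gc)
  have kf: "fls_const (inverse k) * f = 1 - g" by (simp add: g_def)
  have "(fls_const (inverse k) * (\<Sum>i<c. g ^ i)) * f = 1 - g ^ c"
    using one_diff_power_eq[of g c] kf by (metis mult.assoc mult.commute)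
  then have "fls_const (inverse k) * (\<Sum>i<c. g ^ i) + g ^ c * inverse f = inverse f"
    using f0 by (simp add: field_simps)
  moreover have "fls_const (inverse k) * (\<Sum>i<c. g ^ i) \<in> A"
    using A g by (intro subalg_mult subalg_const subalg_sum subalg_power)
  ultimately have "inverse f \<in> A" using subalg_add[OF A _ 1] by metis
  then show ?thesis
    unfolding Units_def using f(1) f0 by (auto intro!: bexI[of _ "inverse f"])
qed

text \<open>Lets a list of coefficients be indexed by the gaps themselves.\<close>

lemma distinct_map_surj:
  assumes "distinct xs" "length ys = length xs"
  shows "\<exists>u. ys = map u xs"
proof (intro exI nth_equalityI)
  fix i assume "i < length ys"
  then show "ys ! i = map (\<lambda>b. the (map_of (zip xs ys) b)) xs ! i"
    using assms by (simp add: map_of_zip_nth)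
qed (simp add: assms)

locale branch =
  fixes n :: nat and x :: "nat \<Rightarrow> ('k::field_char_0) fls" and R :: "'k fls set" and a :: nat
  assumes n_pos: "0 < n"
    and R_eq: "R = power_series_alg n x"
    and x_ord: "\<forall>i<n. ord_ge (int a) (x i)"
    and a_pos: "0 < a"
    and x_0: "x 0 = fls_X ^ a"
    and int_closure_R: "int_closure R = range fps_to_fls"
begin

lemma x_0_fps: "x 0 = fps_to_fls (fps_X ^ a)"
  by (rule fls_eqI) (auto simp: x_0 split: if_splits)

lemma x_0_nz: "x 0 \<noteq> 0"
  by (simp add: x_0)

lemma subdegree_x_0: "fls_subdegree (x 0) = int a"
  by (simp add: x_0)

lemma x_ord_1: "\<forall>i<n. ord_ge 1 (x i)"
  using x_ord a_pos by (auto intro: ord_ge_mono)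

lemma subalg_R: "subalg R"
  unfolding R_eq by (rule subalg_power_series_alg[OF x_ord_1])

lemma R_ord: "f \<in> R \<Longrightarrow> ord_ge 0 f"
  by (auto simp: R_eq power_series_alg_def mps_eval_ord)

lemma x_0_in_R: "x 0 \<in> R"
  using n_pos mps_eval_var[OF x_ord_1, of 0] power_series_algI[OF mps_var_carrier[of 0 n], of x]
  by (simp add: R_eq)

lemma R_ord_of_zero_const:
  assumes "f \<in> R" "f $$ 0 = 0"
  shows "ord_ge (int a) f"
proof -
  obtain F where F: "f = mps_eval n x F" using assms(1) by (auto simp: R_eq power_series_alg_def)
  show ?thesis
    unfolding F using assms(2) F mps_eval_nth_0[OF x_ord_1, of F]
    by (intro mps_eval_ord_of_zero_const[OF x_ord]) auto
qed

lemma power_series_in_x_0: "fps_to_fls (fps_compose c (fps_X ^ a)) \<in> R"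
  using mps_eval_of_fps[of n x, OF n_pos x_0_fps a_pos, of c] power_series_algI[OF mps_of_fps_carrier[OF n_pos], of x c]
  by (simp add: R_eq)

text \<open>\<open>k[[t]]\<close> is generated over \<open>k[[x\<^sub>0]] \<subseteq> R\<close> by \<open>1, t, \<dots>, t\<^sup>a\<^sup>-\<^sup>1\<close>, all of which are fractions
  of elements of \<open>R\<close>, so a common denominator lies in the conductor.\<close>

lemma exists_conductor_element: "\<exists>q\<in>R. q \<noteq> 0 \<and> (\<forall>f. ord_ge 0 f \<longrightarrow> q * f \<in> R)"
proof -
  have "\<exists>p q. p \<in> R \<and> q \<in> R \<and> q \<noteq> 0 \<and> fps_to_fls (fps_X ^ r) = p / q" for r
  proof -
    have "fps_to_fls (fps_X ^ r :: 'k fps) \<in> int_closure R" unfolding int_closure_R by simp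
    then show ?thesis unfolding int_closure_def frac_field_def by blast
  qed
  then obtain p q where pq: "\<And>r. p r \<in> R" "\<And>r. q r \<in> R" "\<And>r. q r \<noteq> 0"
    "\<And>r. fps_to_fls (fps_X ^ r) = p r / q r" by metis
  define d where "d = (\<Prod>r<a. q r)"
  have d1: "d * fps_to_fls (fps_X ^ r) \<in> R" if "r < a" for r
  proof -
    have "d = q r * (\<Prod>l\<in>{..<a} - {r}. q l)"
      unfolding d_def using that by (intro prod.remove) auto
    then have "d * fps_to_fls (fps_X ^ r) = (\<Prod>l\<in>{..<a} - {r}. q l) * p r"
      using pq(3)[of r] by (simp add: pq(4) del: fps_to_fls_power)
    also have "\<dots> \<in> R" using subalg_R pq by (intro subalg_mult subalg_prod)
    finally show ?thesis .
  qed
  have "d * f \<in> R" if f0: "ord_ge 0 f" for f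
  proof -
    obtain w where f: "f = fps_to_fls w" using f0 unfolding ord_ge_0_iff_range by blast
    have "d * f = (\<Sum>r<a. (d * fps_to_fls (fps_X ^ r)) *
        fps_to_fls (fps_compose (Abs_fps (\<lambda>n. fps_nth w (a * n + r))) (fps_X ^ a)))"
      unfolding f by (subst fps_residue_decomposition[OF a_pos, of w])
        (simp add: fps_to_fls_sum fls_times_fps_to_fls sum_distrib_left mult.assoc)
    also have "\<dots> \<in> R"
      by (rule subalg_sum[OF subalg_R]) (auto intro: subalg_mult[OF subalg_R d1 power_series_in_x_0])
    finally show ?thesis .
  qed
  moreover have "d \<in> R" unfolding d_def using subalg_R pq by (intro subalg_prod)
  moreover have "d \<noteq> 0" unfolding d_def using pq by simp
  ultimately show ?thesis by blast
qed

section \<open>The conductor as the set of all series of order at least c\<close>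

lemma conductor_iff: "q \<in> conductor R \<longleftrightarrow> (\<forall>f. ord_ge 0 f \<longrightarrow> q * f \<in> R)"
proof
  assume "q \<in> conductor R"
  then show "\<forall>f. ord_ge 0 f \<longrightarrow> q * f \<in> R"
    unfolding conductor_def int_closure_R ord_ge_0_iff_range by blast
next
  assume q: "\<forall>f. ord_ge 0 f \<longrightarrow> q * f \<in> R"
  then have "q \<in> R" by (metis mult.right_neutral ord_ge_one)
  then have "q \<in> frac_field R"
    unfolding frac_field_def using subalg_1[OF subalg_R]
    by (intro CollectI exI[of _ q] exI[of _ 1]) auto
  with q show "q \<in> conductor R"
    unfolding conductor_def int_closure_R ord_ge_0_iff_range by auto
qed

abbreviation "c \<equiv> conductor_val R"

text \<open>The conductor is closed under multiplication by k[[t]]. If p in it has least order c,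
  then any q of order at least c is p times the power series q / p.\<close>

lemma conductor_eq: "q \<in> conductor R \<longleftrightarrow> ord_ge (int c) q"
proof -
  let ?P = "\<lambda>c. \<exists>q\<in>conductor R. q \<noteq> 0 \<and> fls_subdegree q = int c"
  obtain q0 where q0: "q0 \<in> R" "q0 \<noteq> 0" "\<forall>f. ord_ge 0 f \<longrightarrow> q0 * f \<in> R"
    using exists_conductor_element by blast
  \<comment> \<open>Orders of nonzero elements of R are natural numbers, so the \<open>LEAST\<close>
    in \<open>conductor_val\<close> is attained.\<close>
  have "0 \<le> fls_subdegree q0" using R_ord[OF q0(1)] q0(2) by (simp add: ord_ge_iff)
  then have "fls_subdegree q0 = int (nat (fls_subdegree q0))" by simp
  moreover have "q0 \<in> conductor R" unfolding conductor_iff by (rule q0(3))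
  ultimately have "?P (nat (fls_subdegree q0))" using q0(2) by blast
  then have "?P c" unfolding conductor_val_def by (rule LeastI)
  then obtain p where p: "p \<in> conductor R" "p \<noteq> 0" "fls_subdegree p = int c" by blast
  show ?thesis
  proof
    assume q: "q \<in> conductor R"
    show "ord_ge (int c) q"
    proof (cases "q = 0")
      case False
      have "q * 1 \<in> R" using q ord_ge_one unfolding conductor_iff by blast
      then have "q \<in> R" by simp
      then have "0 \<le> fls_subdegree q" using R_ord[of q] False by (simp add: ord_ge_iff)
      then have sq: "fls_subdegree q = int (nat (fls_subdegree q))" by simp
      with q False have "?P (nat (fls_subdegree q))" by blast
      then have "c \<le> nat (fls_subdegree q)" unfolding conductor_val_def by (rule Least_le)
      then have "int c \<le> fls_subdegree q" using sq by linarith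
      then show ?thesis by (simp add: ord_ge_iff)
    qed simp
  next
    assume q: "ord_ge (int c) q"
    then have qp: "ord_ge 0 (q / p)" using p by (intro ord_ge_divide) auto
    have "q * f \<in> R" if "ord_ge 0 f" for f
    proof -
      have "p * (q / p * f) \<in> R"
        using p(1) ord_ge_mult_left[OF qp that] unfolding conductor_iff by blast
      then show ?thesis using p(2) by simp
    qed
    then show "q \<in> conductor R" by (simp only: conductor_iff) blast
  qed
qed

lemma ord_ge_c_in_R: "ord_ge (int c) f \<Longrightarrow> f \<in> R"
  unfolding conductor_eq[symmetric] conductor_iff by (metis mult.right_neutral ord_ge_one)

lemma nonunit_zero_const:
  assumes A: "subalg A" "R \<subseteq> A" "f \<in> A" "ord_ge 0 f" "f \<notin> Units (fls_ring A)"
  shows "f $$ 0 = 0"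
  using Units_fls_ringI[OF A(1), of c f] assms ord_ge_c_in_R by blast

lemma maximal_id_ord:
  assumes "f \<in> maximal_id R"
  shows "ord_ge (int a) f"
  using assms nonunit_zero_const[OF subalg_R order_refl] R_ord R_ord_of_zero_const
  by (auto simp: maximal_id_def)

text \<open>Products of two non-units of R have order at least 2 a, and so do their sums; the
  conductor element t^c must obey this bound.\<close>

lemma twice_a_le_c:
  assumes "conductor R \<subseteq> maximal_id R \<cdot>\<^bsub>fls_ring R\<^esub> maximal_id R"
  shows "2 * a \<le> c"
proof -
  have "f \<in> maximal_id R \<cdot>\<^bsub>fls_ring R\<^esub> maximal_id R \<Longrightarrow> ord_ge (2 * int a) f" for f
  proof (induction rule: ideal_prod.induct)
    case (prod i j)
    then show ?case using ord_ge_mult[of "int a" i "int a" j] maximal_id_ord by simp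
  next
    case (sum s1 s2)
    then show ?case by (simp add: ord_ge_add)
  qed
  moreover have "fls_X ^ c \<in> conductor R" unfolding conductor_eq by (rule ord_ge_X_power)
  ultimately have "ord_ge (2 * int a) (fls_X ^ c :: 'k fls)" using assms by blast
  then show ?thesis by (simp add: ord_ge_iff)
qed

section \<open>Gap monomials as normal forms modulo R\<close>

abbreviation "gaps \<equiv> late_gaps R a"

lemma finite_gaps: "finite gaps"
  by (rule finite_subset[of _ "{..<c}"]) (auto simp: late_gaps_def)

lemma gaps_ge: "b \<in> gaps \<Longrightarrow> c \<le> b + a"
  by (simp add: late_gaps_def)

lemma gap_combination_nth:
  "(\<Sum>b\<in>gaps. fls_const (u b) * fls_X ^ b) $$ k = (if 0 \<le> k \<and> nat k \<in> gaps then u (nat k) else 0)"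
proof -
  have "(\<Sum>b\<in>gaps. fls_const (u b) * fls_X ^ b) $$ k = (\<Sum>b\<in>gaps. if k = int b then u b else 0)"
    by (simp add: fls_nth_sum fls_mult_const_nth fls_X_power_nth if_distrib cong: if_cong)
  also have "\<dots> = (\<Sum>b\<in>gaps. if b = nat k \<and> 0 \<le> k then u b else 0)"
    by (rule sum.cong) auto
  finally show ?thesis using finite_gaps by (cases "0 \<le> k") (auto simp: sum.delta)
qed

lemma gap_combination_ord:
  "ord_ge (int c - int a) (\<Sum>b\<in>gaps. fls_const (u b) * fls_X ^ b)"
  unfolding ord_ge_def gap_combination_nth using gaps_ge by fastforce

text \<open>The order of a nonzero combination is one of the gaps, and no nonzero element of R has a
  gap as its order.\<close>

lemma gap_combination_in_R:
  assumes R: "(\<Sum>b\<in>gaps. fls_const (u b) * fls_X ^ b) \<in> R" and b: "b \<in> gaps"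
  shows "u b = 0"
proof (rule ccontr)
  let ?h = "\<Sum>b\<in>gaps. fls_const (u b) * fls_X ^ b"
  assume "u b \<noteq> 0"
  then have "?h $$ int b \<noteq> 0" using b by (simp add: gap_combination_nth)
  then have h: "?h \<noteq> 0" by (metis fls_zero_nth)
  define e where "e = fls_subdegree ?h"
  have "?h $$ e \<noteq> 0" unfolding e_def using h by simp
  then have e: "0 \<le> e" "nat e \<in> gaps" by (auto simp: gap_combination_nth split: if_splits)
  moreover have "fls_subdegree ?h = int (nat e)" using e(1) by (simp add: e_def)
  ultimately show False using R h unfolding late_gaps_def by blast
qed

text \<open>Leading terms are removed one exponent at a time from c - a up to c. At a gap a multiple
  of t^e is subtracted, elsewhere a multiple of an element of R of order e; what remains at order c
  lies in R.\<close>

lemma gap_decomposition: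
  assumes "a \<le> c" "ord_ge (int c - int a) f"
  shows "\<exists>r u. r \<in> R \<and> f = r + (\<Sum>b\<in>gaps. fls_const (u b) * fls_X ^ b)"
proof -
  \<comment> \<open>The induction runs on the distance k = c - e to the conductor, and the bound c -
    a \<le> e is written without truncated subtraction.\<close>
  have "\<exists>r u. r \<in> R \<and> f = r + (\<Sum>b\<in>gaps. fls_const (u b) * fls_X ^ b)"
    if "c \<le> e + a" "ord_ge (int e) f" "k = c - e" for k e f
    using that
  proof (induction k arbitrary: e f)
    case 0
    then have "int c \<le> int e" by simp
    with 0 have "f \<in> R" by (intro ord_ge_c_in_R) (rule ord_ge_mono)
    then show ?case by (intro exI[of _ f] exI[of _ "\<lambda>_. 0"]) auto
  next
    case (Suc k)
    then have e: "e < c" by simp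
    have step: "ord_ge (int (Suc e)) (f - g)" if "ord_ge (int e) g" "g $$ int e = f $$ int e" for g
      unfolding ord_ge_def
    proof (intro allI impI)
      fix k assume "k < int (Suc e)"
      then have "k < int e \<or> k = int e" by linarith
      then show "(f - g) $$ k = 0" using that Suc.prems(2) by (auto simp: ord_ge_def)
    qed
    show ?case
    proof (cases "e \<in> gaps")
      case True
      let ?g = "fls_const (f $$ int e) * fls_X ^ e"
      have "ord_ge (int e) ?g" by (intro ord_ge_mult_left ord_ge_const ord_ge_X_power)
      then have "ord_ge (int (Suc e)) (f - ?g)"
        by (rule step) (simp add: fls_mult_const_nth fls_X_power_nth)
      from Suc.IH[OF _ this] Suc.prems obtain r u where r: "r \<in> R"
        "f - ?g = r + (\<Sum>b\<in>gaps. fls_const (u b) * fls_X ^ b)" by fastforce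
      have "(\<Sum>b\<in>gaps. fls_const (u b + (if b = e then f $$ int e else 0)) * fls_X ^ b) =
          (\<Sum>b\<in>gaps. fls_const (u b) * fls_X ^ b) + ?g"
        using True by (intro fls_eqI) (auto simp: gap_combination_nth fls_mult_const_nth fls_X_power_nth)
      with r show ?thesis
        by (intro exI[of _ r] exI[of _ "\<lambda>b. u b + (if b = e then f $$ int e else 0)"])
          (simp add: algebra_simps)
    next
      case False
      with Suc.prems(1) e obtain r0 where r0: "r0 \<in> R" "r0 \<noteq> 0" "fls_subdegree r0 = int e"
        by (auto simp: late_gaps_def)
      then have nz: "r0 $$ int e \<noteq> 0" by (metis nth_fls_subdegree_nonzero)
      let ?g = "fls_const (f $$ int e / r0 $$ int e) * r0"
      have "ord_ge (int e) ?g" using r0 by (intro ord_ge_mult_left ord_ge_const) (simp add: ord_ge_iff)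
      then have "ord_ge (int (Suc e)) (f - ?g)"
        by (rule step) (simp add: fls_mult_const_nth nz)
      from Suc.IH[OF _ this] Suc.prems obtain r u where r: "r \<in> R"
        "f - ?g = r + (\<Sum>b\<in>gaps. fls_const (u b) * fls_X ^ b)" by fastforce
      moreover have "r + ?g \<in> R"
        using subalg_R r(1) r0(1) by (intro subalg_add subalg_mult subalg_const)
      ultimately show ?thesis
        by (intro exI[of _ "r + ?g"] exI[of _ u]) (simp add: algebra_simps)
    qed
  qed
  from this[OF _ _ refl, of "c - a" f] show ?thesis using assms
    by (simp add: of_nat_diff)
qed

text \<open>Since x_0 = t^a, this is R plus the conductor divided by x_0. For a \<le> c it is
  already closed under products, and so bounds S from above.\<close>

definition overring :: "'k fls set" where
  "overring = {r + f | r f. r \<in> R \<and> ord_ge (int c - int a) f}"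

lemma overringI: "r \<in> R \<Longrightarrow> ord_ge (int c - int a) f \<Longrightarrow> r + f \<in> overring"
  unfolding overring_def by blast

lemma R_in_overring: "r \<in> R \<Longrightarrow> r \<in> overring"
  using overringI[of r 0] by simp

lemma overring_add: "f \<in> overring \<Longrightarrow> g \<in> overring \<Longrightarrow> f + g \<in> overring"
proof -
  assume "f \<in> overring" "g \<in> overring"
  then obtain r f' q g' where "r \<in> R" "ord_ge (int c - int a) f'" "f = r + f'"
    "q \<in> R" "ord_ge (int c - int a) g'" "g = q + g'" by (auto simp: overring_def)
  then show ?thesis
    using overringI[of "r + q" "f' + g'"] subalg_add[OF subalg_R] ord_ge_add
    by (metis add.assoc add.left_commute)
qed

lemma overring_mult:
  assumes ac: "a \<le> c" and "f \<in> overring" "g \<in> overring"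
  shows "f * g \<in> overring"
proof -
  obtain r f' q g' where f: "r \<in> R" "ord_ge (int c - int a) f'" "f = r + f'"
    and g: "q \<in> R" "ord_ge (int c - int a) g'" "g = q + g'" using assms by (auto simp: overring_def)
  have f0: "ord_ge 0 f'" using f(2) ac by (rule_tac ord_ge_mono) auto
  have "ord_ge (int c - int a) (r * g' + (f' * q + f' * g'))"
    using f g R_ord by (intro ord_ge_add ord_ge_mult_left[OF _ g(2)] ord_ge_mult_right[OF f(2)] f0) auto
  moreover have "r * q \<in> R" using f g subalg_R by (intro subalg_mult)
  ultimately have "r * q + (r * g' + (f' * q + f' * g')) \<in> overring" by (rule overringI[rotated])
  then show ?thesis by (simp add: f(3) g(3) algebra_simps)
qed

lemma overring_uminus: "a \<le> c \<Longrightarrow> f \<in> overring \<Longrightarrow> - f \<in> overring"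
  using overring_mult[OF _ R_in_overring[OF subalg_uminus[OF subalg_R subalg_1[OF subalg_R]]], of f] by simp

lemma adjoin_conductor_subset:
  assumes ac: "a \<le> c"
  shows "adjoin_conductor R (x 0) \<subseteq> overring"
proof
  fix f assume "f \<in> adjoin_conductor R (x 0)"
  then show "f \<in> overring"
    unfolding adjoin_conductor_def
  proof (induction rule: generate_ring.induct)
    case one
    then show ?case using R_in_overring subalg_1[OF subalg_R] by simp
  next
    case (incl h)
    then consider "h \<in> R" | z where "z \<in> conductor R" "h = z / x 0" by blast
    then show ?case
    proof cases
      case 2
      then have "ord_ge (int c - int a) h"
        using x_0_nz by (auto simp: conductor_eq subdegree_x_0 intro!: ord_ge_divide)
      then show ?thesis using overringI[of 0 h] subalg_0[OF subalg_R] by simp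
    qed (rule R_in_overring)
  next
    case (a_inv h)
    have "subalg (UNIV :: 'k fls set)" by (simp add: subalg_def)
    then show ?case using a_inv overring_uminus[OF ac] by (simp add: fls_ring_minus(2))
  qed (auto simp: overring_add overring_mult[OF ac])
qed

lemma overring_decomposition:
  assumes ac: "a \<le> c" and f: "f \<in> overring"
  shows "\<exists>r u. r \<in> R \<and> f = r + (\<Sum>b\<in>gaps. fls_const (u b) * fls_X ^ b)"
proof -
  obtain r g where g: "r \<in> R" "ord_ge (int c - int a) g" "f = r + g" using f by (auto simp: overring_def)
  from gap_decomposition[OF ac g(2)] obtain q u where q: "q \<in> R"
    "g = q + (\<Sum>b\<in>gaps. fls_const (u b) * fls_X ^ b)" by blast
  then have "r + q \<in> R" "f = (r + q) + (\<Sum>b\<in>gaps. fls_const (u b) * fls_X ^ b)"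
    using g subalg_add[OF subalg_R] by auto
  then show ?thesis by blast
qed

section \<open>The reduced type as the number of gaps\<close>

lemma Idl_x_0: "Idl\<^bsub>fls_ring R\<^esub> {x 0} = {x 0 * r | r. r \<in> R}"
proof -
  interpret P: cring "fls_ring R" by (rule cring_fls_ring[OF subalg_R])
  have "Idl\<^bsub>fls_ring R\<^esub> {x 0} = PIdl\<^bsub>fls_ring R\<^esub> (x 0)"
    using P.cgenideal_eq_genideal[of "x 0"] x_0_in_R by simp
  then show ?thesis by (auto simp: cgenideal_def mult.commute)
qed

text \<open>The right-hand side is an ideal of R, because multiplying a series of order c - a by x_0
  raises its order to c, which lands in R; and it contains the generators, since each of them
  divided by x_0 lies in \<open>overring\<close>.\<close>

lemma Idl_conductor_subset:
  assumes ac: "a \<le> c"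
  shows "Idl\<^bsub>fls_ring R\<^esub> (conductor R \<union> {x 0}) \<subseteq> {x 0 * g | g. g \<in> overring}"
proof -
  interpret P: cring "fls_ring R" by (rule cring_fls_ring[OF subalg_R])
  let ?D = "{x 0 * g | g. g \<in> overring}"
  have DR: "?D \<subseteq> R"
  proof
    fix f assume "f \<in> ?D"
    then obtain r g where g: "r \<in> R" "ord_ge (int c - int a) g" "f = x 0 * (r + g)"
      by (auto simp: overring_def)
    then have "x 0 * g \<in> R"
      using ord_ge_mult[of "int a" "x 0" "int c - int a" g] x_ord n_pos ord_ge_c_in_R by simp
    with g show "f \<in> R"
      using subalg_R x_0_in_R by (simp add: distrib_left subalg_add subalg_mult)
  qed
  have "ideal ?D (fls_ring R)"
  proof (rule idealI)
    show "subgroup ?D (add_monoid (fls_ring R))"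
    proof (rule P.add.subgroupI)
      show "?D \<subseteq> carrier (fls_ring R)" using DR by simp
      show "?D \<noteq> {}" using R_in_overring[OF x_0_in_R] by blast
    next
      fix f assume f: "f \<in> ?D"
      then obtain g where g: "g \<in> overring" "f = x 0 * g" by blast
      have "\<ominus>\<^bsub>fls_ring R\<^esub> f = - f"
        using f DR by (intro fls_ring_minus(2)[OF subalg_R]) auto
      also have "\<dots> = x 0 * (- g)" by (simp add: g(2))
      also have "\<dots> \<in> ?D" using overring_uminus[OF ac g(1)] by blast
      finally show "\<ominus>\<^bsub>fls_ring R\<^esub> f \<in> ?D" .
    next
      fix f g assume "f \<in> ?D" "g \<in> ?D"
      then obtain f' g' where "f' \<in> overring" "g' \<in> overring" "f = x 0 * f'" "g = x 0 * g'" by blast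
      then have "f + g = x 0 * (f' + g')" "f' + g' \<in> overring" by (auto simp: distrib_left overring_add)
      then show "f \<oplus>\<^bsub>fls_ring R\<^esub> g \<in> ?D" by auto
    qed
  next
    fix f r assume "f \<in> ?D" "r \<in> carrier (fls_ring R)"
    then obtain g where g: "g \<in> overring" "f = x 0 * g" "r \<in> overring" using R_in_overring by auto
    have "r * f = x 0 * (r * g)" by (simp add: g(2))
    with overring_mult[OF ac g(3,1)] show "r \<otimes>\<^bsub>fls_ring R\<^esub> f \<in> ?D" by auto
    then show "f \<otimes>\<^bsub>fls_ring R\<^esub> r \<in> ?D" by (simp add: mult.commute)
  qed (rule P.ring_axioms)
  moreover have "conductor R \<union> {x 0} \<subseteq> ?D"
  proof
    fix f assume "f \<in> conductor R \<union> {x 0}"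
    then have "f / x 0 \<in> overring"
    proof
      assume "f \<in> conductor R"
      then have "ord_ge (int c - int a) (f / x 0)"
        using x_0_nz by (auto simp: conductor_eq subdegree_x_0 intro!: ord_ge_divide)
      then show ?thesis using overringI[of 0 "f / x 0"] subalg_0[OF subalg_R] by simp
    next
      assume "f \<in> {x 0}"
      then show ?thesis using R_in_overring[OF subalg_1[OF subalg_R]] x_0_nz by simp
    qed
    moreover have "f = x 0 * (f / x 0)" using x_0_nz by simp
    ultimately show "f \<in> ?D" by blast
  qed
  ultimately show ?thesis by (rule P.genideal_minimal)
qed

lemma subfield_constants: "subfield (range fls_const) (fls_ring R)"
proof -
  let ?K = "range (fls_const :: 'k \<Rightarrow> 'k fls)"
  interpret P: cring "fls_ring R" by (rule cring_fls_ring[OF subalg_R])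
  have K: "subalg ?K"
    unfolding subalg_def by (auto simp: fls_const_mult_const fls_plus_const)
  interpret K: cring "fls_ring ?K" by (rule cring_fls_ring[OF K])
  have "field (fls_ring ?K)"
  proof (rule K.cring_fieldI)
    show "Units (fls_ring ?K) = carrier (fls_ring ?K) - {\<zero>\<^bsub>fls_ring ?K\<^esub>}"
    proof (intro equalityI subsetI)
      fix f assume "f \<in> carrier (fls_ring ?K) - {\<zero>\<^bsub>fls_ring ?K\<^esub>}"
      then obtain k where k: "f = fls_const k" "k \<noteq> 0" by auto
      then have "fls_const (inverse k) * f = 1" by (simp add: fls_const_mult_const)
      then show "f \<in> Units (fls_ring ?K)"
        using k unfolding Units_def
        by (intro CollectI conjI bexI[of _ "fls_const (inverse k)"]) (auto simp: mult.commute)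
    qed (auto simp: Units_def)
  qed
  moreover have "fls_ring ?K = (fls_ring R)\<lparr>carrier := ?K\<rparr>" by (simp add: fls_ring_def)
  ultimately show ?thesis
    using subalg_const[OF subalg_R] by (intro P.subfield_iff(1)) auto
qed

text \<open>Multiplication by x_0 carries \<open>overring\<close> modulo R to the ideal generated by
  the conductor and x_0, modulo x_0 R. The gap monomials are a basis of the former over k, so their
  products with x_0 give a basis of the latter.\<close>

lemma reduced_type_eq:
  assumes ac: "a \<le> c"
  shows "reduced_type R (x 0) = card gaps"
proof -
  define P where "P = fls_ring R"
  define I where "I = Idl\<^bsub>P\<^esub> {x 0}"
  define h where "h = (\<lambda>f. I +>\<^bsub>P\<^esub> f)"
  have P [simp]: "carrier P = R" "monoid.mult P = (*)" "monoid.one P = 1" "ring.zero P = 0" "ring.add P = (+)"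
    by (simp_all add: P_def)
  interpret P: cring P unfolding P_def by (rule cring_fls_ring[OF subalg_R])
  interpret I: ideal I P unfolding I_def using x_0_in_R by (intro P.genideal_ideal) simp
  interpret Q: ring "P Quot I" by (rule I.quotient_is_ring)
  interpret h: ring_hom_ring P "P Quot I" h unfolding h_def by (rule I.rcos_ring_hom_ring)
  have h_eq: "h f = h g \<longleftrightarrow> (\<exists>r\<in>R. f - g = x 0 * r)" if "f \<in> R" "g \<in> R" for f g
    using P.quotient_eq_iff_same_a_r_cos[OF I.ideal_axioms, of f g] that
      fls_ring_minus(1)[OF subalg_R that]
    by (auto simp: h_def I_def P_def Idl_x_0)
  \<comment> \<open>The image of the field of constants is a field only if the quotient ring is
    nonzero.\<close>
  have one_nz: "\<one>\<^bsub>P Quot I\<^esub> \<noteq> \<zero>\<^bsub>P Quot I\<^esub>"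
  proof
    assume "\<one>\<^bsub>P Quot I\<^esub> = \<zero>\<^bsub>P Quot I\<^esub>"
    then have "h 1 = h 0" using h.hom_one h.hom_zero by simp
    then obtain r where r: "r \<in> R" "1 = x 0 * r"
      using h_eq[of 1 0] subalg_0[OF subalg_R] subalg_1[OF subalg_R] by auto
    have "ord_ge (int a) (x 0 * r)" using x_ord n_pos R_ord[OF r(1)] by (intro ord_ge_mult_right) auto
    then show False using a_pos unfolding r(2)[symmetric] by (simp add: ord_ge_iff)
  qed
  define K where "K = h ` range fls_const"
  have K: "subfield K (P Quot I)"
    unfolding K_def using h.img_is_subfield(2)[OF subfield_constants[folded P_def] one_nz] .
  define gl where "gl = sorted_list_of_set gaps"
  have gl: "distinct gl" "set gl = gaps" "length gl = card gaps"
    using finite_gaps by (simp_all add: gl_def)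
  \<comment> \<open>This is x_0 times the gap monomial t^b; for a gap b its order is at least
    c.\<close>
  define m where "m b = (fls_X ^ (b + a) :: 'k fls)" for b
  have mR: "m b \<in> R" if "b \<in> gaps" for b
    using gaps_ge[OF that] unfolding m_def
    by (intro ord_ge_c_in_R ord_ge_mono[OF ord_ge_X_power]) simp
  define Us where "Us = map (\<lambda>b. h (m b)) gl"
  have Us: "set Us \<subseteq> carrier (P Quot I)" using mR gl by (auto simp: Us_def)
  have comb: "\<exists>u. Ks = map (\<lambda>b. h (fls_const (u b))) gl \<and>
      Q.combine Ks Us = h (x 0 * (\<Sum>b\<in>gaps. fls_const (u b) * fls_X ^ b))"
    if Ks: "set Ks \<subseteq> K" "length Ks = length Us" for Ks
  proof -
    have "Ks \<in> lists (range (\<lambda>k. h (fls_const k)))" using Ks(1) by (auto simp: K_def lists_eq_set)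
    then have "Ks \<in> map (\<lambda>k. h (fls_const k)) ` lists UNIV" by (simp add: lists_image)
    then obtain cs where cs: "Ks = map (\<lambda>k. h (fls_const k)) cs" by blast
    with Ks have "length cs = length gl" by (simp add: Us_def)
    from distinct_map_surj[OF gl(1) this] obtain u where u: "cs = map u gl" by blast
    have Ks': "Ks = map h (map (\<lambda>b. fls_const (u b)) gl)" by (simp add: cs u)
    have Us': "Us = map h (map m gl)" by (simp add: Us_def)
    have PC: "P.combine (map (\<lambda>b. fls_const (u b)) bs) (map m bs) = (\<Sum>b\<in>set bs. fls_const (u b) * m b)"
      if "distinct bs" for bs
      using that by (induction bs) auto
    have "Q.combine Ks Us = h (P.combine (map (\<lambda>b. fls_const (u b)) gl) (map m gl))"
      unfolding Ks' Us' using mR gl subalg_const[OF subalg_R] by (intro h.combine_hom) auto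
    also have "P.combine (map (\<lambda>b. fls_const (u b)) gl) (map m gl) = (\<Sum>b\<in>gaps. fls_const (u b) * m b)"
      using PC[OF gl(1)] gl(2) by simp
    also have "\<dots> = x 0 * (\<Sum>b\<in>gaps. fls_const (u b) * fls_X ^ b)"
      by (simp add: x_0 m_def power_add sum_distrib_left mult_ac)
    finally show ?thesis using Ks' by (intro exI[of _ u]) simp
  qed
  have gR: "x 0 * (\<Sum>b\<in>gaps. fls_const (u b) * fls_X ^ b) \<in> conductor R" for u
  proof -
    have "ord_ge (int a + (int c - int a)) (x 0 * (\<Sum>b\<in>gaps. fls_const (u b) * fls_X ^ b))"
      using x_ord n_pos by (intro ord_ge_mult gap_combination_ord) auto
    then show ?thesis by (simp add: conductor_eq)
  qed
  have CR: "conductor R \<subseteq> R" using conductor_eq ord_ge_c_in_R by blast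
  have "Q.independent K Us"
  proof (rule ccontr)
    assume "\<not> Q.independent K Us"
    from Q.dependent_imp_non_trivial_combine[OF K Us this]
    obtain Ks where Ks: "length Ks = length Us" "Q.combine Ks Us = \<zero>\<^bsub>P Quot I\<^esub>" "set Ks \<subseteq> K"
      "set Ks \<noteq> {\<zero>\<^bsub>P Quot I\<^esub>}" by blast
    from comb[OF Ks(3,1)] obtain u where u: "Ks = map (\<lambda>b. h (fls_const (u b))) gl"
      "Q.combine Ks Us = h (x 0 * (\<Sum>b\<in>gaps. fls_const (u b) * fls_X ^ b))" by blast
    have "h (x 0 * (\<Sum>b\<in>gaps. fls_const (u b) * fls_X ^ b)) = h 0"
      using u(2) Ks(2) h.hom_zero by simp
    moreover have "x 0 * (\<Sum>b\<in>gaps. fls_const (u b) * fls_X ^ b) \<in> R" using gR CR by blast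
    ultimately obtain r where r: "r \<in> R"
      "x 0 * (\<Sum>b\<in>gaps. fls_const (u b) * fls_X ^ b) - 0 = x 0 * r"
      using h_eq[OF _ subalg_0[OF subalg_R]] by blast
    then have "(\<Sum>b\<in>gaps. fls_const (u b) * fls_X ^ b) = r" using x_0_nz by simp
    with r(1) have "(\<Sum>b\<in>gaps. fls_const (u b) * fls_X ^ b) \<in> R" by simp
    then have "\<forall>b\<in>gaps. u b = 0" using gap_combination_in_R by blast
    then have "set Ks \<subseteq> {\<zero>\<^bsub>P Quot I\<^esub>}" using u(1) gl(2) h.hom_zero by auto
    \<comment> \<open>Nontriviality is stated as \<open>set Ks\<close> being different from the
      singleton of zero, which the empty list also satisfies; that case is closed
      separately.\<close>
    then have "Ks = []" using Ks(4) by (metis set_empty subset_singletonD)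
    then have "Us = []" using Ks(1) by simp
    then show False using \<open>\<not> Q.independent K Us\<close> by simp
  qed
  moreover have "Q.Span K Us = h ` (Idl\<^bsub>P\<^esub> (conductor R \<union> {x 0}))"
  proof (intro equalityI subsetI)
    fix v assume "v \<in> Q.Span K Us"
    then obtain Ks where "v = Q.combine Ks Us" "length Ks = length Us" "set Ks \<subseteq> K"
      unfolding Q.Span_eq_combine_set_length_version[OF K Us] by blast
    with comb[of Ks] obtain u where v: "v = h (x 0 * (\<Sum>b\<in>gaps. fls_const (u b) * fls_X ^ b))" by blast
    have "conductor R \<union> {x 0} \<subseteq> Idl\<^bsub>P\<^esub> (conductor R \<union> {x 0})"
      using CR x_0_in_R by (intro P.genideal_self) auto
    with gR[of u] v show "v \<in> h ` (Idl\<^bsub>P\<^esub> (conductor R \<union> {x 0}))" by blast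
  next
    fix v assume "v \<in> h ` (Idl\<^bsub>P\<^esub> (conductor R \<union> {x 0}))"
    then obtain g where g: "g \<in> overring" "v = h (x 0 * g)"
      using Idl_conductor_subset[OF ac] by (auto simp: P_def)
    from overring_decomposition[OF ac g(1)] obtain r u where r: "r \<in> R"
      "g = r + (\<Sum>b\<in>gaps. fls_const (u b) * fls_X ^ b)" by blast
    let ?Ks = "map (\<lambda>b. h (fls_const (u b))) gl"
    have sum_R: "x 0 * (\<Sum>b\<in>gaps. fls_const (u b) * fls_X ^ b) \<in> R" using gR CR by blast
    have "x 0 * g \<in> R"
      using r sum_R subalg_R x_0_in_R by (simp add: distrib_left subalg_add subalg_mult)
    then have v: "v = h (x 0 * (\<Sum>b\<in>gaps. fls_const (u b) * fls_X ^ b))"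
      using h_eq[OF _ sum_R, of "x 0 * g"] r g(2) by (auto simp: distrib_left)
    have Ks: "set ?Ks \<subseteq> K" "length ?Ks = length Us" by (auto simp: K_def Us_def)
    from comb[OF this] obtain u' where u': "?Ks = map (\<lambda>b. h (fls_const (u' b))) gl"
      "Q.combine ?Ks Us = h (x 0 * (\<Sum>b\<in>gaps. fls_const (u' b) * fls_X ^ b))" by blast
    \<comment> \<open>The classes determine the coefficients: two constants congruent modulo x_0
      agree, because multiples of x_0 in R have no constant term.\<close>
    have "u' b = u b" if "b \<in> gaps" for b
    proof -
      have "h (fls_const (u b)) = h (fls_const (u' b))" using u'(1) that gl(2) by auto
      then obtain q where q: "q \<in> R" "fls_const (u b) - fls_const (u' b) = x 0 * q"
        using h_eq subalg_const[OF subalg_R] by blast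
      have "ord_ge (int a) (x 0 * q)" using x_ord n_pos R_ord[OF q(1)] by (intro ord_ge_mult_right) auto
      then have "(x 0 * q) $$ 0 = 0" using a_pos by (simp add: ord_ge_def)
      then show ?thesis unfolding q(2)[symmetric] by simp
    qed
    then have "Q.combine ?Ks Us = v" unfolding u'(2) v by (intro arg_cong[of _ _ h]) simp
    with Ks show "v \<in> Q.Span K Us"
      unfolding Q.Span_eq_combine_set_length_version[OF K Us] by blast
  qed
  ultimately have "Q.dimension (length Us) K (h ` (Idl\<^bsub>P\<^esub> (conductor R \<union> {x 0})))"
    by (rule Q.dimensionI[OF K])
  then have "Q.dim K (h ` (Idl\<^bsub>P\<^esub> (conductor R \<union> {x 0}))) = length Us"
    using Q.dimI[OF K] by (simp add: over_def)
  then show ?thesis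
    unfolding reduced_type_def Let_def P_def[symmetric] I_def[symmetric] h_def[symmetric]
    by (simp add: K_def image_image Us_def gl(3))
qed

lemma gap_monomial_ord: "j < card gaps \<Longrightarrow> ord_ge (int c - int a) (gap_monomial R a j)"
proof -
  assume "j < card gaps"
  then have "sorted_list_of_set gaps ! j \<in> gaps"
    using finite_gaps by (metis nth_mem set_sorted_list_of_set length_sorted_list_of_set)
  then show ?thesis
    unfolding gap_monomial_def using gaps_ge by (intro ord_ge_mono[OF ord_ge_X_power]) fastforce
qed

lemma overring_gap_monomials:
  assumes ac: "a \<le> c" and f: "f \<in> overring"
  shows "\<exists>r u. r \<in> R \<and> f = r + (\<Sum>j<card gaps. fls_const (u j) * gap_monomial R a j)"
proof -
  let ?b = "\<lambda>j. sorted_list_of_set gaps ! j"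
  obtain r u where r: "r \<in> R" "f = r + (\<Sum>b\<in>gaps. fls_const (u b) * fls_X ^ b)"
    using overring_decomposition[OF ac f] by blast
  have "bij_betw ?b {..<card gaps} gaps"
    using finite_gaps by (intro bij_betw_nth) auto
  then have "(\<Sum>b\<in>gaps. fls_const (u b) * fls_X ^ b) = (\<Sum>j<card gaps. fls_const (u (?b j)) * fls_X ^ ?b j)"
    by (rule sum.reindex_bij_betw[symmetric])
  with r show ?thesis
    by (intro exI[of _ r] exI[of _ "\<lambda>j. u (?b j)"]) (simp add: gap_monomial_def)
qed

end


section \<open>Modules of differentials\<close>

lemma free_module_simps [simp]:
  "carrier (free_module A m) = {v. (\<forall>i<m. v i \<in> A) \<and> (\<forall>i\<ge>m. v i = 0)}"
  "ring.zero (free_module A m) = (\<lambda>i. 0)"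
  "ring.add (free_module A m) = (\<lambda>u v i. u i + v i)"
  "module.smult (free_module A m) = (\<lambda>a v i. a * v i)"
  by (simp_all add: free_module_def)

lemma Omega_simps:
  "carrier (Omega A m y Fs) = Omega_class A m y Fs ` {v. (\<forall>i<m. v i \<in> A) \<and> (\<forall>i\<ge>m. v i = 0)}"
  "ring.zero (Omega A m y Fs) = jacobian_image A m y Fs"
  "ring.add (Omega A m y Fs) = set_add (free_module A m)"
  "a \<odot>\<^bsub>Omega A m y Fs\<^esub> X = (\<Union>v\<in>X. Omega_class A m y Fs (\<lambda>i. a * v i))"
  by (auto simp: Omega_def quot_module_def Omega_class_def A_RCOSETS_def')

lemma Omega_class_iff:
  "w \<in> Omega_class A m y Fs v \<longleftrightarrow> (\<lambda>i. w i - v i) \<in> jacobian_image A m y Fs"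
proof
  assume "w \<in> Omega_class A m y Fs v"
  then obtain h where "h \<in> jacobian_image A m y Fs" "w = (\<lambda>i. h i + v i)"
    by (auto simp: Omega_class_def a_r_coset_def')
  then show "(\<lambda>i. w i - v i) \<in> jacobian_image A m y Fs" by simp
next
  assume h: "(\<lambda>i. w i - v i) \<in> jacobian_image A m y Fs"
  have "w = (\<lambda>i. (w i - v i) + v i)" by simp
  with h show "w \<in> Omega_class A m y Fs v"
    unfolding Omega_class_def a_r_coset_def' by (simp only: free_module_simps) blast
qed

context
  fixes A :: "('k::field) fls set" and m :: nat and y :: "nat \<Rightarrow> 'k fls" and Fs :: "'k mps list"
  assumes A: "subalg A"
begin

lemma Omega_class_eq_iff:
  "Omega_class A m y Fs u = Omega_class A m y Fs v \<longleftrightarrow> (\<lambda>i. u i - v i) \<in> jacobian_image A m y Fs"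
proof
  assume "Omega_class A m y Fs u = Omega_class A m y Fs v"
  moreover have "u \<in> Omega_class A m y Fs u" by (simp add: Omega_class_iff jacobian_image_zero[OF A])
  ultimately show "(\<lambda>i. u i - v i) \<in> jacobian_image A m y Fs" by (simp add: Omega_class_iff)
next
  assume uv: "(\<lambda>i. u i - v i) \<in> jacobian_image A m y Fs"
  show "Omega_class A m y Fs u = Omega_class A m y Fs v"
  proof (intro equalityI subsetI)
    fix w assume "w \<in> Omega_class A m y Fs u"
    then show "w \<in> Omega_class A m y Fs v"
      using jacobian_image_add[OF A _ uv, of "\<lambda>i. w i - u i"] by (simp add: Omega_class_iff)
  next
    fix w assume "w \<in> Omega_class A m y Fs v"
    then show "w \<in> Omega_class A m y Fs u"
      using jacobian_image_diff[OF A _ uv, of "\<lambda>i. w i - v i"] by (simp add: Omega_class_iff)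
  qed
qed

lemma Omega_zero: "\<zero>\<^bsub>Omega A m y Fs\<^esub> = Omega_class A m y Fs (\<lambda>i. 0)"
  by (auto simp: Omega_simps(2) Omega_class_iff)

lemma Omega_class_eq_zero_iff:
  "Omega_class A m y Fs v = \<zero>\<^bsub>Omega A m y Fs\<^esub> \<longleftrightarrow> v \<in> jacobian_image A m y Fs"
  by (simp add: Omega_zero Omega_class_eq_iff)

lemma Omega_class_add:
  "Omega_class A m y Fs u \<oplus>\<^bsub>Omega A m y Fs\<^esub> Omega_class A m y Fs v = Omega_class A m y Fs (\<lambda>i. u i + v i)"
proof (intro equalityI subsetI)
  fix w assume "w \<in> Omega_class A m y Fs u \<oplus>\<^bsub>Omega A m y Fs\<^esub> Omega_class A m y Fs v"
  then obtain p q where "p \<in> Omega_class A m y Fs u" "q \<in> Omega_class A m y Fs v" "w = (\<lambda>i. p i + q i)"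
    by (auto simp: Omega_simps set_add_def')
  then show "w \<in> Omega_class A m y Fs (\<lambda>i. u i + v i)"
    using jacobian_image_add[OF A, of "\<lambda>i. p i - u i" m y Fs "\<lambda>i. q i - v i"]
    by (simp add: Omega_class_iff algebra_simps)
next
  fix w assume w: "w \<in> Omega_class A m y Fs (\<lambda>i. u i + v i)"
  then have "(\<lambda>i. w i - v i) \<in> Omega_class A m y Fs u" by (simp add: Omega_class_iff algebra_simps)
  moreover have "v \<in> Omega_class A m y Fs v" by (simp add: Omega_class_iff jacobian_image_zero[OF A])
  ultimately have "(\<lambda>i. (w i - v i) + v i) \<in> Omega_class A m y Fs u \<oplus>\<^bsub>Omega A m y Fs\<^esub> Omega_class A m y Fs v"
    unfolding Omega_simps(3) set_add_def' by (simp only: free_module_simps) blast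
  then show "w \<in> Omega_class A m y Fs u \<oplus>\<^bsub>Omega A m y Fs\<^esub> Omega_class A m y Fs v" by simp
qed

lemma Omega_class_smult:
  assumes "b \<in> A"
  shows "b \<odot>\<^bsub>Omega A m y Fs\<^esub> Omega_class A m y Fs v = Omega_class A m y Fs (\<lambda>i. b * v i)"
proof -
  have "Omega_class A m y Fs (\<lambda>i. b * w i) = Omega_class A m y Fs (\<lambda>i. b * v i)"
    if "w \<in> Omega_class A m y Fs v" for w
    using jacobian_image_smult[OF A assms, of "\<lambda>i. w i - v i" m y Fs] that
    by (simp add: Omega_class_iff Omega_class_eq_iff right_diff_distrib)
  moreover have "v \<in> Omega_class A m y Fs v" by (simp add: Omega_class_iff jacobian_image_zero[OF A])
  ultimately show ?thesis unfolding Omega_simps(4) by blast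
qed

lemma abelian_monoid_Omega: "abelian_monoid (Omega A m y Fs)"
proof (rule abelian_monoidI)
  fix X Y assume "X \<in> carrier (Omega A m y Fs)" "Y \<in> carrier (Omega A m y Fs)"
  then show "X \<oplus>\<^bsub>Omega A m y Fs\<^esub> Y \<in> carrier (Omega A m y Fs)"
    unfolding Omega_simps(1)
    by (auto simp: Omega_class_add subalg_add[OF A] intro!: imageI)
next
  show "\<zero>\<^bsub>Omega A m y Fs\<^esub> \<in> carrier (Omega A m y Fs)"
    unfolding Omega_simps(1) Omega_zero by (auto simp: subalg_0[OF A] intro!: imageI)
qed (auto simp: Omega_simps(1) Omega_zero Omega_class_add add_ac)

lemma Omega_class_carrier:
  "\<forall>i<m. v i \<in> A \<Longrightarrow> \<forall>i\<ge>m. v i = 0 \<Longrightarrow> Omega_class A m y Fs v \<in> carrier (Omega A m y Fs)"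
  unfolding Omega_simps(1) by blast

lemma Omega_finsum_class:
  assumes "finite I" "\<forall>l\<in>I. (\<forall>i<m. v l i \<in> A) \<and> (\<forall>i\<ge>m. v l i = 0)"
  shows "(\<Oplus>\<^bsub>Omega A m y Fs\<^esub>l\<in>I. Omega_class A m y Fs (v l)) = Omega_class A m y Fs (\<lambda>i. \<Sum>l\<in>I. v l i)"
proof -
  interpret abelian_monoid "Omega A m y Fs" by (rule abelian_monoid_Omega)
  show ?thesis using assms
  proof (induction I rule: finite_induct)
    case empty
    then show ?case by (simp add: Omega_zero)
  next
    case (insert l I)
    then have "(\<lambda>l. Omega_class A m y Fs (v l)) \<in> I \<rightarrow> carrier (Omega A m y Fs)"
      "Omega_class A m y Fs (v l) \<in> carrier (Omega A m y Fs)"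
      by (auto intro!: Omega_class_carrier)
    with insert show ?case by (simp add: Omega_class_add)
  qed
qed

end


section \<open>The blowup by the conductor\<close>

text \<open>The ring S enters through its presentation by the x_i and T_j and through the upper
  bound \<open>overring\<close>; together these give S = R + sum of the k T_j.\<close>

locale blowup = branch n x R a for n and x :: "nat \<Rightarrow> ('k::field_char_0) fls" and R a +
  fixes S :: "'k fls set" and y :: "nat \<Rightarrow> 'k fls" and Fs Gs :: "'k mps list" and s :: nat
  assumes ac2: "2 * a \<le> conductor_val R"
    and s_eq: "s = card (late_gaps R a)"
    and y_eq: "y = append_tuple n x (gap_monomial R a)"
    and R_presents: "presents n x Fs R"
    and S_presents: "presents (n + s) y Gs S"
    and S_subset: "S \<subseteq> overring"
begin

abbreviation "T \<equiv> gap_monomial R a"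
abbreviation "J \<equiv> jacobian_image S (n + s) y Gs"

lemma ac: "a \<le> c"
  using ac2 by simp

lemma y_x: "i < n \<Longrightarrow> y i = x i"
  by (simp add: y_eq append_tuple_def)

lemma y_T: "y (n + j) = T j"
  by (simp add: y_eq append_tuple_def)

lemma T_ord: "j < s \<Longrightarrow> ord_ge (int c - int a) (T j)"
  using gap_monomial_ord by (simp add: s_eq)

lemma T_ord_a: "j < s \<Longrightarrow> ord_ge (int a) (T j)"
  using ord_ge_mono[OF T_ord, of j "int a"] ac2 by simp

lemma y_ord: "\<forall>i<n + s. ord_ge 1 (y i)"
proof (intro allI impI)
  fix i assume i: "i < n + s"
  show "ord_ge 1 (y i)"
  proof (cases "i < n")
    case True
    then show ?thesis using x_ord_1 y_x by simp
  next
    case False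
    with i have "y i = T (i - n)" "i - n < s" using y_T[of "i - n"] by auto
    then show ?thesis using ord_ge_mono[OF T_ord_a, of "i - n" 1] a_pos by simp
  qed
qed

lemma S_eq: "S = power_series_alg (n + s) y"
  by (rule presentsD(1)[OF S_presents])

lemma subalg_S: "subalg S"
  unfolding S_eq by (rule subalg_power_series_alg[OF y_ord])

lemma S_ord: "f \<in> S \<Longrightarrow> ord_ge 0 f"
  by (auto simp: S_eq power_series_alg_def mps_eval_ord)

lemma eval_y_eq_eval_x: "F \<in> mps_carrier n \<Longrightarrow> mps_eval (n + s) y F = mps_eval n x F"
  by (rule mps_eval_restrict) (auto simp: y_x)

lemma grad_y_eq_grad_x: "F \<in> mps_carrier n \<Longrightarrow> grad (n + s) y F = grad n x F"
  by (simp add: grad_def eval_y_eq_eval_x mps_deriv_carrier)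

lemma R_subset_S: "R \<subseteq> S"
proof
  fix f assume "f \<in> R"
  then obtain F where F: "F \<in> mps_carrier n" "f = mps_eval n x F"
    by (auto simp: R_eq power_series_alg_def)
  then have "F \<in> mps_carrier (n + s)" by (auto intro: mps_carrier_mono)
  then show "f \<in> S"
    unfolding S_eq F(2) eval_y_eq_eval_x[OF F(1), symmetric] by (rule power_series_algI)
qed

lemma T_in_S: "j < s \<Longrightarrow> T j \<in> S"
  using mps_eval_var[OF y_ord, of "n + j"] power_series_algI[OF mps_var_carrier[of "n + j" "n + s"], of y]
  by (simp add: S_eq y_T)

text \<open>A lift that involves only the variables of R, so that df is an R-combination of the dx_i
  alone.\<close>

lemma obtain_R_series:
  assumes "f \<in> R"
  obtains F where "F \<in> mps_carrier n" "mps_eval (n + s) y F = f" "\<forall>i. grad (n + s) y F i \<in> R"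
    "\<forall>i\<ge>n. grad (n + s) y F i = 0"
proof -
  obtain F where F: "F \<in> mps_carrier n" "f = mps_eval n x F"
    using assms by (auto simp: R_eq power_series_alg_def)
  show ?thesis
  proof (rule that[OF F(1)])
    show "mps_eval (n + s) y F = f" using F by (simp add: eval_y_eq_eval_x)
    show "\<forall>i. grad (n + s) y F i \<in> R"
      using grad_mem_power_series_alg[OF F(1), of x] by (simp add: grad_y_eq_grad_x[OF F(1)] R_eq)
    show "\<forall>i\<ge>n. grad (n + s) y F i = 0"
      using grad_vanishes[OF F(1), of _ x] by (simp add: grad_y_eq_grad_x[OF F(1)])
  qed
qed

text \<open>Relations among the x_i remain relations among the generators of S; hence the natural
  map between the modules of differentials is well defined.\<close>

lemma jacobian_image_R_subset: "jacobian_image R n x Fs \<subseteq> J"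
proof
  fix v assume "v \<in> jacobian_image R n x Fs"
  then obtain b where b: "\<forall>j<length Fs. b j \<in> R"
    "v = (\<lambda>i. if i < n then \<Sum>j<length Fs. b j * mps_eval n x (mps_deriv i (Fs ! j)) else 0)"
    by (rule jacobian_imageE)
  interpret P: cring "mps_ring n :: 'k mps ring" by (rule cring_mps_ring)
  note prD = presentsD[OF R_presents]
  have Fj: "Fs ! j \<in> mps_carrier n" "mps_eval n x (Fs ! j) = 0" if "j < length Fs" for j
  proof -
    have "Fs ! j \<in> Idl\<^bsub>mps_ring n\<^esub> (set Fs)"
      using P.genideal_self[of "set Fs"] prD(2) that by auto
    then show "Fs ! j \<in> mps_carrier n" "mps_eval n x (Fs ! j) = 0" using prD(3) by blast+
  qed
  have "(\<lambda>i. \<Sum>j<length Fs. b j * grad (n + s) y (Fs ! j) i) \<in> J"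
  proof (intro jacobian_image_sum[OF subalg_S] jacobian_image_smult[OF subalg_S]
      grad_mem_jacobian_image[OF S_presents y_ord])
    fix j assume "j \<in> {..<length Fs}"
    then show "b j \<in> S" "Fs ! j \<in> mps_carrier (n + s)" "mps_eval (n + s) y (Fs ! j) = 0"
      using b(1) R_subset_S Fj[of j] by (auto simp: eval_y_eq_eval_x intro: mps_carrier_mono)
  qed
  moreover have "(\<lambda>i. \<Sum>j<length Fs. b j * grad (n + s) y (Fs ! j) i) = v"
  proof
    fix i
    have "(\<Sum>j<length Fs. b j * grad (n + s) y (Fs ! j) i) = (\<Sum>j<length Fs. b j * grad n x (Fs ! j) i)"
      using Fj by (intro sum.cong) (auto simp: grad_y_eq_grad_x)
    also have "\<dots> = v i"
      unfolding b(2) using Fj by (auto simp: grad_vanishes, simp add: grad_def)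
    finally show "(\<Sum>j<length Fs. b j * grad (n + s) y (Fs ! j) i) = v i" .
  qed
  ultimately show "v \<in> J" by simp
qed

text \<open>The pairs \<open>(i, j)\<close> and \<open>(n + k, j)\<close> below index the vectors \<open>T\<^sub>j dx\<^sub>i\<close> and, for \<open>j < k\<close>,
  \<open>T\<^sub>j dT\<^sub>k\<close>; their number is the source of the bound on \<open>N\<close>.\<close>

definition exceptional :: "(nat \<times> nat) set" where
  "exceptional = {..<n} \<times> {..<s} \<union> {(i, j). n \<le> i \<and> i < n + s \<and> j < i - n}"

definition exceptional_vector :: "(nat \<Rightarrow> nat \<Rightarrow> 'k) \<Rightarrow> nat \<Rightarrow> 'k fls" where
  "exceptional_vector \<gamma> i = (\<Sum>j<s. if (i, j) \<in> exceptional then fls_const (\<gamma> i j) * T j else 0)"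

text \<open>Here \<open>\<rho>\<close> represents an element of Omega_R and \<open>\<gamma>\<close>
  the exceptional part. Both are kept as arguments because the final elimination takes linear
  combinations of them.\<close>

definition reduces_to :: "(nat \<Rightarrow> 'k fls) \<Rightarrow> (nat \<Rightarrow> 'k fls) \<Rightarrow> (nat \<Rightarrow> nat \<Rightarrow> 'k) \<Rightarrow> bool" where
  "reduces_to v \<rho> \<gamma> \<longleftrightarrow> (\<forall>i<n. \<rho> i \<in> R) \<and> (\<forall>i\<ge>n. \<rho> i = 0) \<and>
     (\<lambda>i. v i - \<rho> i - exceptional_vector \<gamma> i) \<in> J"

definition reducible :: "(nat \<Rightarrow> 'k fls) \<Rightarrow> bool" where
  "reducible v \<longleftrightarrow> (\<exists>\<rho> \<gamma>. reduces_to v \<rho> \<gamma>)"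

lemma card_exceptional: "card exceptional \<le> n * s + (s choose 2)"
proof -
  have "{(i, j). n \<le> i \<and> i < n + s \<and> j < i - n} = (\<lambda>(k, j). (n + k, j)) ` Sigma {..<s} (\<lambda>k. {..<k})"
  proof (intro equalityI subsetI)
    fix p assume "p \<in> {(i, j). n \<le> i \<and> i < n + s \<and> j < i - n}"
    then obtain i j where "p = (i, j)" "n \<le> i" "i < n + s" "j < i - n" by auto
    then show "p \<in> (\<lambda>(k, j). (n + k, j)) ` Sigma {..<s} (\<lambda>k. {..<k})"
      by (intro image_eqI[of _ _ "(i - n, j)"]) auto
  qed auto
  then have "card {(i, j). n \<le> i \<and> i < n + s \<and> j < i - n} \<le> card (Sigma {..<s} (\<lambda>k. {..<k}))"
    by (simp only:) (rule card_image_le, simp)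
  also have "\<dots> = (\<Sum>k<s. k)" by simp
  also have "\<dots> = s choose 2" by (induction s) (auto simp: numeral_2_eq_2)
  finally have "card {(i, j). n \<le> i \<and> i < n + s \<and> j < i - n} \<le> s choose 2" .
  then show ?thesis
    unfolding exceptional_def
    by (intro order_trans[OF card_Un_le]) (simp add: card_cartesian_product)
qed

lemma finite_exceptional: "finite exceptional"
proof -
  have "exceptional \<subseteq> {..<n + s} \<times> {..<s}" by (auto simp: exceptional_def)
  then show ?thesis by (rule finite_subset) simp
qed

section \<open>Linearity of the reduction modulo the image of Omega_R\<close>

lemma exceptional_vector_add:
  "exceptional_vector (\<lambda>i j. \<gamma> i j + \<gamma>' i j) i = exceptional_vector \<gamma> i + exceptional_vector \<gamma>' i"
  unfolding exceptional_vector_def sum.distrib[symmetric]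
  by (rule sum.cong) (auto simp: distrib_right simp flip: fls_plus_const)

lemma exceptional_vector_smult:
  "exceptional_vector (\<lambda>i j. \<kappa> * \<gamma> i j) i = fls_const \<kappa> * exceptional_vector \<gamma> i"
  unfolding exceptional_vector_def sum_distrib_left
  by (rule sum.cong) (auto simp: mult.assoc simp flip: fls_const_mult_const)

lemma reduces_to_add:
  assumes "reduces_to u \<rho> \<gamma>" "reduces_to v \<rho>' \<gamma>'"
  shows "reduces_to (\<lambda>i. u i + v i) (\<lambda>i. \<rho> i + \<rho>' i) (\<lambda>i j. \<gamma> i j + \<gamma>' i j)"
  using assms jacobian_image_add[OF subalg_S, of "\<lambda>i. u i - \<rho> i - exceptional_vector \<gamma> i" "n + s" y Gs
      "\<lambda>i. v i - \<rho>' i - exceptional_vector \<gamma>' i"]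
  by (simp add: reduces_to_def subalg_add[OF subalg_R] exceptional_vector_add algebra_simps)

lemma reduces_to_smult:
  assumes "reduces_to v \<rho> \<gamma>"
  shows "reduces_to (\<lambda>i. fls_const \<kappa> * v i) (\<lambda>i. fls_const \<kappa> * \<rho> i) (\<lambda>i j. \<kappa> * \<gamma> i j)"
  using assms jacobian_image_smult[OF subalg_S subalg_const[OF subalg_S],
      of "\<lambda>i. v i - \<rho> i - exceptional_vector \<gamma> i" "n + s" y Gs \<kappa>]
  by (simp add: reduces_to_def subalg_mult[OF subalg_R] subalg_const[OF subalg_R]
      exceptional_vector_smult algebra_simps)

lemma reduces_to_zero: "reduces_to (\<lambda>i. 0) (\<lambda>i. 0) (\<lambda>i j. 0)"
proof -
  have "exceptional_vector (\<lambda>i j. 0) i = 0" for i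
    unfolding exceptional_vector_def by (rule sum.neutral) auto
  then show ?thesis by (simp add: reduces_to_def subalg_0[OF subalg_R] jacobian_image_zero[OF subalg_S])
qed

lemma reduces_to_sum:
  assumes "finite L" "\<forall>l\<in>L. reduces_to (v l) (\<rho> l) (\<gamma> l)"
  shows "reduces_to (\<lambda>i. \<Sum>l\<in>L. v l i) (\<lambda>i. \<Sum>l\<in>L. \<rho> l i) (\<lambda>i j. \<Sum>l\<in>L. \<gamma> l i j)"
  using assms
proof (induction L rule: finite_induct)
  case empty
  then show ?case using reduces_to_zero by simp
next
  case (insert l L)
  then have "reduces_to (\<lambda>i. v l i + (\<Sum>l\<in>L. v l i)) (\<lambda>i. \<rho> l i + (\<Sum>l\<in>L. \<rho> l i))
      (\<lambda>i j. \<gamma> l i j + (\<Sum>l\<in>L. \<gamma> l i j))"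
    by (intro reduces_to_add) auto
  with insert show ?case by simp
qed

lemma reducible_add: "reducible u \<Longrightarrow> reducible v \<Longrightarrow> reducible (\<lambda>i. u i + v i)"
  unfolding reducible_def using reduces_to_add by blast

lemma reducible_smult: "reducible v \<Longrightarrow> reducible (\<lambda>i. fls_const \<kappa> * v i)"
  unfolding reducible_def using reduces_to_smult by blast

lemma reducible_uminus: "reducible v \<Longrightarrow> reducible (\<lambda>i. - v i)"
proof -
  have "fls_const (- 1) * f = - f" for f :: "'k fls"
    by (rule fls_eqI) (simp add: fls_mult_const_nth)
  then show "reducible v \<Longrightarrow> reducible (\<lambda>i. - v i)" using reducible_smult[of v "- 1"] by simp
qed

lemma reducible_sum:
  assumes "finite L" "\<forall>l\<in>L. reducible (v l)"
  shows "reducible (\<lambda>i. \<Sum>l\<in>L. v l i)"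
proof -
  from assms(2) obtain \<rho> \<gamma> where "\<forall>l\<in>L. reduces_to (v l) (\<rho> l) (\<gamma> l)"
    unfolding reducible_def by metis
  then show ?thesis unfolding reducible_def using reduces_to_sum[OF assms(1)] by blast
qed

lemma reducible_cong_J:
  assumes "(\<lambda>i. u i - v i) \<in> J" "reducible v"
  shows "reducible u"
proof -
  obtain \<rho> \<gamma> where "reduces_to v \<rho> \<gamma>" using assms(2) unfolding reducible_def by blast
  then have "reduces_to u \<rho> \<gamma>"
    using jacobian_image_add[OF subalg_S assms(1), of "\<lambda>i. v i - \<rho> i - exceptional_vector \<gamma> i"]
    by (simp add: reduces_to_def algebra_simps)
  then show ?thesis unfolding reducible_def by blast
qed

text \<open>Each coefficient splits as an element of R plus a k-combination of the T_j, and every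
  T_j dx_i is exceptional; so the reduction is an identity of vectors.\<close>

lemma reducible_dx:
  assumes v: "\<forall>i<n. v i \<in> S" "\<forall>i\<ge>n. v i = 0"
  shows "reducible v"
proof -
  have "\<forall>i\<in>{..<n}. \<exists>r u. r \<in> R \<and> v i = r + (\<Sum>j<s. fls_const (u j) * T j)"
    using v(1) S_subset overring_gap_monomials[OF ac] unfolding s_eq by blast
  then obtain r u where r: "\<forall>i\<in>{..<n}. r i \<in> R \<and> v i = r i + (\<Sum>j<s. fls_const (u i j) * T j)"
    by metis
  define \<rho> where "\<rho> i = (if i < n then r i else 0)" for i
  define \<gamma> where "\<gamma> i j = (if i < n then u i j else 0)" for i j
  have "v i - \<rho> i - exceptional_vector \<gamma> i = 0" for i
  proof (cases "i < n")
    case True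
    then have "exceptional_vector \<gamma> i = (\<Sum>j<s. fls_const (u i j) * T j)"
      unfolding exceptional_vector_def by (intro sum.cong) (auto simp: exceptional_def \<gamma>_def)
    with True r show ?thesis by (simp add: \<rho>_def)
  next
    case False
    then have "exceptional_vector \<gamma> i = 0"
      unfolding exceptional_vector_def by (intro sum.neutral) (auto simp: \<gamma>_def)
    with False show ?thesis using v(2) by (simp add: \<rho>_def)
  qed
  then have "reduces_to v \<rho> \<gamma>"
    using r by (simp add: reduces_to_def jacobian_image_zero[OF subalg_S] \<rho>_def)
  then show ?thesis unfolding reducible_def by blast
qed

text \<open>The relation \<open>d(\<rho> T\<^sub>j) = \<rho> dT\<^sub>j + T\<^sub>j d\<rho>\<close> with \<open>\<rho> T\<^sub>j \<in> R\<close>.\<close>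

lemma reducible_nonunit_dT:
  assumes j: "j < s" and \<rho>: "\<rho> \<in> R" "\<rho> $$ 0 = 0"
  shows "reducible (\<lambda>i. if i = n + j then \<rho> else 0)"
proof -
  \<comment> \<open>A non-unit of R contributes order a and T_j contributes c - a, which together
    reach the conductor.\<close>
  have "ord_ge (int a + (int c - int a)) (\<rho> * T j)"
    using R_ord_of_zero_const[OF \<rho>] T_ord[OF j] by (rule ord_ge_mult)
  then have "\<rho> * T j \<in> R" by (simp add: ord_ge_c_in_R)
  then obtain P where P: "P \<in> mps_carrier n" "mps_eval (n + s) y P = \<rho> * T j"
    "\<forall>i. grad (n + s) y P i \<in> R" "\<forall>i\<ge>n. grad (n + s) y P i = 0" by (rule obtain_R_series)
  obtain H where H: "H \<in> mps_carrier n" "mps_eval (n + s) y H = \<rho>"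
    "\<forall>i. grad (n + s) y H i \<in> R" "\<forall>i\<ge>n. grad (n + s) y H i = 0" using \<rho>(1) by (rule obtain_R_series)
  \<comment> \<open>H lifts \<rho> and P lifts \<rho> T_j. The gradient of this series gives \<rho>
    dT_j = dP - T_j dH, whose right side has only dx-components.\<close>
  let ?F = "\<lambda>\<alpha>. mps_times H (mps_var (n + j)) \<alpha> - P \<alpha>"
  have Tj: "mps_eval (n + s) y (mps_var (n + j)) = T j"
    using mps_eval_var[OF y_ord, of "n + j"] j by (simp add: y_T)
  have "?F \<in> mps_carrier (n + s)"
    using P(1) H(1) j by (intro mps_diff_carrier mps_times_carrier mps_var_carrier) (auto intro: mps_carrier_mono)
  moreover have "mps_eval (n + s) y ?F = 0"
    by (simp add: mps_eval_diff mps_eval_times[OF y_ord] H(2) P(2) Tj)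
  ultimately have "grad (n + s) y ?F \<in> J" by (rule grad_mem_jacobian_image[OF S_presents y_ord])
  then have "(\<lambda>i. (if i = n + j then \<rho> else 0) - (grad (n + s) y P i - T j * grad (n + s) y H i)) \<in> J"
    unfolding grad_diff grad_times[OF y_ord] grad_var[OF y_ord] H(2) Tj
    by (rule back_subst[of "\<lambda>v. v \<in> J"]) (auto simp: fun_eq_iff)
  moreover have "reducible (\<lambda>i. grad (n + s) y P i - T j * grad (n + s) y H i)"
    using P(3,4) H(3,4) R_subset_S T_in_S[OF j]
    by (intro reducible_dx) (auto intro!: subalg_diff subalg_mult subalg_S)
  ultimately show ?thesis by (rule reducible_cong_J)
qed

text \<open>T_j T_k has order at least a + (c - a), so it lies in R; differentiating it expresses
  T_k dT_j + T_j dT_k through the dx_i with coefficients in R.\<close>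

lemma reducible_symmetric_dT:
  assumes j: "j < s" and k: "k < s"
  shows "reducible (\<lambda>i. (if i = n + j then T k else 0) + (if i = n + k then T j else 0))"
proof -
  have "ord_ge (int c) (T k * T j)"
    using ord_ge_mult[OF T_ord_a[OF k] T_ord[OF j]] by simp
  then have "T k * T j \<in> R" by (rule ord_ge_c_in_R)
  then obtain P where P: "P \<in> mps_carrier n" "mps_eval (n + s) y P = T k * T j"
    "\<forall>i. grad (n + s) y P i \<in> R" "\<forall>i\<ge>n. grad (n + s) y P i = 0" by (rule obtain_R_series)
  let ?F = "\<lambda>\<alpha>. mps_times (mps_var (n + k)) (mps_var (n + j)) \<alpha> - P \<alpha>"
  have T: "mps_eval (n + s) y (mps_var (n + j)) = T j" "mps_eval (n + s) y (mps_var (n + k)) = T k"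
    using mps_eval_var[OF y_ord, of "n + j"] mps_eval_var[OF y_ord, of "n + k"] j k by (simp_all add: y_T)
  have "?F \<in> mps_carrier (n + s)"
    using P(1) j k by (intro mps_diff_carrier mps_times_carrier mps_var_carrier) (auto intro: mps_carrier_mono)
  moreover have "mps_eval (n + s) y ?F = 0"
    by (simp add: mps_eval_diff mps_eval_times[OF y_ord] P(2) T)
  ultimately have "grad (n + s) y ?F \<in> J" by (rule grad_mem_jacobian_image[OF S_presents y_ord])
  then have "(\<lambda>i. ((if i = n + j then T k else 0) + (if i = n + k then T j else 0)) - grad (n + s) y P i) \<in> J"
    unfolding grad_diff grad_times[OF y_ord] grad_var[OF y_ord] T
    by (rule back_subst[of "\<lambda>v. v \<in> J"]) (auto simp: fun_eq_iff)
  moreover have "reducible (grad (n + s) y P)"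
    using P(3,4) R_subset_S by (intro reducible_dx) auto
  ultimately show ?thesis by (rule reducible_cong_J)
qed

lemma reducible_T_dT_less:
  assumes "j < k" "k < s"
  shows "reducible (\<lambda>i. if i = n + k then T j else 0)"
proof -
  let ?\<gamma> = "\<lambda>i l. if i = n + k \<and> l = j then 1 else 0"
  have "exceptional_vector ?\<gamma> i = (if i = n + k then T j else 0)" for i
  proof -
    have "exceptional_vector ?\<gamma> i = (\<Sum>l<s. if l = j then (if i = n + k then T j else 0) else 0)"
      unfolding exceptional_vector_def using assms by (intro sum.cong) (auto simp: exceptional_def)
    then show ?thesis using assms by simp
  qed
  then have "reduces_to (\<lambda>i. if i = n + k then T j else 0) (\<lambda>i. 0) ?\<gamma>"
    by (simp add: reduces_to_def subalg_0[OF subalg_R] jacobian_image_zero[OF subalg_S])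
  then show ?thesis unfolding reducible_def by blast
qed

text \<open>For k < j the vector is itself exceptional; for j < k the symmetric relation exchanges
  the indices, and for j = k that relation is divided by 2.\<close>

lemma reducible_T_dT:
  assumes j: "j < s" and k: "k < s"
  shows "reducible (\<lambda>i. if i = n + j then T k else 0)"
proof -
  consider "k < j" | "j < k" | "j = k" by linarith
  then show ?thesis
  proof cases
    case 1
    then show ?thesis using reducible_T_dT_less j by blast
  next
    case 2
    have "reducible (\<lambda>i. ((if i = n + j then T k else 0) + (if i = n + k then T j else 0)) +
        - (if i = n + k then T j else 0))"
      using reducible_symmetric_dT[OF j k] reducible_uminus[OF reducible_T_dT_less[OF 2 k]]
      by (rule reducible_add)
    then show ?thesis by (simp add: algebra_simps)
  next
    case 3
    have h: "fls_const (1 / 2) * (f + f) = f" for f :: "'k fls"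
      by (rule fls_eqI) (simp add: fls_mult_const_nth)
    have "reducible (\<lambda>i. fls_const (1 / 2) * ((if i = n + j then T k else 0) + (if i = n + j then T k else 0)))"
      using reducible_smult[OF reducible_symmetric_dT[OF j k], of "1 / 2"] unfolding 3 .
    then show ?thesis by (simp only: h)
  qed
qed

text \<open>Write g as r plus a combination of the T_k. As the T_k have positive order, a non-unit g
  forces the constant term of r to vanish, which is what \<open>reducible_nonunit_dT\<close>
  requires.\<close>

lemma reducible_dT:
  assumes j: "j < s" and g: "g \<in> S" "g \<notin> Units (fls_ring S)"
  shows "reducible (\<lambda>i. if i = n + j then g else 0)"
proof -
  obtain r u where r: "r \<in> R" "g = r + (\<Sum>k<s. fls_const (u k) * T k)"
    using g(1) S_subset overring_gap_monomials[OF ac] unfolding s_eq by blast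
  have "g $$ 0 = 0"
    using nonunit_zero_const[OF subalg_S R_subset_S g(1) S_ord[OF g(1)] g(2)] .
  moreover have "T k $$ 0 = 0" if "k < s" for k
    using T_ord_a[OF that] a_pos by (simp add: ord_ge_def)
  ultimately have "r $$ 0 = 0" by (simp add: r(2) fls_nth_sum fls_mult_const_nth)
  then have "reducible (\<lambda>i. (if i = n + j then r else 0) +
      (\<Sum>k<s. fls_const (u k) * (if i = n + j then T k else 0)))"
    using r(1) j
    by (intro reducible_add reducible_sum ballI reducible_smult reducible_T_dT reducible_nonunit_dT) auto
  moreover have "(\<lambda>i. (if i = n + j then r else 0) +
      (\<Sum>k<s. fls_const (u k) * (if i = n + j then T k else 0))) = (\<lambda>i. if i = n + j then g else 0)"
    by (auto simp: r(2) fun_eq_iff)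
  ultimately show ?thesis by simp
qed

text \<open>The map dy_i \<mapsto> y_i'(t) dt takes values in k((t)), which is torsion-free, so it
  kills torsion.\<close>

lemma torsion_S_orthogonal:
  assumes v: "\<forall>i<n + s. v i \<in> S" "\<forall>i\<ge>n + s. v i = 0"
    and tor: "Omega_class S (n + s) y Gs v \<in> torsion (fls_ring S) (Omega S (n + s) y Gs)"
  shows "(\<Sum>i<n + s. v i * fls_deriv (y i)) = 0"
proof -
  obtain b where b: "b \<in> S" "b \<noteq> 0"
    "b \<odot>\<^bsub>Omega S (n + s) y Gs\<^esub> Omega_class S (n + s) y Gs v = \<zero>\<^bsub>Omega S (n + s) y Gs\<^esub>"
    using tor by (auto simp: torsion_def)
  then have "(\<lambda>i. b * v i) \<in> J"
    by (simp add: Omega_class_smult[OF subalg_S] Omega_class_eq_zero_iff[OF subalg_S])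
  from jacobian_image_orthogonal[OF S_presents y_ord this]
  have "b * (\<Sum>i<n + s. v i * fls_deriv (y i)) = 0" by (simp add: sum_distrib_left mult.assoc)
  then show ?thesis using b(2) by simp
qed

text \<open>The union collapses because representatives differ by elements of the Jacobian image of
  R, which lies in that of S.\<close>

lemma Omega_map_class:
  "Omega_map S (n + s) y Gs (Omega_class R n x Fs u) = Omega_class S (n + s) y Gs u"
proof -
  have "Omega_class S (n + s) y Gs v = Omega_class S (n + s) y Gs u" if "v \<in> Omega_class R n x Fs u" for v
    using that jacobian_image_R_subset
    by (auto simp: Omega_class_eq_iff[OF subalg_S] Omega_class_iff)
  moreover have "u \<in> Omega_class R n x Fs u"
    by (simp add: Omega_class_iff jacobian_image_zero[OF subalg_R])
  ultimately show ?thesis unfolding Omega_map_def by blast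
qed

lemma exists_torsion_preimage:
  fixes \<tau> :: "nat \<Rightarrow> (nat \<Rightarrow> 'k fls) set"
  assumes N: "n * s + (s choose 2) < N"
    and tor: "\<forall>l<N. \<tau> l \<in> torsion (fls_ring S) (Omega S (n + s) y Gs)"
    and ind: "lin_independent \<tau> N (Omega S (n + s) y Gs)"
    and v: "\<forall>l<N. (\<forall>i<n + s. v l i \<in> S) \<and> (\<forall>i\<ge>n + s. v l i = 0) \<and>
        (\<forall>i. n \<le> i \<and> i < n + s \<longrightarrow> v l i \<notin> Units (fls_ring S)) \<and>
        \<tau> l = Omega_class S (n + s) y Gs (v l)"
  shows "\<exists>\<kappa> \<omega>. (\<exists>l<N. \<kappa> l \<noteq> 0) \<and> \<omega> \<in> torsion (fls_ring R) (Omega R n x Fs) \<and>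
     \<omega> \<noteq> \<zero>\<^bsub>Omega R n x Fs\<^esub> \<and>
     Omega_map S (n + s) y Gs \<omega> =
       (\<Oplus>\<^bsub>Omega S (n + s) y Gs\<^esub>l\<in>{..<N}. fls_const (\<kappa> l) \<odot>\<^bsub>Omega S (n + s) y Gs\<^esub> \<tau> l)"
proof -
  let ?\<Omega> = "Omega S (n + s) y Gs" and ?cl = "Omega_class S (n + s) y Gs"
  have "reducible (v l)" if l: "l < N" for l
  proof -
    have vl: "\<forall>i<n + s. v l i \<in> S" "\<forall>i\<ge>n + s. v l i = 0"
      "\<forall>i. n \<le> i \<and> i < n + s \<longrightarrow> v l i \<notin> Units (fls_ring S)" using v l by auto
    have "reducible (\<lambda>i. (if i < n then v l i else 0) + (\<Sum>j<s. if i = n + j then v l (n + j) else 0))"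
      using vl by (intro reducible_add reducible_dx reducible_sum ballI reducible_dT) auto
    moreover have "(\<lambda>i. (if i < n then v l i else 0) + (\<Sum>j<s. if i = n + j then v l (n + j) else 0)) = v l"
    proof
      fix i
      have "(\<Sum>j<s. if i = n + j then v l (n + j) else 0) = (if n \<le> i \<and> i < n + s then v l i else 0)"
      proof -
        have "(\<Sum>j<s. if i = n + j then v l (n + j) else 0) =
            (\<Sum>j<s. if j = i - n then (if n \<le> i then v l i else 0) else 0)"
          by (rule sum.cong) auto
        then show ?thesis by (auto simp: sum.delta)
      qed
      then show "(if i < n then v l i else 0) + (\<Sum>j<s. if i = n + j then v l (n + j) else 0) = v l i"
        using vl(2) by auto
    qed
    ultimately show ?thesis by simp
  qed
  then have "\<forall>l\<in>{..<N}. \<exists>\<rho> \<gamma>. reduces_to (v l) \<rho> \<gamma>" by (simp add: reducible_def)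
  then obtain \<rho> \<gamma> where red: "\<forall>l\<in>{..<N}. reduces_to (v l) (\<rho> l) (\<gamma> l)" by metis
  \<comment> \<open>One unknown for each torsion element and one equation for each exceptional pair:
    this is where the size of N is used.\<close>
  have "card exceptional < card {..<N}" using card_exceptional N by simp
  from exists_nontrivial_solution[OF finite_exceptional finite_lessThan this, of "\<lambda>l p. \<gamma> l (fst p) (snd p)"]
  obtain \<kappa> where \<kappa>: "\<exists>l<N. \<kappa> l \<noteq> 0" "\<forall>p\<in>exceptional. (\<Sum>l<N. \<kappa> l * \<gamma> l (fst p) (snd p)) = 0" by auto
  define w where "w = (\<lambda>i. \<Sum>l<N. fls_const (\<kappa> l) * v l i)"
  define u where "u = (\<lambda>i. \<Sum>l<N. fls_const (\<kappa> l) * \<rho> l i)"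
  have "reduces_to w u (\<lambda>i j. \<Sum>l<N. \<kappa> l * \<gamma> l i j)"
    unfolding w_def u_def using red by (intro reduces_to_sum ballI reduces_to_smult) auto
  \<comment> \<open>By the choice of \<kappa> the exceptional part cancels, leaving w congruent to
    u, which has only dx-components, all in R.\<close>
  moreover have "exceptional_vector (\<lambda>i j. \<Sum>l<N. \<kappa> l * \<gamma> l i j) i = 0" for i
    unfolding exceptional_vector_def using \<kappa>(2) by (intro sum.neutral) auto
  ultimately have u: "\<forall>i<n. u i \<in> R" "\<forall>i\<ge>n. u i = 0" and wu: "(\<lambda>i. w i - u i) \<in> J"
    by (simp_all add: reduces_to_def)
  have "(\<Oplus>\<^bsub>?\<Omega>\<^esub>l\<in>{..<N}. fls_const (\<kappa> l) \<odot>\<^bsub>?\<Omega>\<^esub> \<tau> l) = (\<Oplus>\<^bsub>?\<Omega>\<^esub>l\<in>{..<N}. ?cl (\<lambda>i. fls_const (\<kappa> l) * v l i))"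
  proof -
    interpret abelian_monoid ?\<Omega> by (rule abelian_monoid_Omega[OF subalg_S])
    show ?thesis
      using v subalg_S
      by (intro finsum_cong')
        (auto simp: Omega_class_smult[OF subalg_S] subalg_const subalg_mult intro!: Omega_class_carrier[OF subalg_S])
  qed
  also have "\<dots> = ?cl w"
    unfolding w_def using v subalg_S
    by (intro Omega_finsum_class[OF subalg_S]) (auto simp: subalg_const subalg_mult)
  finally have sum_eq: "(\<Oplus>\<^bsub>?\<Omega>\<^esub>l\<in>{..<N}. fls_const (\<kappa> l) \<odot>\<^bsub>?\<Omega>\<^esub> \<tau> l) = ?cl u"
    using wu Omega_class_eq_iff[OF subalg_S] by simp
  \<comment> \<open>Linear independence over k enters here; by
    \<open>jacobian_image_R_subset\<close>, u is then nonzero in Omega_R as well.\<close>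
  have "?cl u \<noteq> \<zero>\<^bsub>?\<Omega>\<^esub>"
    using ind \<kappa>(1) unfolding lin_independent_def sum_eq[symmetric] by blast
  then have uJ: "u \<notin> J" using Omega_class_eq_zero_iff[OF subalg_S] by blast
  \<comment> \<open>Orthogonality passes from the torsion vectors to w, then to u across the
    Jacobian image, and finally to R, where it implies torsion.\<close>
  have "(\<Sum>i<n + s. w i * fls_deriv (y i)) = 0"
  proof -
    have "(\<Sum>i<n + s. w i * fls_deriv (y i)) =
        (\<Sum>i<n + s. \<Sum>l<N. fls_const (\<kappa> l) * (v l i * fls_deriv (y i)))"
      by (simp add: w_def sum_distrib_right mult.assoc)
    also have "\<dots> = (\<Sum>l<N. fls_const (\<kappa> l) * (\<Sum>i<n + s. v l i * fls_deriv (y i)))"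
      by (subst sum.swap) (simp add: sum_distrib_left)
    also have "\<dots> = 0"
      using v tor torsion_S_orthogonal by (intro sum.neutral) auto
    finally show ?thesis .
  qed
  moreover have "(\<Sum>i<n + s. (w i - u i) * fls_deriv (y i)) = 0"
    by (rule jacobian_image_orthogonal[OF S_presents y_ord wu])
  ultimately have "(\<Sum>i<n + s. u i * fls_deriv (y i)) = 0"
    by (simp add: left_diff_distrib sum_subtractf)
  moreover have "(\<Sum>i<n + s. u i * fls_deriv (y i)) = (\<Sum>i<n. u i * fls_deriv (x i))"
    using u(2) by (intro sum.mono_neutral_cong_right) (auto simp: y_x)
  ultimately have "(\<Sum>i<n. u i * fls_deriv (x i)) = 0" by simp
  from orthogonal_imp_torsion[OF R_presents x_ord_1 n_pos x_0_fps a_pos u this]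
  obtain b where b: "b \<in> R" "b \<noteq> 0" "(\<lambda>i. b * u i) \<in> jacobian_image R n x Fs" by blast
  let ?\<omega> = "Omega_class R n x Fs u"
  have "?\<omega> \<in> torsion (fls_ring R) (Omega R n x Fs)"
    unfolding torsion_def using b u
    by (auto simp: Omega_class_smult[OF subalg_R] Omega_class_eq_zero_iff[OF subalg_R]
        intro!: Omega_class_carrier[OF subalg_R] bexI[of _ b])
  moreover have "?\<omega> \<noteq> \<zero>\<^bsub>Omega R n x Fs\<^esub>"
    using uJ jacobian_image_R_subset by (auto simp: Omega_class_eq_zero_iff[OF subalg_R])
  moreover have "Omega_map S (n + s) y Gs ?\<omega> =
      (\<Oplus>\<^bsub>?\<Omega>\<^esub>l\<in>{..<N}. fls_const (\<kappa> l) \<odot>\<^bsub>?\<Omega>\<^esub> \<tau> l)"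
    by (simp only: Omega_map_class sum_eq)
  ultimately show ?thesis
    using \<kappa>(1) by (intro exI[of _ \<kappa>] exI[of _ ?\<omega>] conjI)
qed

end

theorem theorem4p9:
  fixes n s N :: nat
    and x T y :: "nat \<Rightarrow> 'k::{alg_closed_field, field_char_0} fls"
    and R S :: "'k fls set"
    and Fs Gs :: "'k mps list"
    and \<Omega>\<^sub>R \<Omega>\<^sub>S :: "('k fls, (nat \<Rightarrow> 'k fls) set) module"
    and d :: "nat \<Rightarrow> (nat \<Rightarrow> 'k fls) set"
    and \<tau> :: "nat \<Rightarrow> (nat \<Rightarrow> 'k fls) set"
  assumes "0 < n"
    and "\<forall>i<n. 0 < fls_subdegree (x i)"
    and "mono_on {..<n} (\<lambda>i. fls_subdegree (x i))"
    and "x 0 = fls_X_intpow (fls_subdegree (x 0))"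
    and "R = power_series_alg n x"
    and "int_closure R = range fps_to_fls"
    and "minimal_generators n x R"
    and "conductor R \<subseteq> maximal_id R \<cdot>\<^bsub>fls_ring R\<^esub> maximal_id R"
    and "s = reduced_type R (x 0)"
    and "S = adjoin_conductor R (x 0)"
    and "T = gap_monomial R (nat (fls_subdegree (x 0)))"
    and "y = append_tuple n x T"
    and "presents n x Fs R"
    and "presents (n + s) y Gs S"
    and "\<Omega>\<^sub>R = Omega R n x Fs"
    and "\<Omega>\<^sub>S = Omega S (n + s) y Gs"
    and "d = Omega_d S (n + s) y Gs"
    and "N = n * s + (s choose 2) + 1"
    and "module_length (fls_ring S) \<Omega>\<^sub>S (torsion (fls_ring S) \<Omega>\<^sub>S) \<ge> enat N"
    and "\<forall>l<N. \<tau> l \<in> torsion (fls_ring S) \<Omega>\<^sub>S"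
    and "lin_independent \<tau> N \<Omega>\<^sub>S"
    and "\<forall>l<N. \<exists>r r'. (\<forall>i<n. r i \<in> S) \<and> (\<forall>j<s. r' j \<in> S \<and> r' j \<notin> Units (fls_ring S)) \<and>
           \<tau> l = (\<Oplus>\<^bsub>\<Omega>\<^sub>S\<^esub>i\<in>{..<n}. r i \<odot>\<^bsub>\<Omega>\<^sub>S\<^esub> d i) \<oplus>\<^bsub>\<Omega>\<^sub>S\<^esub>
                 (\<Oplus>\<^bsub>\<Omega>\<^sub>S\<^esub>j\<in>{..<s}. r' j \<odot>\<^bsub>\<Omega>\<^sub>S\<^esub> d (n + j))"
  shows "(\<exists>c \<omega>. (\<exists>l<N. c l \<noteq> 0) \<and>
             \<omega> \<in> torsion (fls_ring R) \<Omega>\<^sub>R \<and> \<omega> \<noteq> \<zero>\<^bsub>\<Omega>\<^sub>R\<^esub> \<and>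
             Omega_map S (n + s) y Gs \<omega> = (\<Oplus>\<^bsub>\<Omega>\<^sub>S\<^esub>l\<in>{..<N}. fls_const (c l) \<odot>\<^bsub>\<Omega>\<^sub>S\<^esub> \<tau> l))
         \<and> torsion (fls_ring R) \<Omega>\<^sub>R \<noteq> {\<zero>\<^bsub>\<Omega>\<^sub>R\<^esub>}"
proof -
  define a where "a = nat (fls_subdegree (x 0))"
  have sd: "fls_subdegree (x 0) = int a" and a: "0 < a" using assms(1,2) by (auto simp: a_def)
  have x0: "x 0 = fls_X ^ a" using assms(4) unfolding sd by (simp add: fls_X_power_conv_shift_1)
  interpret branch n x R a
  proof
    have "int a \<le> fls_subdegree (x i)" if "i < n" for i
      using mono_onD[OF assms(3), of 0 i] that sd by simp
    then show "\<forall>i<n. ord_ge (int a) (x i)" by (simp add: ord_ge_iff)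
  qed (use assms a x0 in auto)
  have ac2: "2 * a \<le> conductor_val R" by (rule twice_a_le_c[OF assms(8)])
  \<comment> \<open>This identifies the T_j in the presentation of S with all the gap
    monomials.\<close>
  have s_eq: "s = card (late_gaps R a)" using assms(9) reduced_type_eq ac2 by simp
  have S_sub: "S \<subseteq> overring" using assms(10) adjoin_conductor_subset ac2 by simp
  interpret blowup n x R a S y Fs Gs s
    by unfold_locales (use ac2 s_eq S_sub assms in \<open>simp_all add: a_def\<close>)
  let ?\<Omega> = "Omega S (n + s) y Gs" and ?cl = "Omega_class S (n + s) y Gs"
  let ?e = "\<lambda>i i'. if i' = i then 1 else (0 :: 'k fls)"
  interpret \<Omega>: abelian_monoid ?\<Omega> by (rule abelian_monoid_Omega[OF subalg_S])
  have "\<forall>l\<in>{..<N}. \<exists>v. (\<forall>i<n + s. v i \<in> S) \<and> (\<forall>i\<ge>n + s. v i = 0) \<and>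
      (\<forall>i. n \<le> i \<and> i < n + s \<longrightarrow> v i \<notin> Units (fls_ring S)) \<and> \<tau> l = ?cl v"
  proof
    fix l assume "l \<in> {..<N}"
    with assms(22) obtain r r' where r: "\<forall>i<n. r i \<in> S" and r': "\<forall>j<s. r' j \<in> S \<and> r' j \<notin> Units (fls_ring S)"
      and \<tau>: "\<tau> l = (\<Oplus>\<^bsub>?\<Omega>\<^esub>i\<in>{..<n}. r i \<odot>\<^bsub>?\<Omega>\<^esub> d i) \<oplus>\<^bsub>?\<Omega>\<^esub> (\<Oplus>\<^bsub>?\<Omega>\<^esub>j\<in>{..<s}. r' j \<odot>\<^bsub>?\<Omega>\<^esub> d (n + j))"
      unfolding assms(16) by blast
    have d: "d i = ?cl (?e i)" for i by (simp add: assms(17) Omega_d_def)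
    have 1: "(\<Oplus>\<^bsub>?\<Omega>\<^esub>i\<in>{..<n}. r i \<odot>\<^bsub>?\<Omega>\<^esub> d i) = ?cl (\<lambda>i'. \<Sum>i<n. r i * ?e i i')"
    proof -
      have "(\<Oplus>\<^bsub>?\<Omega>\<^esub>i\<in>{..<n}. r i \<odot>\<^bsub>?\<Omega>\<^esub> d i) = (\<Oplus>\<^bsub>?\<Omega>\<^esub>i\<in>{..<n}. ?cl (\<lambda>i'. r i * ?e i i'))"
        using r subalg_S by (intro \<Omega>.finsum_cong')
          (auto simp: d Omega_class_smult[OF subalg_S] subalg_0 intro!: Omega_class_carrier[OF subalg_S])
      also have "\<dots> = ?cl (\<lambda>i'. \<Sum>i<n. r i * ?e i i')"
        using r subalg_S by (intro Omega_finsum_class[OF subalg_S]) (auto simp: subalg_0)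
      finally show ?thesis .
    qed
    have 2: "(\<Oplus>\<^bsub>?\<Omega>\<^esub>j\<in>{..<s}. r' j \<odot>\<^bsub>?\<Omega>\<^esub> d (n + j)) = ?cl (\<lambda>i'. \<Sum>j<s. r' j * ?e (n + j) i')"
    proof -
      have "(\<Oplus>\<^bsub>?\<Omega>\<^esub>j\<in>{..<s}. r' j \<odot>\<^bsub>?\<Omega>\<^esub> d (n + j)) = (\<Oplus>\<^bsub>?\<Omega>\<^esub>j\<in>{..<s}. ?cl (\<lambda>i'. r' j * ?e (n + j) i'))"
        using r' subalg_S by (intro \<Omega>.finsum_cong')
          (auto simp: d Omega_class_smult[OF subalg_S] subalg_0 intro!: Omega_class_carrier[OF subalg_S])
      also have "\<dots> = ?cl (\<lambda>i'. \<Sum>j<s. r' j * ?e (n + j) i')"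
        using r' subalg_S by (intro Omega_finsum_class[OF subalg_S]) (auto simp: subalg_0)
      finally show ?thesis .
    qed
    \<comment> \<open>The concatenated coefficient vector; its entries from n up to n + s are the
      non-unit coefficients of the dT_j.\<close>
    define v where "v i = (if i < n then r i else if i < n + s then r' (i - n) else 0)" for i
    have "(\<Sum>i<n. r i * ?e i i') + (\<Sum>j<s. r' j * ?e (n + j) i') = v i'" for i'
    proof -
      have "(\<Sum>i<n. r i * ?e i i') = (\<Sum>i<n. if i = i' then r i' else 0)" by (rule sum.cong) auto
      moreover have "(\<Sum>j<s. r' j * ?e (n + j) i') =
          (\<Sum>j<s. if j = i' - n then (if n \<le> i' then r' (i' - n) else 0) else 0)"
        by (rule sum.cong) auto
      ultimately show ?thesis by (auto simp: v_def)
    qed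
    then have "\<tau> l = ?cl v" unfolding \<tau> 1 2 Omega_class_add[OF subalg_S] by simp
    then show "\<exists>v. (\<forall>i<n + s. v i \<in> S) \<and> (\<forall>i\<ge>n + s. v i = 0) \<and>
      (\<forall>i. n \<le> i \<and> i < n + s \<longrightarrow> v i \<notin> Units (fls_ring S)) \<and> \<tau> l = ?cl v"
      using r r' by (intro exI[of _ v]) (auto simp: v_def)
  qed
  then obtain v where "\<forall>l\<in>{..<N}. (\<forall>i<n + s. v l i \<in> S) \<and> (\<forall>i\<ge>n + s. v l i = 0) \<and>
      (\<forall>i. n \<le> i \<and> i < n + s \<longrightarrow> v l i \<notin> Units (fls_ring S)) \<and> \<tau> l = ?cl (v l)"
    by metis
  then have v: "\<forall>l<N. (\<forall>i<n + s. v l i \<in> S) \<and> (\<forall>i\<ge>n + s. v l i = 0) \<and>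
      (\<forall>i. n \<le> i \<and> i < n + s \<longrightarrow> v l i \<notin> Units (fls_ring S)) \<and> \<tau> l = ?cl (v l)" by simp
  have "n * s + (s choose 2) < N" by (simp add: assms(18))
  from exists_torsion_preimage[OF this _ _ v] assms(20,21)
  have *: "\<exists>c \<omega>. (\<exists>l<N. c l \<noteq> 0) \<and> \<omega> \<in> torsion (fls_ring R) \<Omega>\<^sub>R \<and> \<omega> \<noteq> \<zero>\<^bsub>\<Omega>\<^sub>R\<^esub> \<and>
      Omega_map S (n + s) y Gs \<omega> = (\<Oplus>\<^bsub>\<Omega>\<^sub>S\<^esub>l\<in>{..<N}. fls_const (c l) \<odot>\<^bsub>\<Omega>\<^sub>S\<^esub> \<tau> l)"
    unfolding assms(15,16) by blast
  then show ?thesis by blast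
qed

end
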